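(* Let $\Delta\subset\mathfrak t^*$ be a simple (or smooth) polytope with facets $F_1,\dots,F_N$. The following conditions are equivalent: (i) every $H\in\mathfrak t$ is mass linear on $\Delta$; (ii) every $H\in\mathfrak t$ is inessential on $\Delta$; (iii) $\Delta$ is a product of simplices; (iv) $\bigcap_{i\in I}F_i=\emptyset$ for every equivalence class of facets $I$; in particular, $|I|>1$.
   Context: There are two versions of the statement: one for simple polytopes, one for smooth polytopes, with the notions below read accordingly. Let $\mathfrak t$ be a finite-dimensional real vector space with dual $\mathfrak t^*$ and pairing $\langle\cdot,\cdot\rangle$. A polytope is a bounded set $\Delta=\bigcap_{i=1}^N\{x\in\mathfrak t^*\mid\langle\eta_i,x\rangle\le\kappa_i\}$ with outward conormals $\eta_i\in\mathfrak t$ and support numbers $\kappa_i\in\mathbb R$, where $\Delta$ affinely spans $\mathfrak t^*$ and each facet $F_i=\Delta\cap\{\langle\eta_i,x\rangle=\kappa_i\}$ affinely spans a hyperplane. It is simple if exactly $\dim\mathfrak t$ facets meet at each vertex. Given an integer lattice $\ell\subset\mathfrak t$, a simple polytope is smooth if the conormals can be chosen in $\ell$ and, at each vertex, the primitive outward conormals of the facets meeting there form a basis of $\ell$. With the $\eta_i$ fixed, for $\kappa'\in\mathbb R^N$ let $\Delta(\kappa')=\bigcap_i\{\langle\eta_i,x\rangle\le\kappa'_i\}$, with facets $F_i(\kappa')$. The chamber $\mathcal C_\Delta\subset\mathbb R^N$ is the connected component containing $\kappa$ of the set of $\kappa'$ for which $\Delta(\kappa')$ is a simple polytope (with $N$ facets,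 that is, $\Delta(\kappa')$ affinely spans $\mathfrak t^*$, each of the $N$ sets $\Delta(\kappa')\cap\{\langle\eta_i,x\rangle=\kappa'_i\}$ affinely spans a hyperplane, and exactly $\dim\mathfrak t$ of these $N$ facets meet at each vertex). $c_\Delta(\kappa')$ is the center of mass of $\Delta(\kappa')$. $H\in\mathfrak t$ is mass linear on $\Delta$ if $\langle H,c_\Delta(\kappa')\rangle=\sum_i\gamma_i\kappa'_i+C$ on $\mathcal C_\Delta$ for some real constants $\gamma_i,C$. A symmetry of a polytope is an affine map $a:\mathfrak t^*\to\mathfrak t^*$ taking the polytope to itself; in the smooth case its linear part is required to induce an automorphism of the integer lattice. A robust symmetry of $\Delta$ is a linear map $\hat a:\mathfrak t^*\to\mathfrak t^*$ such that for every $\kappa'\in\mathcal C_\Delta$ there is a symmetry $a_{\kappa'}$ of $\Delta(\kappa')$ with associated linear map $\hat a$. Facets $F_i$, $F_j$ are equivalent if there is a robust symmetry $\hat a$ such that each $a_{\kappa'}$ takes $F_i(\kappa')$ to $F_j(\kappa')$; classes are viewed as subsets of $\{1,\dots,N\}$. The conormals are normalized so that for every robust symmetry $\hat a$ and every $i$ there is $j$ with $\hat a^*(\eta_i)=\eta_j$ (always possible); in the smooth case the $\eta_i$ are the primitive outward conormals. $H\in\mathfrak t$ is inessential if $H=\sum_i\beta_i\eta_i$ with $\beta_i\in\mathbb R$ and $\sum_{i\in I}\beta_i=0$ for every equivalence class $I$. Polytopes are identified up to affine equivalence (by affine isomorphisms, whose linear parts preserve the integer lattices in the smooth case). A $k$-simplex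 is a $k$-dimensional polytope with $k+1$ facets (smooth, in the smooth case). "$\Delta$ is a product of simplices" means that $\Delta$ is affine equivalent to a product of simplices, where the product of $\hat\Delta\subset\hat{\mathfrak t}^*$ and $\tilde\Delta\subset\tilde{\mathfrak t}^*$ is $\hat\Delta\times\tilde\Delta\subset\hat{\mathfrak t}^*\times\tilde{\mathfrak t}^*$ (with the product lattice in the smooth case). *)

theory Defs
  imports "HOL-Analysis.Analysis"
begin

text \<open>
  The space and its dual are both modelled by a Euclidean space (or by a linear subspace
  \<open>V\<close> of one, needed for the factors of products), the pairing being the inner product.
  A polytope is given by its family of outward conormals \<open>\<eta>\<close> and support numbers \<open>\<kappa>\<close>,
  indexed by a set \<open>I\<close>.
\<close>

definition halfspace_inter ::
  "'a::euclidean_space set \<Rightarrow> 'i set \<Rightarrow> ('i \<Rightarrow> 'a) \<Rightarrow> ('i \<Rightarrow> real) \<Rightarrow> 'a set" where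
  "halfspace_inter V I \<eta> \<kappa> = {x \<in> V. \<forall>i\<in>I. \<eta> i \<bullet> x \<le> \<kappa> i}"

definition facet ::
  "'a::euclidean_space set \<Rightarrow> 'i set \<Rightarrow> ('i \<Rightarrow> 'a) \<Rightarrow> ('i \<Rightarrow> real) \<Rightarrow> 'i \<Rightarrow> 'a set" where
  "facet V I \<eta> \<kappa> i = halfspace_inter V I \<eta> \<kappa> \<inter> {x. \<eta> i \<bullet> x = \<kappa> i}"

definition facet_polytope ::
  "'a::euclidean_space set \<Rightarrow> 'i set \<Rightarrow> ('i \<Rightarrow> 'a) \<Rightarrow> ('i \<Rightarrow> real) \<Rightarrow> bool" where
  "facet_polytope V I \<eta> \<kappa> \<longleftrightarrow>
     subspace V \<and> finite I \<and> \<eta> ` I \<subseteq> V - {0} \<and>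
     bounded (halfspace_inter V I \<eta> \<kappa>) \<and>
     affine hull (halfspace_inter V I \<eta> \<kappa>) = V \<and>
     (\<forall>i\<in>I. affine hull (facet V I \<eta> \<kappa> i) = {x \<in> V. \<eta> i \<bullet> x = \<kappa> i}) \<and>
     inj_on (facet V I \<eta> \<kappa>) I"

definition simple_polytope ::
  "'a::euclidean_space set \<Rightarrow> 'i set \<Rightarrow> ('i \<Rightarrow> 'a) \<Rightarrow> ('i \<Rightarrow> real) \<Rightarrow> bool" where
  "simple_polytope V I \<eta> \<kappa> \<longleftrightarrow>
     facet_polytope V I \<eta> \<kappa> \<and>
     (\<forall>v. v extreme_point_of (halfspace_inter V I \<eta> \<kappa>) \<longrightarrow>
          card {i \<in> I. v \<in> facet V I \<eta> \<kappa> i} = dim V)"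

definition int_span :: "'a::euclidean_space set \<Rightarrow> 'a set" where
  "int_span B = {\<Sum>b\<in>B. of_int (c b) *\<^sub>R b | c :: 'a \<Rightarrow> int. True}"

definition lattice_basis :: "'a::euclidean_space set \<Rightarrow> 'a set \<Rightarrow> bool" where
  "lattice_basis L B \<longleftrightarrow> independent B \<and> int_span B = L"

definition integer_lattice :: "'a::euclidean_space set \<Rightarrow> 'a set \<Rightarrow> bool" where
  "integer_lattice V L \<longleftrightarrow> (\<exists>B. lattice_basis L B \<and> span B = V)"

definition primitive_vector :: "'a::euclidean_space set \<Rightarrow> 'a \<Rightarrow> bool" where
  "primitive_vector L v \<longleftrightarrow>
     v \<in> L \<and> v \<noteq> 0 \<and> (\<forall>w\<in>L. \<forall>k::nat. v = of_nat k *\<^sub>R w \<longrightarrow> k = 1)"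

text \<open>A smooth polytope, presented by its primitive outward conormals.\<close>

definition smooth_polytope ::
  "'a::euclidean_space set \<Rightarrow> 'a set \<Rightarrow> 'i set \<Rightarrow> ('i \<Rightarrow> 'a) \<Rightarrow> ('i \<Rightarrow> real) \<Rightarrow> bool" where
  "smooth_polytope V L I \<eta> \<kappa> \<longleftrightarrow>
     integer_lattice V L \<and> simple_polytope V I \<eta> \<kappa> \<and>
     (\<forall>i\<in>I. primitive_vector L (\<eta> i)) \<and>
     (\<forall>v. v extreme_point_of (halfspace_inter V I \<eta> \<kappa>) \<longrightarrow>
          lattice_basis L (\<eta> ` {i \<in> I. v \<in> facet V I \<eta> \<kappa> i}))"

text \<open>
  From here on the polytope lives in the whole space and its facets are indexed by a finite
  type, so that the support numbers form a point of \<open>real ^ 'i\<close>.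
\<close>

abbreviation polytope_of :: "('i::finite \<Rightarrow> 'a::euclidean_space) \<Rightarrow> real ^ 'i \<Rightarrow> 'a set" where
  "polytope_of \<eta> \<kappa> \<equiv> halfspace_inter UNIV UNIV \<eta> (($) \<kappa>)"

abbreviation facet_of_index ::
  "('i::finite \<Rightarrow> 'a::euclidean_space) \<Rightarrow> real ^ 'i \<Rightarrow> 'i \<Rightarrow> 'a set" where
  "facet_of_index \<eta> \<kappa> \<equiv> facet UNIV UNIV \<eta> (($) \<kappa>)"

definition chamber ::
  "('i::finite \<Rightarrow> 'a::euclidean_space) \<Rightarrow> real ^ 'i \<Rightarrow> (real ^ 'i) set" where
  "chamber \<eta> \<kappa> =
     connected_component_set {\<kappa>'. simple_polytope UNIV UNIV \<eta> (($) \<kappa>')} \<kappa>"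

definition center_of_mass :: "'a::euclidean_space set \<Rightarrow> 'a" where
  "center_of_mass P = (LINT x:P|lborel. x) /\<^sub>R measure lborel P"

definition mass_linear ::
  "('i::finite \<Rightarrow> 'a::euclidean_space) \<Rightarrow> real ^ 'i \<Rightarrow> 'a \<Rightarrow> bool" where
  "mass_linear \<eta> \<kappa> H \<longleftrightarrow>
     (\<exists>(\<gamma> :: 'i \<Rightarrow> real) C. \<forall>\<kappa>' \<in> chamber \<eta> \<kappa>.
        H \<bullet> center_of_mass (polytope_of \<eta> \<kappa>') = (\<Sum>i\<in>UNIV. \<gamma> i * \<kappa>' $ i) + C)"

text \<open>
  The argument \<open>\<Lambda>\<close> selects the version: \<open>None\<close> is the setting of simple polytopes,
  \<open>Some L\<close> that of smooth polytopes with integer lattice \<open>L\<close>. The lattice lives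
  on the conormal side, where the linear part \<open>A\<close> of a symmetry acts by its adjoint.
\<close>

definition symmetry ::
  "'a::euclidean_space set option \<Rightarrow> 'a set \<Rightarrow> ('a \<Rightarrow> 'a) \<Rightarrow> ('a \<Rightarrow> 'a) \<Rightarrow> bool" where
  "symmetry \<Lambda> P a A \<longleftrightarrow>
     linear A \<and> (\<exists>b. \<forall>x. a x = A x + b) \<and> a ` P = P \<and>
     (case \<Lambda> of None \<Rightarrow> True | Some L \<Rightarrow> bij_betw (adjoint A) L L)"

definition robust_symmetry ::
  "'a::euclidean_space set option \<Rightarrow> ('i::finite \<Rightarrow> 'a) \<Rightarrow> real ^ 'i \<Rightarrow> ('a \<Rightarrow> 'a) \<Rightarrow> bool" where
  "robust_symmetry \<Lambda> \<eta> \<kappa> A \<longleftrightarrow>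
     linear A \<and> (\<forall>\<kappa>' \<in> chamber \<eta> \<kappa>. \<exists>a. symmetry \<Lambda> (polytope_of \<eta> \<kappa>') a A)"

text \<open>
  Since the polytopes are bounded, the symmetry with a given linear part is unique; hence the
  quantifier over \<open>a\<close> below only names it.
\<close>

definition facets_equivalent ::
  "'a::euclidean_space set option \<Rightarrow> ('i::finite \<Rightarrow> 'a) \<Rightarrow> real ^ 'i \<Rightarrow> 'i \<Rightarrow> 'i \<Rightarrow> bool" where
  "facets_equivalent \<Lambda> \<eta> \<kappa> i j \<longleftrightarrow>
     (\<exists>A. robust_symmetry \<Lambda> \<eta> \<kappa> A \<and>
          (\<forall>\<kappa>' \<in> chamber \<eta> \<kappa>. \<forall>a. symmetry \<Lambda> (polytope_of \<eta> \<kappa>') a A \<longrightarrow>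
             a ` facet_of_index \<eta> \<kappa>' i = facet_of_index \<eta> \<kappa>' j))"

definition facet_classes ::
  "'a::euclidean_space set option \<Rightarrow> ('i::finite \<Rightarrow> 'a) \<Rightarrow> real ^ 'i \<Rightarrow> 'i set set" where
  "facet_classes \<Lambda> \<eta> \<kappa> = UNIV // {(i, j). facets_equivalent \<Lambda> \<eta> \<kappa> i j}"

definition normalized_conormals ::
  "'a::euclidean_space set option \<Rightarrow> ('i::finite \<Rightarrow> 'a) \<Rightarrow> real ^ 'i \<Rightarrow> bool" where
  "normalized_conormals \<Lambda> \<eta> \<kappa> \<longleftrightarrow>
     (\<forall>A. robust_symmetry \<Lambda> \<eta> \<kappa> A \<longrightarrow> (\<forall>i. \<exists>j. adjoint A (\<eta> i) = \<eta> j))"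

text \<open>
  In the smooth case the normalization is that the conormals are primitive, which is part of
  \<open>smooth_polytope\<close>.
\<close>

definition simple_or_smooth_polytope ::
  "'a::euclidean_space set option \<Rightarrow> ('i::finite \<Rightarrow> 'a) \<Rightarrow> real ^ 'i \<Rightarrow> bool" where
  "simple_or_smooth_polytope \<Lambda> \<eta> \<kappa> \<longleftrightarrow>
     (case \<Lambda> of
        None \<Rightarrow> simple_polytope UNIV UNIV \<eta> (($) \<kappa>) \<and> normalized_conormals None \<eta> \<kappa>
      | Some L \<Rightarrow> smooth_polytope UNIV L UNIV \<eta> (($) \<kappa>))"

definition inessential ::
  "'a::euclidean_space set option \<Rightarrow> ('i::finite \<Rightarrow> 'a) \<Rightarrow> real ^ 'i \<Rightarrow> 'a \<Rightarrow> bool" where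
  "inessential \<Lambda> \<eta> \<kappa> H \<longleftrightarrow>
     (\<exists>\<beta> :: 'i \<Rightarrow> real. H = (\<Sum>i\<in>UNIV. \<beta> i *\<^sub>R \<eta> i) \<and>
        (\<forall>I \<in> facet_classes \<Lambda> \<eta> \<kappa>. (\<Sum>i\<in>I. \<beta> i) = 0))"

definition simplex_in ::
  "'a::euclidean_space set \<Rightarrow> 'a set \<Rightarrow> bool" where
  "simplex_in V S \<longleftrightarrow>
     (\<exists>(I :: nat set) \<eta> \<kappa>. facet_polytope V I \<eta> \<kappa> \<and> card I = dim V + 1 \<and>
        S = halfspace_inter V I \<eta> \<kappa>)"

definition smooth_simplex_in ::
  "'a::euclidean_space set \<Rightarrow> 'a set \<Rightarrow> 'a set \<Rightarrow> bool" where
  "smooth_simplex_in V L S \<longleftrightarrow>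
     (\<exists>(I :: nat set) \<eta> \<kappa>. smooth_polytope V L I \<eta> \<kappa> \<and> card I = dim V + 1 \<and>
        S = halfspace_inter V I \<eta> \<kappa>)"

text \<open>
  The product of spaces \<open>V j\<close> (\<open>j < r\<close>) is \<open>PiE {..<r} V\<close>, and a linear map from it to
  \<open>'a\<close> has the form \<open>product_linear r A\<close> with each \<open>A j\<close> linear.
\<close>

definition product_linear ::
  "nat \<Rightarrow> (nat \<Rightarrow> 'a \<Rightarrow> 'a) \<Rightarrow> (nat \<Rightarrow> 'a) \<Rightarrow> 'a::euclidean_space" where
  "product_linear r A f = (\<Sum>j<r. A j (f j))"

text \<open>
  The affine map with linear part \<open>product_linear r A\<close> and translation part \<open>b\<close> is an affine
  isomorphism of the product space onto \<open>'a\<close> taking the product of the \<open>S j\<close> to \<open>P\<close>.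
\<close>

definition product_affine_equivalence ::
  "nat \<Rightarrow> (nat \<Rightarrow> 'a set) \<Rightarrow> (nat \<Rightarrow> 'a \<Rightarrow> 'a) \<Rightarrow> 'a \<Rightarrow> (nat \<Rightarrow> 'a set) \<Rightarrow>
     'a::euclidean_space set \<Rightarrow> bool" where
  "product_affine_equivalence r V A b S P \<longleftrightarrow>
     (\<forall>j<r. linear (A j)) \<and>
     bij_betw (product_linear r A) (PiE {..<r} V) UNIV \<and>
     (\<lambda>f. product_linear r A f + b) ` PiE {..<r} S = P"

text \<open>
  The dual map of \<open>product_linear r A\<close> takes the lattice \<open>L\<close> to the product lattice; the pairing
  of \<open>w\<close> and \<open>f\<close> in the product is the sum of the \<open>w j \<bullet> f j\<close>, so the dual map sends \<open>h\<close>
  to the \<open>w\<close> that satisfies the equation below for all \<open>f\<close>.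
\<close>

definition product_lattice_preserving ::
  "nat \<Rightarrow> (nat \<Rightarrow> 'a set) \<Rightarrow> (nat \<Rightarrow> 'a \<Rightarrow> 'a) \<Rightarrow> (nat \<Rightarrow> 'a set) \<Rightarrow>
     'a::euclidean_space set \<Rightarrow> bool" where
  "product_lattice_preserving r V A M L \<longleftrightarrow>
     {w \<in> PiE {..<r} V. \<exists>h\<in>L. \<forall>f \<in> PiE {..<r} V.
        (\<Sum>j<r. w j \<bullet> f j) = h \<bullet> product_linear r A f} = PiE {..<r} M"

definition product_of_simplices ::
  "'a::euclidean_space set option \<Rightarrow> 'a set \<Rightarrow> bool" where
  "product_of_simplices \<Lambda> P \<longleftrightarrow>
     (case \<Lambda> of
        None \<Rightarrow>
          \<exists>r V S A b. (\<forall>j<r. simplex_in (V j) (S j)) \<and>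
            product_affine_equivalence r V A b S P
      | Some L \<Rightarrow>
          \<exists>r V S A b M. (\<forall>j<r. smooth_simplex_in (V j) (M j) (S j)) \<and>
            product_affine_equivalence r V A b S P \<and>
            product_lattice_preserving r V A M L)"

end

theory Submission
  imports Defs "HOL-Combinatorics.Transposition"
begin

text \<open>
  All four conditions are equivalent to a condition on the linear relations among the conormals,
  \<open>simplex_blocks\<close>: the facets are partitioned into blocks such that the conormals of each block satisfy
  one relation with positive coefficients, and these relations span all others. That this says
  "product of simplices" is linear algebra: the space splits into the spans of the blocks, and in each
  summand the block cuts out a simplex; conversely, facet inequalities are determined up to positive
  factors by the polytope (\<open>blocks_if_product_of_simplices\<close>, \<open>product_if_blocks\<close>). The normalization of
  the conormals makes all coefficients of a block equal (\<open>blocks_normalized\<close>). Permuting the conormals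
  of a block then gives robust symmetries, so that classes are unions of blocks, every \<open>H\<close> is
  inessential, and the facets of a class have no common point.

  For the way back from inessentiality or from empty intersections, the key is that every relation is constant on the classes
  (\<open>relation_constant_on_classes\<close>), because the translation part of a robust symmetry exists for all
  support numbers near \<open>\<kappa>\<close>. Each of the two conditions produces a relation with the value \<open>1\<close> on a
  given class and with the value \<open>0\<close> elsewhere, and then the classes themselves are blocks.

  Inessential functions are mass linear since symmetries fix the center of mass. That all \<open>H\<close> are mass
  linear means that the center \<open>c\<close> is an affine function of the support numbers. Let
  \<open>f i = \<kappa> $ i - \<eta> i \<bullet> c\<close> be the slack of the center, an affine function too. If the \<open>i\<close>-th support
  number grows, then the added slab lies between the old and the new facet hyperplane; comparing the first moments
  shows that the logarithm of the volume has the partial derivative \<open>m i / f i\<close>, where \<open>m i > 0\<close> is the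
  constant \<open>i\<close>-th partial derivative of \<open>\<eta> i \<bullet> c\<close>.
  Equality of mixed partial derivatives gives \<open>m i * D i j / (f i)\<^sup>2 = m j * D j i / (f j)\<^sup>2\<close>, where
  \<open>D i j\<close> is the constant \<open>j\<close>-th partial derivative of \<open>f i\<close>. So \<open>f i\<close> and \<open>f j\<close> are proportional whenever
  \<open>D i j\<close> is nonzero. By translation invariance the rows of \<open>D\<close> are relations among the conormals, and
  they span all relations; the blocks are the classes of proportional rows.
\<close>

section \<open>Linear algebra\<close>

text \<open>
  A map on a family of vectors extends linearly as soon as it respects the linear relations of the
  family. Symmetries, translations and vertices are all constructed in this way.
\<close>

lemma linear_extension_of_family:
  fixes x :: "'k \<Rightarrow> 'a::euclidean_space" and y :: "'k \<Rightarrow> 'b::real_vector"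
  assumes "finite K"
    and rel: "\<And>\<beta>. (\<Sum>k\<in>K. \<beta> k *\<^sub>R x k) = 0 \<Longrightarrow> (\<Sum>k\<in>K. \<beta> k *\<^sub>R y k) = 0"
  obtains f where "linear f" "\<And>k. k \<in> K \<Longrightarrow> f (x k) = y k"
proof -
  obtain B where B: "B \<subseteq> x ` K" "independent B" "x ` K \<subseteq> span B"
    by (rule maximal_independent_subset)
  have finB: "finite B" using B(1) \<open>finite K\<close> finite_subset by blast
  obtain g where g: "\<And>b. b \<in> B \<Longrightarrow> g b \<in> K \<and> x (g b) = b"
    using B(1) by (metis image_iff subset_iff)
  have inj: "inj_on g B" by (metis g inj_onI)
  obtain f where f: "linear f" "\<forall>b\<in>B. f b = y (g b)"
    using linear_independent_extend[OF B(2), of "\<lambda>b. y (g b)"] by blast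
  have "f (x k) = y k" if k: "k \<in> K" for k
  proof -
    have "x k \<in> span B" using B(3) k by blast
    then obtain r where r: "x k = (\<Sum>b\<in>B. r b *\<^sub>R b)"
      using span_finite[OF finB] by auto
    \<comment> \<open>the relation that expresses \<open>x k\<close> in the basis, with one index \<open>g b\<close> for each basis vector \<open>b\<close>\<close>
    define \<beta> where "\<beta> l = (if l = k then 1 else 0) - (if l \<in> g ` B then r (x l) else 0)" for l
    have *: "(\<Sum>l\<in>K. \<beta> l *\<^sub>R h l) = h k - (\<Sum>b\<in>B. r b *\<^sub>R h (g b))" for h :: "'k \<Rightarrow> 'c::real_vector"
    proof -
      have "(\<Sum>l\<in>K. \<beta> l *\<^sub>R h l) =
        (\<Sum>l\<in>K. if l = k then h l else 0) - (\<Sum>l\<in>K. if l \<in> g ` B then r (x l) *\<^sub>R h l else 0)"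
        unfolding sum_subtractf[symmetric] by (rule sum.cong) (auto simp: \<beta>_def algebra_simps)
      also have "(\<Sum>l\<in>K. if l = k then h l else 0) = h k" using k \<open>finite K\<close> by simp
      also have "(\<Sum>l\<in>K. if l \<in> g ` B then r (x l) *\<^sub>R h l else 0) = (\<Sum>l\<in>g ` B. r (x l) *\<^sub>R h l)"
        using g \<open>finite K\<close> by (intro sum.mono_neutral_cong_right) auto
      also have "\<dots> = (\<Sum>b\<in>B. r b *\<^sub>R h (g b))"
        by (simp add: sum.reindex[OF inj] g)
      finally show ?thesis .
    qed
    have "(\<Sum>l\<in>K. \<beta> l *\<^sub>R x l) = 0"
      unfolding * using r g by simp
    from rel[OF this] have "y k = (\<Sum>b\<in>B. r b *\<^sub>R y (g b))"
      unfolding * by simp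
    also have "\<dots> = f (x k)"
      unfolding r using f by (simp add: linear_sum linear_scale)
    finally show ?thesis by simp
  qed
  with f(1) show thesis by (rule that)
qed

lemma inner_system_solvable:
  fixes x :: "'k \<Rightarrow> 'a::euclidean_space"
  assumes "finite K"
    and "\<And>\<beta>. (\<Sum>k\<in>K. \<beta> k *\<^sub>R x k) = 0 \<Longrightarrow> (\<Sum>k\<in>K. \<beta> k * u k) = 0"
  obtains b where "\<And>k. k \<in> K \<Longrightarrow> x k \<bullet> b = u k"
proof -
  obtain f :: "'a \<Rightarrow> real" where f: "linear f" "\<And>k. k \<in> K \<Longrightarrow> f (x k) = u k"
    using linear_extension_of_family[of K x u] assms by auto
  have "x k \<bullet> adjoint f 1 = u k" if "k \<in> K" for k
    using that f by (simp add: adjoint_works)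
  then show thesis by (rule that)
qed

lemma inner_eq_on_spanning:
  fixes x y :: "'a::euclidean_space"
  assumes "x - y \<in> span (e ` K)" "\<And>k. k \<in> K \<Longrightarrow> e k \<bullet> x = e k \<bullet> y"
  shows "x = y"
proof -
  have "(x - y) \<bullet> z = 0" if "z \<in> span (e ` K)" for z
    using that
  proof (induction rule: span_induct)
    case base then show ?case by (simp add: subspace_def inner_add_right)
  next
    case (step z) then show ?case
      using assms(2) by (auto simp: inner_commute inner_diff_right)
  qed
  from this[OF assms(1)] show ?thesis by simp
qed

lemma span_eq_UNIV_if_no_orthogonal:
  fixes V :: "'a::euclidean_space set"
  assumes "subspace V" "E \<subseteq> V" and no: "\<And>d. d \<in> V \<Longrightarrow> (\<And>e. e \<in> E \<Longrightarrow> e \<bullet> d = 0) \<Longrightarrow> d = 0"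
  shows "span E = V"
proof (rule ccontr)
  assume "span E \<noteq> V"
  moreover have "span E \<subseteq> V" using assms by (simp add: span_minimal)
  ultimately have "span E \<subset> span V" using assms(1) by (metis psubsetI span_eq_iff)
  then obtain d where "d \<noteq> 0" "d \<in> span V" "\<And>y. y \<in> span E \<Longrightarrow> orthogonal d y"
    by (rule orthogonal_to_subspace_exists_gen) blast
  then show False using no[of d] assms(1)
    by (metis inner_commute orthogonal_def span_base span_eq_iff)
qed

lemma span_imageE:
  assumes "finite K" "v \<in> span (x ` K)"
  obtains r where "v = (\<Sum>k\<in>K. r k *\<^sub>R x k)"
proof -
  let ?S = "range (\<lambda>r. \<Sum>k\<in>K. r k *\<^sub>R x k)"
  have "subspace ?S"
  proof (rule subspaceI)
    show "0 \<in> ?S" by (auto intro!: image_eqI[of _ _ "\<lambda>_. 0"])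
    show "u + v \<in> ?S" if uv: "u \<in> ?S" "v \<in> ?S" for u v
    proof -
      obtain r s where "u = (\<Sum>k\<in>K. r k *\<^sub>R x k)" "v = (\<Sum>k\<in>K. s k *\<^sub>R x k)" using uv by blast
      then have "u + v = (\<Sum>k\<in>K. (r k + s k) *\<^sub>R x k)" by (simp add: scaleR_add_left sum.distrib)
      then show ?thesis using rangeI[of "\<lambda>r. \<Sum>k\<in>K. r k *\<^sub>R x k" "\<lambda>k. r k + s k"] by simp
    qed
    show "c *\<^sub>R u \<in> ?S" if u: "u \<in> ?S" for c u
    proof -
      obtain r where "u = (\<Sum>k\<in>K. r k *\<^sub>R x k)" using u by blast
      then have "c *\<^sub>R u = (\<Sum>k\<in>K. (c * r k) *\<^sub>R x k)" by (simp add: scaleR_sum_right)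
      then show ?thesis using rangeI[of "\<lambda>r. \<Sum>k\<in>K. r k *\<^sub>R x k" "\<lambda>k. c * r k"] by simp
    qed
  qed
  moreover have "x ` K \<subseteq> ?S"
  proof (rule image_subsetI)
    fix k assume k: "k \<in> K"
    have "(\<Sum>l\<in>K. (if l = k then 1 else 0) *\<^sub>R x l) = (\<Sum>l\<in>K. if l = k then x l else 0)"
      by (rule sum.cong) auto
    then have "x k = (\<Sum>l\<in>K. (if l = k then 1 else 0) *\<^sub>R x l)" using k assms(1) by simp
    then show "x k \<in> ?S" using rangeI[of "\<lambda>r. \<Sum>l\<in>K. r l *\<^sub>R x l" "\<lambda>l. if l = k then 1 else 0"] by simp
  qed
  ultimately have "span (x ` K) \<subseteq> ?S" by (rule span_minimal[rotated])
  then show thesis using assms(2) that by blast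
qed

text \<open>As many vectors as the dimension that span satisfy no linear relation.\<close>

lemma no_relation_if_spanning:
  fixes x :: "'k \<Rightarrow> 'a::euclidean_space"
  assumes "finite K" "subspace V" "span (x ` K) = V" "card K \<le> dim V"
    and rel: "(\<Sum>k\<in>K. \<beta> k *\<^sub>R x k) = 0" and k: "k \<in> K"
  shows "\<beta> k = 0"
proof -
  have c: "card (x ` K) \<le> card K" using assms(1) by (rule card_image_le)
  have ind: "independent (x ` K)"
    using assms c by (intro card_le_dim_spanning[of _ V]) (auto intro: span_base)
  have "dim V = card (x ` K)" using ind assms(3) by (metis dim_span dim_eq_card_independent)
  then have "inj_on x K" using c assms by (intro eq_card_imp_inj_on) auto
  then obtain f where f: "\<And>k. k \<in> K \<Longrightarrow> f (x k) = k" by (metis the_inv_into_f_f)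
  have "(\<Sum>v\<in>x ` K. \<beta> (f v) *\<^sub>R v) = 0"
    using rel f by (simp add: sum.reindex[OF \<open>inj_on x K\<close>])
  then have "\<beta> (f (x k)) = 0"
    using ind assms(1) k by (intro independentD[of "x ` K" "x ` K" "\<lambda>v. \<beta> (f v)"]) auto
  then show ?thesis using f k by simp
qed

lemma orthogonal_part:
  fixes x :: "'a::euclidean_space"
  assumes "subspace V"
  shows "\<exists>y\<in>V. \<forall>w\<in>V. w \<bullet> y = w \<bullet> x"
proof -
  obtain y z where yz: "y \<in> span V" "\<And>w. w \<in> span V \<Longrightarrow> orthogonal z w" "x = y + z"
    by (rule orthogonal_subspace_decomp_exists[of V x]) blast
  have "y \<in> V" using yz(1) unfolding span_eq_iff[THEN iffD2, OF assms] .
  moreover have "w \<bullet> y = w \<bullet> x" if "w \<in> V" for w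
    using yz(2)[OF span_base[OF that]] yz(3) by (simp add: orthogonal_def inner_add_right inner_commute)
  ultimately show ?thesis by blast
qed

section \<open>Polytopes\<close>

lemma mem_halfspace_inter: "x \<in> halfspace_inter V I \<eta> \<kappa> \<longleftrightarrow> x \<in> V \<and> (\<forall>i\<in>I. \<eta> i \<bullet> x \<le> \<kappa> i)"
  by (simp add: halfspace_inter_def)

lemma mem_facet:
  "x \<in> facet V I \<eta> \<kappa> i \<longleftrightarrow> x \<in> V \<and> (\<forall>i\<in>I. \<eta> i \<bullet> x \<le> \<kappa> i) \<and> \<eta> i \<bullet> x = \<kappa> i"
  by (auto simp add: facet_def halfspace_inter_def)

lemma convex_halfspace_inter: "subspace V \<Longrightarrow> convex (halfspace_inter V I \<eta> \<kappa>)"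
proof -
  assume "subspace V"
  moreover have "halfspace_inter V I \<eta> \<kappa> = V \<inter> (\<Inter>i\<in>I. {x. \<eta> i \<bullet> x \<le> \<kappa> i})"
    by (auto simp: halfspace_inter_def)
  ultimately show ?thesis
    by (auto intro!: convex_Int convex_INT convex_halfspace_le simp: subspace_imp_convex)
qed

lemma closed_halfspace_inter: "subspace V \<Longrightarrow> closed (halfspace_inter V I \<eta> \<kappa>)"
proof -
  assume "subspace V"
  moreover have "halfspace_inter V I \<eta> \<kappa> = V \<inter> (\<Inter>i\<in>I. {x. \<eta> i \<bullet> x \<le> \<kappa> i})"
    by (auto simp: halfspace_inter_def)
  ultimately show ?thesis
    by (auto intro!: closed_Int closed_INT closed_halfspace_le simp: closed_subspace)
qed

lemma convex_average:
  assumes "convex S" "finite K" "K \<noteq> {}" "\<And>k. k \<in> K \<Longrightarrow> x k \<in> S"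
  shows "(\<Sum>k\<in>K. (1 / real (card K)) *\<^sub>R x k) \<in> S"
  using assms by (intro convex_sum) auto

lemma average_less:
  fixes x :: "'k \<Rightarrow> 'a::euclidean_space"
  assumes "finite K" "\<And>k. k \<in> K \<Longrightarrow> e \<bullet> x k \<le> c" "l \<in> K" "e \<bullet> x l < c"
  shows "e \<bullet> (\<Sum>k\<in>K. (1 / real (card K)) *\<^sub>R x k) < c"
proof -
  have c: "card K > 0" using assms by (metis card_gt_0_iff empty_iff)
  have "e \<bullet> (\<Sum>k\<in>K. (1 / real (card K)) *\<^sub>R x k) = (\<Sum>k\<in>K. (e \<bullet> x k) / real (card K))"
    by (simp add: inner_sum_right)
  also have "\<dots> < (\<Sum>k\<in>K. c / real (card K))"
    using assms c by (intro sum_strict_mono_ex1) (auto intro!: divide_right_mono divide_strict_right_mono)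
  also have "\<dots> = c" using c by simp
  finally show ?thesis .
qed

lemma strict_interior_point:
  assumes "facet_polytope V I \<eta> \<kappa>"
  obtains q where "q \<in> V" "\<And>i. i \<in> I \<Longrightarrow> \<eta> i \<bullet> q < \<kappa> i"
proof (cases "I = {}")
  case True
  then show thesis using that[of 0] assms by (auto simp: facet_polytope_def subspace_0)
next
  case False
  define P where "P = halfspace_inter V I \<eta> \<kappa>"
  have V: "subspace V" "finite I" and aff: "affine hull P = V" and nz: "\<And>i. i \<in> I \<Longrightarrow> \<eta> i \<in> V \<and> \<eta> i \<noteq> 0"
    using assms by (auto simp: facet_polytope_def P_def)
  have "\<exists>x\<in>P. \<eta> i \<bullet> x < \<kappa> i" if i: "i \<in> I" for i
  proof (rule ccontr)
    assume "\<not> ?thesis"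
    then have "P \<subseteq> {x. \<eta> i \<bullet> x = \<kappa> i}"
      using i unfolding P_def by (auto simp: mem_halfspace_inter not_less intro: order_antisym)
    then have "affine hull P \<subseteq> {x. \<eta> i \<bullet> x = \<kappa> i}"
      by (rule hull_minimal) (rule affine_hyperplane)
    then have "\<And>x. x \<in> V \<Longrightarrow> \<eta> i \<bullet> x = \<kappa> i" using aff by auto
    from this[of 0] this[of "\<eta> i"] nz[OF i] V show False by (simp add: subspace_0)
  qed
  then obtain x where x: "\<And>i. i \<in> I \<Longrightarrow> x i \<in> P \<and> \<eta> i \<bullet> x i < \<kappa> i" by metis
  define q where "q = (\<Sum>k\<in>I. (1 / real (card I)) *\<^sub>R x k)"
  have "q \<in> P" unfolding q_def
    using x False V by (intro convex_average) (auto simp: P_def convex_halfspace_inter)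
  moreover have "\<eta> i \<bullet> q < \<kappa> i" if "i \<in> I" for i
    unfolding q_def using that x V(2)
    by (intro average_less[of I "\<eta> i" x "\<kappa> i" i]) (auto simp: P_def mem_halfspace_inter)
  ultimately show thesis using that by (auto simp: P_def mem_halfspace_inter)
qed

lemma hyperplane_subset_imp_eq:
  fixes e f :: "'a::euclidean_space"
  assumes "subspace V" "e \<in> V" "f \<in> V" "e \<noteq> 0" "f \<noteq> 0"
    and sub: "{x \<in> V. e \<bullet> x = c} \<subseteq> {x. f \<bullet> x = d}"
  obtains t where "t \<noteq> 0" "f = t *\<^sub>R e" "d = t * c"
proof -
  define p where "p = (c / (e \<bullet> e)) *\<^sub>R e"
  have p: "p \<in> V" "e \<bullet> p = c" using assms by (auto simp: p_def subspace_scale)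
  then have fp: "f \<bullet> p = d" using sub by auto
  define z where "z = f - ((f \<bullet> e) / (e \<bullet> e)) *\<^sub>R e"
  have ez: "e \<bullet> z = 0" using assms by (simp add: z_def inner_diff_right inner_commute)
  have zV: "z \<in> V" unfolding z_def using assms by (intro subspace_diff subspace_scale) auto
  have "p + z \<in> V" "e \<bullet> (p + z) = c" using p ez zV assms by (auto simp: subspace_add inner_add_right)
  then have "f \<bullet> (p + z) = d" using sub by auto
  then have fz: "f \<bullet> z = 0" using fp by (simp add: inner_add_right)
  have "z \<bullet> z = 0"
    using fz ez by (subst (1) z_def) (simp add: inner_diff_left)
  then have f: "f = ((f \<bullet> e) / (e \<bullet> e)) *\<^sub>R e" by (simp add: z_def)
  show thesis
  proof (rule that)
    show "f = ((f \<bullet> e) / (e \<bullet> e)) *\<^sub>R e" by (rule f)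
    with assms show "(f \<bullet> e) / (e \<bullet> e) \<noteq> 0" by auto
    have "d = (((f \<bullet> e) / (e \<bullet> e)) *\<^sub>R e) \<bullet> p" using f fp by simp
    then show "d = (f \<bullet> e) / (e \<bullet> e) * c" using p by simp
  qed
qed

text \<open>A facet has a point that lies on no other facet.\<close>

lemma facet_only_point:
  assumes "facet_polytope V I \<eta> \<kappa>" "i \<in> I"
  obtains p where "p \<in> V" "\<eta> i \<bullet> p = \<kappa> i" "\<And>k. k \<in> I \<Longrightarrow> k \<noteq> i \<Longrightarrow> \<eta> k \<bullet> p < \<kappa> k"
proof -
  define F where "F = facet V I \<eta> \<kappa>"
  have V: "subspace V" "finite I" and nz: "\<And>i. i \<in> I \<Longrightarrow> \<eta> i \<in> V \<and> \<eta> i \<noteq> 0"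
    and aff: "affine hull (F i) = {x \<in> V. \<eta> i \<bullet> x = \<kappa> i}" and inj: "inj_on F I"
    using assms by (auto simp: facet_polytope_def F_def)
  have cF: "convex (F i)"
    unfolding F_def facet_def using V by (intro convex_Int convex_halfspace_inter convex_hyperplane)
  have "\<exists>x\<in>F i. \<eta> k \<bullet> x < \<kappa> k" if k: "k \<in> I" "k \<noteq> i" for k
  proof (rule ccontr)
    assume "\<not> ?thesis"
    then have "F i \<subseteq> {x. \<eta> k \<bullet> x = \<kappa> k}"
      using k unfolding F_def by (auto simp: mem_facet not_less intro: order_antisym)
    then have "affine hull (F i) \<subseteq> {x. \<eta> k \<bullet> x = \<kappa> k}"
      by (rule hull_minimal) (rule affine_hyperplane)
    then have "{x \<in> V. \<eta> i \<bullet> x = \<kappa> i} \<subseteq> {x. \<eta> k \<bullet> x = \<kappa> k}" using aff by simp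
    then obtain t where t: "t \<noteq> 0" "\<eta> k = t *\<^sub>R \<eta> i" "\<kappa> k = t * \<kappa> i"
      using hyperplane_subset_imp_eq[of V "\<eta> i" "\<eta> k"] nz[OF assms(2)] nz[OF k(1)] V by blast
    then have "F k = F i" unfolding F_def by (auto simp: mem_facet)
    then show False using inj k assms(2) by (auto dest: inj_onD)
  qed
  then obtain x where x: "\<And>k. k \<in> I \<Longrightarrow> k \<noteq> i \<Longrightarrow> x k \<in> F i \<and> \<eta> k \<bullet> x k < \<kappa> k" by metis
  have "F i \<noteq> {}"
  proof
    assume "F i = {}"
    moreover have "(\<kappa> i / (\<eta> i \<bullet> \<eta> i)) *\<^sub>R \<eta> i \<in> {x \<in> V. \<eta> i \<bullet> x = \<kappa> i}"
      using nz[OF assms(2)] V by (auto simp: subspace_scale)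
    ultimately show False using aff by auto
  qed
  then obtain x0 where x0: "x0 \<in> F i" by blast
  define y where "y k = (if k = i then x0 else x k)" for k
  have y: "y k \<in> F i" if "k \<in> I" for k using that x x0 by (auto simp: y_def)
  define p where "p = (\<Sum>k\<in>I. (1 / real (card I)) *\<^sub>R y k)"
  have "p \<in> F i" unfolding p_def
    using y assms(2) V cF by (intro convex_average) auto
  moreover have "\<eta> k \<bullet> p < \<kappa> k" if "k \<in> I" "k \<noteq> i" for k
    unfolding p_def using that x[OF that] V(2) y
    by (intro average_less[of I "\<eta> k" y "\<kappa> k" k]) (auto simp: F_def mem_facet y_def)
  ultimately show thesis using that by (auto simp: F_def mem_facet)
qed

lemma strict_neighbourhood:
  fixes \<eta> :: "'i \<Rightarrow> 'a::euclidean_space"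
  assumes "finite I"
  shows "open {x. \<forall>i\<in>I. \<eta> i \<bullet> x < \<kappa> i}"
proof -
  have "{x. \<forall>i\<in>I. \<eta> i \<bullet> x < \<kappa> i} = (\<Inter>i\<in>I. {x. \<eta> i \<bullet> x < \<kappa> i})" by auto
  then show ?thesis using assms by (auto intro: open_INT open_halfspace_lt)
qed

text \<open>
  Conversely, a point strictly inside and, for each facet, a point on that facet only suffice for the
  spanning conditions on the polytope and its facets.
\<close>

lemma facet_polytopeI:
  assumes V: "subspace V" "finite I" "\<eta> ` I \<subseteq> V - {0}"
    and bd: "bounded (halfspace_inter V I \<eta> \<kappa>)"
    and q: "q \<in> V" "\<And>i. i \<in> I \<Longrightarrow> \<eta> i \<bullet> q < \<kappa> i"
    and p: "\<And>i. i \<in> I \<Longrightarrow> p i \<in> V \<and> \<eta> i \<bullet> p i = \<kappa> i"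
      "\<And>i k. i \<in> I \<Longrightarrow> k \<in> I \<Longrightarrow> k \<noteq> i \<Longrightarrow> \<eta> k \<bullet> p i < \<kappa> k"
  shows "facet_polytope V I \<eta> \<kappa>"
proof -
  define P where "P = halfspace_inter V I \<eta> \<kappa>"
  have "affine hull P = V"
  proof -
    define U where "U = {x. \<forall>i\<in>I. \<eta> i \<bullet> x < \<kappa> i}"
    have "open U" unfolding U_def using V by (intro strict_neighbourhood)
    have "affine hull (V \<inter> U) = V"
      using q V \<open>open U\<close> by (subst affine_hull_affine_Int_open) (auto simp: U_def subspace_imp_affine)
    moreover have "V \<inter> U \<subseteq> P" "P \<subseteq> V" by (auto simp: U_def P_def mem_halfspace_inter less_imp_le)
    ultimately show ?thesis
      by (metis V(1) hull_minimal hull_mono subset_antisym subspace_imp_affine)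
  qed
  moreover have "affine hull (facet V I \<eta> \<kappa> i) = {x \<in> V. \<eta> i \<bullet> x = \<kappa> i}" if i: "i \<in> I" for i
  proof -
    define U where "U = {x. \<forall>k\<in>I - {i}. \<eta> k \<bullet> x < \<kappa> k}"
    define T where "T = V \<inter> {x. \<eta> i \<bullet> x = \<kappa> i}"
    have "open U" unfolding U_def using V by (intro strict_neighbourhood) auto
    have aT: "affine T" unfolding T_def
      using V by (intro affine_Int affine_hyperplane) (auto simp: subspace_imp_affine)
    have "p i \<in> T \<inter> U" using p i by (auto simp: U_def T_def)
    then have "affine hull (T \<inter> U) = T"
      using aT \<open>open U\<close> by (subst affine_hull_affine_Int_open) auto
    moreover have "T \<inter> U \<subseteq> facet V I \<eta> \<kappa> i"
      by (auto simp: U_def T_def mem_facet) (metis DiffI empty_iff insert_iff less_imp_le order_refl)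
    moreover have "facet V I \<eta> \<kappa> i \<subseteq> T" by (auto simp: T_def mem_facet)
    ultimately have "affine hull (facet V I \<eta> \<kappa> i) = T"
      by (metis aT hull_minimal hull_mono subset_antisym)
    then show ?thesis by (auto simp: T_def)
  qed
  moreover have "inj_on (facet V I \<eta> \<kappa>) I"
  proof (rule inj_onI, rule ccontr)
    fix i k assume ik: "i \<in> I" "k \<in> I" "facet V I \<eta> \<kappa> i = facet V I \<eta> \<kappa> k" "i \<noteq> k"
    have "p i \<in> facet V I \<eta> \<kappa> i" using p ik(1) by (auto simp: mem_facet) (metis less_imp_le order_refl)
    then have "p i \<in> facet V I \<eta> \<kappa> k" using ik by simp
    then show False using p(2)[of i k] ik by (auto simp: mem_facet)
  qed
  ultimately show ?thesis using V bd by (simp add: facet_polytope_def P_def)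
qed

text \<open>Conormals of different facets have different directions.\<close>

lemma conormal_direction_unique:
  assumes "facet_polytope V I \<eta> \<kappa>" "i \<in> I" "j \<in> I" "s > 0" "\<eta> j = s *\<^sub>R \<eta> i"
  shows "i = j"
proof (rule ccontr)
  assume ij: "i \<noteq> j"
  obtain p where p: "\<eta> i \<bullet> p = \<kappa> i" "\<eta> j \<bullet> p < \<kappa> j" using facet_only_point[OF assms(1,2)] ij assms(3) by metis
  obtain q where q: "\<eta> j \<bullet> q = \<kappa> j" "\<eta> i \<bullet> q < \<kappa> i" using facet_only_point[OF assms(1,3)] ij assms(2) by metis
  have "s * \<kappa> i < \<kappa> j" using p assms(5) by simp
  moreover have "s * (\<eta> i \<bullet> q) = \<kappa> j" using q assms(5) by simp
  ultimately show False using q(2) assms(4) by (metis mult_less_cancel_left_pos not_less_iff_gr_or_eq)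
qed

text \<open>
  The product of the slacks attains its maximum over the polytope at an interior point, where
  its gradient vanishes.  This gives a linear relation with positive coefficients.
\<close>

lemma positive_relation:
  assumes fp: "facet_polytope V I \<eta> \<kappa>"
  obtains \<mu> where "\<And>i. i \<in> I \<Longrightarrow> \<mu> i > (0::real)" "(\<Sum>i\<in>I. \<mu> i *\<^sub>R \<eta> i) = 0"
proof -
  define P where "P = halfspace_inter V I \<eta> \<kappa>"
  have V: "subspace V" "finite I" and nz: "\<And>i. i \<in> I \<Longrightarrow> \<eta> i \<in> V" and bd: "bounded P"
    using assms by (auto simp: facet_polytope_def P_def)
  obtain q where q: "q \<in> V" "\<And>i. i \<in> I \<Longrightarrow> \<eta> i \<bullet> q < \<kappa> i" using strict_interior_point[OF fp] by metis
  have "compact P" using bd V by (simp add: P_def closed_halfspace_inter compact_eq_bounded_closed)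
  define g where "g x = (\<Prod>i\<in>I. \<kappa> i - \<eta> i \<bullet> x)" for x
  have "q \<in> P" using q by (auto simp: P_def mem_halfspace_inter less_imp_le)
  moreover have "continuous_on P g" unfolding g_def by (intro continuous_intros)
  ultimately obtain x where x: "x \<in> P" "\<And>y. y \<in> P \<Longrightarrow> g y \<le> g x"
    using continuous_attains_sup[OF \<open>compact P\<close>, of g] by blast
  have "g q > 0" unfolding g_def using q by (auto intro!: prod_pos)
  then have "g x > 0" using x \<open>q \<in> P\<close> by (meson less_le_trans)
  then have "\<And>i. i \<in> I \<Longrightarrow> \<kappa> i - \<eta> i \<bullet> x \<noteq> 0" using V(2) unfolding g_def by (metis order_less_irrefl prod_zero_iff)
  then have slack: "\<kappa> i - \<eta> i \<bullet> x > 0" if "i \<in> I" for i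
    using x(1) that by (force simp: P_def mem_halfspace_inter)
  define d where "d = (\<Sum>i\<in>I. (1 / (\<kappa> i - \<eta> i \<bullet> x)) *\<^sub>R \<eta> i)"
  have dV: "d \<in> V" unfolding d_def using V nz by (intro subspace_sum subspace_scale) auto
  define h where "h t = g (x + t *\<^sub>R d)" for t
  have "open {y. \<forall>i\<in>I. \<eta> i \<bullet> y < \<kappa> i}" using V(2) by (rule strict_neighbourhood)
  moreover have "x \<in> {y. \<forall>i\<in>I. \<eta> i \<bullet> y < \<kappa> i}" using slack by auto
  ultimately obtain e where e: "e > 0" "ball x e \<subseteq> {y. \<forall>i\<in>I. \<eta> i \<bullet> y < \<kappa> i}"
    by (meson open_contains_ball)
  define r where "r = e / (norm d + 1)"
  have "r > 0" using e by (simp add: r_def add_nonneg_pos)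
  have max: "h t \<le> h 0" if "\<bar>0 - t\<bar> < r" for t
  proof -
    have "\<bar>t\<bar> * norm d \<le> \<bar>t\<bar> * (norm d + 1)" by (simp add: mult_left_mono)
    also have "\<dots> < e" using that by (simp add: r_def pos_less_divide_eq add_nonneg_pos)
    finally have "x + t *\<^sub>R d \<in> ball x e" by (simp add: dist_norm)
    then have "x + t *\<^sub>R d \<in> P" using e x(1) dV V(1)
      by (auto simp: P_def mem_halfspace_inter subspace_add subspace_scale less_imp_le subset_iff)
    then show ?thesis using x by (simp add: h_def)
  qed
  have "(h has_field_derivative (\<Sum>i\<in>I. (- (\<eta> i \<bullet> d)) * (\<Prod>k\<in>I - {i}. \<kappa> k - \<eta> k \<bullet> (x + 0 *\<^sub>R d)))) (at 0)"
    unfolding h_def[abs_def] g_def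
    by (rule has_field_derivative_prod) (auto intro!: derivative_eq_intros simp: inner_add_right)
  then have "(\<Sum>i\<in>I. (- (\<eta> i \<bullet> d)) * (\<Prod>k\<in>I - {i}. \<kappa> k - \<eta> k \<bullet> (x + 0 *\<^sub>R d))) = 0"
    by (rule DERIV_local_max[where d = r]) (use \<open>r > 0\<close> max in auto)
  moreover have "(\<Prod>k\<in>I - {i}. \<kappa> k - \<eta> k \<bullet> x) = g x / (\<kappa> i - \<eta> i \<bullet> x)" if "i \<in> I" for i
    unfolding g_def using that slack[OF that] V(2) by (simp add: prod.remove)
  ultimately have "(\<Sum>i\<in>I. (- (\<eta> i \<bullet> d)) * (g x / (\<kappa> i - \<eta> i \<bullet> x))) = 0" by simp
  also have "(\<Sum>i\<in>I. (- (\<eta> i \<bullet> d)) * (g x / (\<kappa> i - \<eta> i \<bullet> x))) = - g x * (d \<bullet> d)"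
    
  proof -
    have "d \<bullet> d = (\<Sum>i\<in>I. (\<eta> i \<bullet> d) / (\<kappa> i - \<eta> i \<bullet> x))"
      by (subst (1) d_def) (simp add: inner_sum_left)
    then show ?thesis by (simp add: sum_distrib_left sum_negf mult_ac)
  qed
  finally have "d = 0" using \<open>g x > 0\<close> by simp
  show thesis
    by (rule that[of "\<lambda>i. 1 / (\<kappa> i - \<eta> i \<bullet> x)"]) (use slack \<open>d = 0\<close> in \<open>auto simp: d_def\<close>)
qed

lemma conormals_span:
  assumes fp: "facet_polytope V I \<eta> \<kappa>"
  shows "span (\<eta> ` I) = V"
proof (rule span_eq_UNIV_if_no_orthogonal)
  define P where "P = halfspace_inter V I \<eta> \<kappa>"
  have V: "subspace V" and nz: "\<eta> ` I \<subseteq> V" and bd: "bounded P"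
    using assms by (auto simp: facet_polytope_def P_def)
  show "subspace V" "\<eta> ` I \<subseteq> V" by fact+
  fix d assume d: "d \<in> V" "\<And>e. e \<in> \<eta> ` I \<Longrightarrow> e \<bullet> d = 0"
  obtain q where q: "q \<in> V" "\<And>i. i \<in> I \<Longrightarrow> \<eta> i \<bullet> q < \<kappa> i" using strict_interior_point[OF fp] by metis
  obtain B where B: "\<And>x. x \<in> P \<Longrightarrow> norm x \<le> B" using bd by (auto simp: bounded_iff)
  have "norm (q + t *\<^sub>R d) \<le> B" for t
    using q d V by (intro B) (auto simp: P_def mem_halfspace_inter subspace_add subspace_scale inner_add_right less_imp_le)
  show "d = 0"
  proof (rule ccontr)
    assume "d \<noteq> 0"
    define t where "t = (B + norm q + 1) / norm d"
    have "norm (t *\<^sub>R d) = \<bar>B + norm q + 1\<bar>" using \<open>d \<noteq> 0\<close> by (simp add: t_def)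
    moreover have "norm (t *\<^sub>R d) \<le> norm (q + t *\<^sub>R d) + norm q"
      using norm_triangle_ineq4[of "q + t *\<^sub>R d" q] by simp
    ultimately show False using \<open>norm (q + t *\<^sub>R d) \<le> B\<close> by linarith
  qed
qed

text \<open>At an extreme point the active conormals span.\<close>

lemma active_span_at_extreme_point:
  assumes V: "subspace V" "finite I" "\<eta> ` I \<subseteq> V" and v: "v extreme_point_of (halfspace_inter V I \<eta> \<kappa>)"
  shows "span (\<eta> ` {i \<in> I. v \<in> facet V I \<eta> \<kappa> i}) = V"
proof (rule span_eq_UNIV_if_no_orthogonal)
  let ?P = "halfspace_inter V I \<eta> \<kappa>" and ?J = "{i \<in> I. v \<in> facet V I \<eta> \<kappa> i}"
  show "subspace V" "\<eta> ` ?J \<subseteq> V" using V by auto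
  have vP: "v \<in> V" "\<And>i. i \<in> I \<Longrightarrow> \<eta> i \<bullet> v \<le> \<kappa> i"
    using v by (auto simp: extreme_point_of_def mem_halfspace_inter)
  fix d assume d: "d \<in> V" "\<And>e. e \<in> \<eta> ` ?J \<Longrightarrow> e \<bullet> d = 0"
  let ?U = "{y. \<forall>i\<in>I - ?J. \<eta> i \<bullet> y < \<kappa> i}"
  have "open ?U" using V(2) by (intro strict_neighbourhood) auto
  moreover have "v \<in> ?U" using vP by (force simp: mem_facet)
  ultimately obtain e where e: "e > 0" "ball v e \<subseteq> ?U"
    by (meson open_contains_ball)
  define t where "t = e / (2 * (norm d + 1))"
  have "t > 0" using e by (simp add: t_def add_nonneg_pos)
  have "t * norm d < e"
  proof -
    have "norm d / (norm d + 1) < 1" by (simp add: add_nonneg_pos)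
    then have "e / 2 * (norm d / (norm d + 1)) < e / 2 * 1" using e by (intro mult_strict_left_mono) auto
    moreover have "t * norm d = e / 2 * (norm d / (norm d + 1))"
      unfolding t_def by (simp only: times_divide_eq_left times_divide_eq_right divide_divide_eq_left)
    ultimately show ?thesis using e by linarith
  qed
  have in_P: "v + s *\<^sub>R d \<in> ?P" if "\<bar>s\<bar> = t" for s
  proof -
    have "v + s *\<^sub>R d \<in> ball v e" using that \<open>t * norm d < e\<close> by (simp add: dist_norm)
    then have "v + s *\<^sub>R d \<in> ?U" using e by auto
    moreover have "\<eta> i \<bullet> (v + s *\<^sub>R d) \<le> \<kappa> i" if "i \<in> ?J" for i
      using that d(2) vP(2) by (auto simp: inner_add_right)
    ultimately have "\<eta> i \<bullet> (v + s *\<^sub>R d) \<le> \<kappa> i" if "i \<in> I" for i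
      using that by (cases "i \<in> ?J") (blast, simp add: less_imp_le)
    then show ?thesis using vP(1) d(1) V(1)
      by (simp add: mem_halfspace_inter subspace_add subspace_scale)
  qed
  show "d = 0"
  proof (rule ccontr)
    assume "d \<noteq> 0"
    have "v = midpoint (v + t *\<^sub>R d) (v + (-t) *\<^sub>R d)" by (simp add: midpoint_def scaleR_2[symmetric])
    moreover have "v + t *\<^sub>R d \<noteq> v + (-t) *\<^sub>R d" using \<open>d \<noteq> 0\<close> \<open>t > 0\<close>
      by (auto simp flip: scaleR_add_left simp: eq_neg_iff_add_eq_0)
    ultimately have "v \<in> open_segment (v + t *\<^sub>R d) (v + (-t) *\<^sub>R d)"
      by (metis midpoint_in_open_segment)
    then show False using v in_P[of t] in_P[of "-t"] \<open>t > 0\<close> by (auto simp: extreme_point_of_def)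
  qed
qed

lemma extreme_point_if_active_span:
  fixes \<eta> :: "'i \<Rightarrow> 'a::euclidean_space"
  assumes v: "v \<in> halfspace_inter V I \<eta> \<kappa>" and J: "J \<subseteq> I" "\<And>j. j \<in> J \<Longrightarrow> \<eta> j \<bullet> v = \<kappa> j"
    and sp: "V \<subseteq> span (\<eta> ` J)" "subspace V"
  shows "v extreme_point_of (halfspace_inter V I \<eta> \<kappa>)"
  unfolding extreme_point_of_def
proof (intro conjI ballI notI)
  show "v \<in> halfspace_inter V I \<eta> \<kappa>" by fact
  fix a b assume ab: "a \<in> halfspace_inter V I \<eta> \<kappa>" "b \<in> halfspace_inter V I \<eta> \<kappa>" "v \<in> open_segment a b"
  then obtain u where u: "0 < u" "u < 1" "v = (1 - u) *\<^sub>R a + u *\<^sub>R b" "a \<noteq> b"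
    by (auto simp: in_segment)
  have "a = b"
  proof (rule inner_eq_on_spanning)
    show "a - b \<in> span (\<eta> ` J)" using ab sp by (auto simp: mem_halfspace_inter intro!: subspace_diff)
    fix j assume j: "j \<in> J"
    have 1: "\<eta> j \<bullet> a \<le> \<kappa> j" "\<eta> j \<bullet> b \<le> \<kappa> j" using ab j J by (auto simp: mem_halfspace_inter)
    have eq: "(1 - u) * (\<eta> j \<bullet> a) + u * (\<eta> j \<bullet> b) = \<kappa> j"
      using J(2)[OF j] u(3) by (simp add: inner_add_right)
    have "(1 - u) * (\<kappa> j - \<eta> j \<bullet> a) + u * (\<kappa> j - \<eta> j \<bullet> b) = 0" using eq by (simp add: algebra_simps)
    moreover have "(1 - u) * (\<kappa> j - \<eta> j \<bullet> a) \<ge> 0" "u * (\<kappa> j - \<eta> j \<bullet> b) \<ge> 0" using 1 u by auto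
    ultimately have "(1 - u) * (\<kappa> j - \<eta> j \<bullet> a) = 0" "u * (\<kappa> j - \<eta> j \<bullet> b) = 0" by linarith+
    then show "\<eta> j \<bullet> a = \<eta> j \<bullet> b" using u by simp
  qed
  with u(4) show False by simp
qed

lemma halfspace_inter_has_extreme_point:
  assumes "facet_polytope V I \<eta> \<kappa>"
  obtains v where "v extreme_point_of (halfspace_inter V I \<eta> \<kappa>)"
proof -
  obtain q where q: "q \<in> V" "\<And>i. i \<in> I \<Longrightarrow> \<eta> i \<bullet> q < \<kappa> i" using strict_interior_point[OF assms] by metis
  have "q \<in> halfspace_inter V I \<eta> \<kappa>" using q by (auto simp: mem_halfspace_inter less_imp_le)
  moreover have "compact (halfspace_inter V I \<eta> \<kappa>)" "convex (halfspace_inter V I \<eta> \<kappa>)"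
    using assms by (auto simp: facet_polytope_def closed_halfspace_inter compact_eq_bounded_closed convex_halfspace_inter)
  ultimately show thesis using extreme_point_exists_convex that by blast
qed

text \<open>Not every extreme point lies on a given facet.\<close>

lemma extreme_point_off_facet:
  assumes fp: "facet_polytope V I \<eta> \<kappa>" and i: "i \<in> I"
  obtains v where "v extreme_point_of (halfspace_inter V I \<eta> \<kappa>)" "v \<notin> facet V I \<eta> \<kappa> i"
proof -
  let ?P = "halfspace_inter V I \<eta> \<kappa>"
  obtain q where q: "q \<in> V" "\<And>i. i \<in> I \<Longrightarrow> \<eta> i \<bullet> q < \<kappa> i" using strict_interior_point[OF fp] by metis
  have "q \<in> ?P" using q by (auto simp: mem_halfspace_inter less_imp_le)
  have kc: "compact ?P" "convex ?P"
    using assms by (auto simp: facet_polytope_def closed_halfspace_inter compact_eq_bounded_closed convex_halfspace_inter)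
  have "\<exists>v. v extreme_point_of ?P \<and> v \<notin> facet V I \<eta> \<kappa> i"
  proof (rule ccontr)
    assume "\<not> ?thesis"
    then have "{v. v extreme_point_of ?P} \<subseteq> {x. \<eta> i \<bullet> x = \<kappa> i}" by (auto simp: mem_facet)
    then have "convex hull {v. v extreme_point_of ?P} \<subseteq> {x. \<eta> i \<bullet> x = \<kappa> i}"
      by (rule hull_minimal) (rule convex_hyperplane)
    then have "?P \<subseteq> {x. \<eta> i \<bullet> x = \<kappa> i}" using Krein_Milman_Minkowski[OF kc] by auto
    then show False using \<open>q \<in> ?P\<close> q(2)[OF i] by auto
  qed
  then show thesis using that by blast
qed

section \<open>The chamber is open\<close>

text \<open>Boundedness depends on the conormals only.\<close>

lemma bounded_if_positive_relation:
  fixes \<eta> :: "'i::finite \<Rightarrow> 'a::euclidean_space"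
  assumes pos: "\<And>i. \<mu> i > (0::real)" "(\<Sum>i\<in>UNIV. \<mu> i *\<^sub>R \<eta> i) = 0" and sp: "span (range \<eta>) = UNIV"
  shows "bounded (halfspace_inter UNIV UNIV \<eta> \<kappa>)"
proof -
  have "\<exists>r. b = (\<Sum>i\<in>UNIV. r i *\<^sub>R \<eta> i)" for b
    using span_imageE[of UNIV b \<eta>] sp by auto
  then obtain r where r: "\<And>b. b = (\<Sum>i\<in>UNIV. r b i *\<^sub>R \<eta> i)" by metis
  define C where "C i = \<bar>\<kappa> i\<bar> + \<bar>(\<Sum>k\<in>UNIV - {i}. \<mu> k * \<kappa> k) / \<mu> i\<bar>" for i
  have C: "\<bar>\<eta> i \<bullet> x\<bar> \<le> C i" if x: "x \<in> halfspace_inter UNIV UNIV \<eta> \<kappa>" for x i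
  proof -
    have x: "\<eta> k \<bullet> x \<le> \<kappa> k" for k using x by (simp add: mem_halfspace_inter)
    have "0 = (\<Sum>k\<in>UNIV. \<mu> k *\<^sub>R \<eta> k) \<bullet> x" using pos by simp
    also have "\<dots> = \<mu> i * (\<eta> i \<bullet> x) + (\<Sum>k\<in>UNIV - {i}. \<mu> k * (\<eta> k \<bullet> x))"
      unfolding inner_sum_left by (subst sum.remove[of UNIV i]) auto
    also have "(\<Sum>k\<in>UNIV - {i}. \<mu> k * (\<eta> k \<bullet> x)) \<le> (\<Sum>k\<in>UNIV - {i}. \<mu> k * \<kappa> k)"
      using x pos by (intro sum_mono mult_left_mono) (auto intro: less_imp_le)
    finally have "- (\<eta> i \<bullet> x) \<le> (\<Sum>k\<in>UNIV - {i}. \<mu> k * \<kappa> k) / \<mu> i"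
      using pos(1)[of i] by (simp add: field_simps)
    then show ?thesis using x[of i] unfolding C_def by linarith
  qed
  have "norm x \<le> (\<Sum>b\<in>Basis. \<Sum>i\<in>UNIV. \<bar>r b i\<bar> * C i)" if x: "x \<in> halfspace_inter UNIV UNIV \<eta> \<kappa>" for x
  proof -
    have "norm x \<le> (\<Sum>b\<in>Basis. \<bar>x \<bullet> b\<bar>)" by (rule norm_le_l1)
    also have "\<dots> \<le> (\<Sum>b\<in>Basis. \<Sum>i\<in>UNIV. \<bar>r b i\<bar> * C i)"
    proof (rule sum_mono)
      fix b :: 'a assume "b \<in> Basis"
      have "x \<bullet> b = (\<Sum>i\<in>UNIV. r b i * (\<eta> i \<bullet> x))"
        by (subst r) (simp add: inner_sum_right inner_commute)
      also have "\<bar>\<dots>\<bar> \<le> (\<Sum>i\<in>UNIV. \<bar>r b i * (\<eta> i \<bullet> x)\<bar>)" by (rule sum_abs)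
      also have "\<dots> \<le> (\<Sum>i\<in>UNIV. \<bar>r b i\<bar> * C i)"
        using C[OF x] by (intro sum_mono) (simp add: abs_mult mult_left_mono)
      finally show "\<bar>x \<bullet> b\<bar> \<le> (\<Sum>i\<in>UNIV. \<bar>r b i\<bar> * C i)" .
    qed
    finally show ?thesis .
  qed
  then show ?thesis by (auto simp: bounded_iff)
qed

lemma eventually_all_finite:
  fixes P :: "'b::finite \<Rightarrow> 'c \<Rightarrow> bool"
  shows "(\<And>i. eventually (P i) F) \<Longrightarrow> eventually (\<lambda>x. \<forall>i. P i x) F"
  using eventually_ball_finite[of UNIV "\<lambda>x i. P i x" F] by simp

lemma eventually_inner_less:
  fixes f :: "real ^ 'i \<Rightarrow> 'a::euclidean_space"
  assumes "isCont f \<kappa>" "e \<bullet> f \<kappa> < \<kappa> $ k"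
  shows "\<forall>\<^sub>F \<kappa>' in nhds \<kappa>. e \<bullet> f \<kappa>' < \<kappa>' $ k"
proof -
  have "isCont (\<lambda>\<kappa>'. \<kappa>' $ k - e \<bullet> f \<kappa>') \<kappa>" using assms(1) by (intro continuous_intros)
  then have "(\<lambda>\<kappa>'. \<kappa>' $ k - e \<bullet> f \<kappa>') \<midarrow>\<kappa>\<rightarrow> \<kappa> $ k - e \<bullet> f \<kappa>"
    by (simp add: isCont_def)
  from order_tendstoD(1)[OF this, of 0] assms(2) show ?thesis by (simp add: eventually_nhds_conv_at)
qed

lemma eventually_inner_greater:
  fixes f :: "real ^ 'i \<Rightarrow> 'a::euclidean_space"
  assumes "isCont f \<kappa>" "e \<bullet> f \<kappa> > \<kappa> $ k"
  shows "\<forall>\<^sub>F \<kappa>' in nhds \<kappa>. e \<bullet> f \<kappa>' > \<kappa>' $ k"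
proof -
  have "isCont (\<lambda>\<kappa>'. e \<bullet> f \<kappa>' - \<kappa>' $ k) \<kappa>" using assms(1) by (intro continuous_intros)
  then have "(\<lambda>\<kappa>'. e \<bullet> f \<kappa>' - \<kappa>' $ k) \<midarrow>\<kappa>\<rightarrow> e \<bullet> f \<kappa> - \<kappa> $ k"
    by (simp add: isCont_def)
  from order_tendstoD(1)[OF this, of 0] assms(2) show ?thesis by (simp add: eventually_nhds_conv_at)
qed

text \<open>
  A nearby polytope keeps the strictly interior point and, after a shift along the conormal, the points
  that lie on one facet only. Its vertices are among the finitely many points \<open>X \<kappa>'\<close> at which a basis
  of conormals is active; by simplicity of the original polytope, each of these is either violating
  some inequality strictly or is strict in all inequalities outside the basis, and both persist.
\<close>

lemma eventually_simple_polytope: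
  fixes \<eta> :: "'i::finite \<Rightarrow> 'a::euclidean_space"
  assumes sp: "simple_polytope UNIV UNIV \<eta> (($) \<kappa>)"
  shows "\<forall>\<^sub>F \<kappa>' in nhds \<kappa>. simple_polytope UNIV UNIV \<eta> (($) \<kappa>')"
proof -
  have fp: "facet_polytope UNIV UNIV \<eta> (($) \<kappa>)"
    and vert: "\<And>v. v extreme_point_of polytope_of \<eta> \<kappa> \<Longrightarrow> card {i. v \<in> facet_of_index \<eta> \<kappa> i} = DIM('a)"
    using sp by (auto simp: simple_polytope_def dim_UNIV)
  have nz: "\<eta> i \<noteq> 0" for i using fp by (auto simp: facet_polytope_def)
  obtain \<mu> where \<mu>: "\<And>i. \<mu> i > (0::real)" "(\<Sum>i\<in>UNIV. \<mu> i *\<^sub>R \<eta> i) = 0"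
    using positive_relation[OF fp] by auto
  have bdd: "bounded (halfspace_inter UNIV UNIV \<eta> \<kappa>')" for \<kappa>'
    using \<mu> conormals_span[OF fp] by (rule bounded_if_positive_relation)
  obtain q where q: "\<And>i. \<eta> i \<bullet> q < \<kappa> $ i" using strict_interior_point[OF fp] by auto
  have "\<exists>p. \<eta> i \<bullet> p = \<kappa> $ i \<and> (\<forall>k. k \<noteq> i \<longrightarrow> \<eta> k \<bullet> p < \<kappa> $ k)" for i
    using facet_only_point[OF fp, of i] by auto
  then obtain p where p: "\<And>i. \<eta> i \<bullet> p i = \<kappa> $ i" "\<And>i k. k \<noteq> i \<Longrightarrow> \<eta> k \<bullet> p i < \<kappa> $ k" by metis
  \<comment> \<open>the point on facet \<open>i\<close> only, moved along with the facet\<close>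
  define p' where "p' i \<kappa>' = p i + ((\<kappa>' $ i - \<kappa> $ i) / (\<eta> i \<bullet> \<eta> i)) *\<^sub>R \<eta> i" for i and \<kappa>' :: "real ^ 'i"
  have p'1: "\<eta> i \<bullet> p' i \<kappa>' = \<kappa>' $ i" for i \<kappa>' using nz[of i] p by (simp add: p'_def inner_add_right)
  have p'2: "isCont (p' i) \<kappa>" for i unfolding p'_def[abs_def] using nz[of i] by (intro continuous_intros) auto
  have ev_q: "\<forall>\<^sub>F \<kappa>' in nhds \<kappa>. \<forall>i. \<eta> i \<bullet> q < \<kappa>' $ i"
    using q by (intro eventually_all_finite eventually_inner_less) auto
  have ev_p: "\<forall>\<^sub>F \<kappa>' in nhds \<kappa>. \<forall>i k. k \<noteq> i \<longrightarrow> \<eta> k \<bullet> p' i \<kappa>' < \<kappa>' $ k"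
  proof (intro eventually_all_finite)
    fix i k show "\<forall>\<^sub>F \<kappa>' in nhds \<kappa>. k \<noteq> i \<longrightarrow> \<eta> k \<bullet> p' i \<kappa>' < \<kappa>' $ k"
      using eventually_inner_less[OF p'2[of i], of "\<eta> k" k] p(2)[of k i]
      by (cases "k = i") (auto simp: p'_def[of i \<kappa>])
  qed
  have "\<forall>\<^sub>F \<kappa>' in nhds \<kappa>. \<forall>x. span (\<eta> ` J) = UNIV \<and> card J = DIM('a) \<and> (\<forall>j\<in>J. \<eta> j \<bullet> x = \<kappa>' $ j) \<and> x \<in> polytope_of \<eta> \<kappa>'
     \<longrightarrow> (\<forall>k. k \<notin> J \<longrightarrow> \<eta> k \<bullet> x < \<kappa>' $ k)" for J
  proof (cases "span (\<eta> ` J) = UNIV \<and> card J = DIM('a)")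
    case True
    have "\<exists>u. \<forall>i\<in>J. \<eta> i \<bullet> u = (if i = j then 1 else 0)" for j
    proof -
      obtain u where "\<And>i. i \<in> J \<Longrightarrow> \<eta> i \<bullet> u = (if i = j then 1 else 0)"
      proof (rule inner_system_solvable[of J \<eta> "\<lambda>i. if i = j then 1 else 0"])
        fix \<beta> assume "(\<Sum>k\<in>J. \<beta> k *\<^sub>R \<eta> k) = 0"
        then have "\<beta> k = 0" if "k \<in> J" for k
          using True that by (intro no_relation_if_spanning[of J UNIV \<eta> \<beta> k]) (auto simp: dim_UNIV)
        then show "(\<Sum>k\<in>J. \<beta> k * (if k = j then 1 else 0)) = 0" by simp
      qed auto
      then show ?thesis by blast
    qed
    then obtain u where u: "\<And>j i. i \<in> J \<Longrightarrow> \<eta> i \<bullet> u j = (if i = j then 1 else 0)" by metis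
    define X where "X \<kappa>' = (\<Sum>j\<in>J. (\<kappa>' $ j) *\<^sub>R u j)" for \<kappa>' :: "real ^ 'i"
    have X: "\<eta> i \<bullet> X \<kappa>' = \<kappa>' $ i" if "i \<in> J" for i \<kappa>'
    proof -
      have "\<eta> i \<bullet> X \<kappa>' = (\<Sum>j\<in>J. if i = j then \<kappa>' $ j else 0)"
        unfolding X_def inner_sum_right using u[OF that] by (intro sum.cong) auto
      then show ?thesis using that by simp
    qed
    have uniq: "x = X \<kappa>'" if "\<forall>j\<in>J. \<eta> j \<bullet> x = \<kappa>' $ j" for x \<kappa>'
      using that X True by (intro inner_eq_on_spanning[of _ _ \<eta> J]) auto
    have cX: "isCont X \<kappa>" unfolding X_def[abs_def] by (intro continuous_intros)
    show ?thesis
    proof (cases "X \<kappa> \<in> polytope_of \<eta> \<kappa>")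
      case inP: True
      have "X \<kappa> extreme_point_of polytope_of \<eta> \<kappa>"
        using inP X True by (intro extreme_point_if_active_span[where J = J]) auto
      then have "card {i. X \<kappa> \<in> facet_of_index \<eta> \<kappa> i} = card J" using vert True by simp
      moreover have "J \<subseteq> {i. X \<kappa> \<in> facet_of_index \<eta> \<kappa> i}" using inP X by (auto simp: mem_facet mem_halfspace_inter)
      ultimately have "J = {i. X \<kappa> \<in> facet_of_index \<eta> \<kappa> i}" by (metis card_subset_eq finite)
      then have *: "\<eta> k \<bullet> X \<kappa> < \<kappa> $ k" if "k \<notin> J" for k
        using inP that by (auto simp: mem_facet mem_halfspace_inter less_le)
      have "\<forall>\<^sub>F \<kappa>' in nhds \<kappa>. \<forall>k. k \<notin> J \<longrightarrow> \<eta> k \<bullet> X \<kappa>' < \<kappa>' $ k"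
      proof (intro eventually_all_finite)
        fix k show "\<forall>\<^sub>F \<kappa>' in nhds \<kappa>. k \<notin> J \<longrightarrow> \<eta> k \<bullet> X \<kappa>' < \<kappa>' $ k"
          using eventually_inner_less[OF cX, of "\<eta> k" k] *[of k] by (cases "k \<in> J") auto
      qed
      then show ?thesis by (rule eventually_mono) (use uniq in blast)
    next
      case False
      then obtain k where "\<eta> k \<bullet> X \<kappa> > \<kappa> $ k" by (auto simp: mem_halfspace_inter not_le)
      then have "\<forall>\<^sub>F \<kappa>' in nhds \<kappa>. \<eta> k \<bullet> X \<kappa>' > \<kappa>' $ k" using cX by (rule eventually_inner_greater[rotated])
      then show ?thesis
        by (rule eventually_mono) (use uniq in \<open>auto simp: mem_halfspace_inter not_le[symmetric]\<close>)
    qed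
  next
    case False
    then show ?thesis by (intro always_eventually) blast
  qed
  then have ev_J: "\<forall>\<^sub>F \<kappa>' in nhds \<kappa>. \<forall>J x. span (\<eta> ` J) = UNIV \<and> card J = DIM('a) \<and> (\<forall>j\<in>J. \<eta> j \<bullet> x = \<kappa>' $ j) \<and> x \<in> polytope_of \<eta> \<kappa>'
     \<longrightarrow> (\<forall>k. k \<notin> J \<longrightarrow> \<eta> k \<bullet> x < \<kappa>' $ k)"
    by (rule eventually_all_finite)
  show ?thesis using ev_q ev_p ev_J
  proof eventually_elim
    case (elim \<kappa>')
    have "facet_polytope UNIV UNIV \<eta> (($) \<kappa>')"
      using elim(1,2) bdd nz by (intro facet_polytopeI[where q = q and p = "\<lambda>i. p' i \<kappa>'"]) (auto simp: p'1)
    moreover have "card {i. v \<in> facet_of_index \<eta> \<kappa>' i} = DIM('a)" if v: "v extreme_point_of polytope_of \<eta> \<kappa>'" for v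
    proof -
      let ?J = "{i. v \<in> facet_of_index \<eta> \<kappa>' i}"
      have "span (\<eta> ` ?J) = UNIV"
        using active_span_at_extreme_point[OF subspace_UNIV _ _ v] by simp
      obtain B where B: "B \<subseteq> \<eta> ` ?J" "independent B" "\<eta> ` ?J \<subseteq> span B" by (rule maximal_independent_subset)
      then have spB: "span B = UNIV" using \<open>span (\<eta> ` ?J) = UNIV\<close> by (metis span_mono span_span top.extremum_uniqueI)
      have "\<exists>J\<subseteq>?J. inj_on \<eta> J \<and> B = \<eta> ` J" using B(1) by (rule subset_image_inj[THEN iffD1])
      then obtain J where J: "J \<subseteq> ?J" "inj_on \<eta> J" "B = \<eta> ` J" by blast
      have "card J = DIM('a)" using J B(2) spB by (metis card_image dim_UNIV dim_eq_card_independent dim_span)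
      moreover have "v \<in> polytope_of \<eta> \<kappa>'" using v by (simp add: extreme_point_of_def)
      ultimately have "\<forall>k. k \<notin> J \<longrightarrow> \<eta> k \<bullet> v < \<kappa>' $ k"
        using elim(3) J spB by (auto simp: mem_facet subset_iff)
      then have "?J = J" using J(1) by (auto simp: mem_facet)
      with \<open>card J = DIM('a)\<close> show ?thesis by simp
    qed
    ultimately show "simple_polytope UNIV UNIV \<eta> (($) \<kappa>')" by (simp add: simple_polytope_def dim_UNIV)
  qed
qed

lemma chamber_ball:
  fixes \<eta> :: "'i::finite \<Rightarrow> 'a::euclidean_space"
  assumes "simple_polytope UNIV UNIV \<eta> (($) \<kappa>)"
  obtains e where "e > 0" "ball \<kappa> e \<subseteq> chamber \<eta> \<kappa>"
proof -
  obtain e where e: "e > 0" "\<And>\<kappa>'. dist \<kappa>' \<kappa> < e \<Longrightarrow> simple_polytope UNIV UNIV \<eta> (($) \<kappa>')"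
    using eventually_simple_polytope[OF assms] by (auto simp: eventually_nhds_metric)
  have "ball \<kappa> e \<subseteq> chamber \<eta> \<kappa>" unfolding chamber_def
    using e by (intro connected_component_maximal) (auto simp: dist_commute convex_connected)
  with e(1) show thesis by (rule that)
qed

lemma simple_if_in_chamber: "\<kappa>' \<in> chamber \<eta> \<kappa> \<Longrightarrow> simple_polytope UNIV UNIV \<eta> (($) \<kappa>')"
  unfolding chamber_def using connected_component_subset by blast

lemma simple_if_simple_or_smooth:
  "simple_or_smooth_polytope \<Lambda> \<eta> \<kappa> \<Longrightarrow> simple_polytope UNIV UNIV \<eta> (($) \<kappa>)"
  by (auto simp: simple_or_smooth_polytope_def smooth_polytope_def split: option.splits)

lemma self_in_chamber: "simple_polytope UNIV UNIV \<eta> (($) \<kappa>) \<Longrightarrow> \<kappa> \<in> chamber \<eta> \<kappa>"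
  unfolding chamber_def by (simp add: connected_component_refl)

text \<open>
  Any linear description of a polytope contains every facet inequality, up to a positive factor:
  at a point that lies on one facet only, the tangent cone is a half space.
\<close>

lemma facet_inequality_in_description:
  fixes e :: "'k \<Rightarrow> 'a::euclidean_space"
  assumes fp: "facet_polytope UNIV I \<eta> \<kappa>" and i: "i \<in> I" and "finite K"
    and P: "halfspace_inter UNIV I \<eta> \<kappa> = {x. \<forall>k\<in>K. e k \<bullet> x \<le> c k}"
  obtains k t where "k \<in> K" "t > 0" "\<eta> i = t *\<^sub>R e k" "\<kappa> i = t * c k"
proof -
  have fin: "finite I" and nz: "\<eta> i \<noteq> 0" using fp i by (auto simp: facet_polytope_def)
  obtain p where p: "\<eta> i \<bullet> p = \<kappa> i" "\<And>k. k \<in> I \<Longrightarrow> k \<noteq> i \<Longrightarrow> \<eta> k \<bullet> p < \<kappa> k"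
    using facet_only_point[OF fp i] by metis
  have pP: "p \<in> halfspace_inter UNIV I \<eta> \<kappa>" using p by (force simp: mem_halfspace_inter)
  define K' where "K' = {k \<in> K. e k \<bullet> p = c k}"
  have small: "\<exists>s>0. p + s *\<^sub>R d \<in> U" if "open U" "p \<in> U" for d U
  proof -
    have "((\<lambda>s. p + s *\<^sub>R d) \<longlongrightarrow> p + 0 *\<^sub>R d) (at_right 0)" by (intro tendsto_intros)
    then have "eventually (\<lambda>s. p + s *\<^sub>R d \<in> U) (at_right 0)"
      using that by (intro topological_tendstoD) auto
    moreover have "eventually (\<lambda>s::real. s > 0) (at_right 0)" by (simp add: eventually_at_right_less)
    ultimately have "eventually (\<lambda>s. s > 0 \<and> p + s *\<^sub>R d \<in> U) (at_right 0)" by eventually_elim simp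
    then show ?thesis by (auto dest!: eventually_happens)
  qed
  have cone: "e k \<bullet> d \<le> 0" if k: "k \<in> K'" and d: "\<eta> i \<bullet> d \<le> 0" for k d
  proof -
    have "open {x. \<forall>k\<in>I - {i}. \<eta> k \<bullet> x < \<kappa> k}" using fin by (intro strict_neighbourhood) auto
    then obtain s where s: "s > 0" "\<forall>k\<in>I - {i}. \<eta> k \<bullet> (p + s *\<^sub>R d) < \<kappa> k"
      using small p by blast
    have "\<eta> i \<bullet> (p + s *\<^sub>R d) \<le> \<kappa> i" using p s d by (simp add: inner_add_right mult_nonneg_nonpos)
    with s have "p + s *\<^sub>R d \<in> halfspace_inter UNIV I \<eta> \<kappa>"
      unfolding mem_halfspace_inter by (metis DiffI UNIV_I empty_iff insert_iff less_imp_le)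
    then have "e k \<bullet> (p + s *\<^sub>R d) \<le> c k" using P k by (auto simp: K'_def)
    then show ?thesis using k s(1) by (simp add: K'_def inner_add_right mult_le_0_iff)
  qed
  have mult: "\<exists>t\<ge>0. e k = t *\<^sub>R \<eta> i" if k: "k \<in> K'" for k
  proof -
    define t where "t = (e k \<bullet> \<eta> i) / (\<eta> i \<bullet> \<eta> i)"
    define z where "z = e k - t *\<^sub>R \<eta> i"
    have 0: "\<eta> i \<bullet> z = 0" using nz by (simp add: z_def t_def inner_diff_right inner_commute)
    then have "e k \<bullet> z \<le> 0" using cone[OF k] by simp
    moreover have "z \<bullet> z = e k \<bullet> z" using 0 by (subst (1) z_def) (simp add: inner_diff_left)
    ultimately have "z = 0" using inner_gt_zero_iff[of z] by linarith
    moreover have "e k \<bullet> (- \<eta> i) \<le> 0" by (rule cone[OF k]) simp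
    then have "t \<ge> 0" by (simp add: t_def)
    ultimately show ?thesis by (auto simp: z_def)
  qed
  have "\<exists>k\<in>K'. e k \<noteq> 0"
  proof (rule ccontr)
    assume no: "\<not> ?thesis"
    have "open {x. \<forall>k\<in>K - K'. e k \<bullet> x < c k}" using \<open>finite K\<close> by (intro strict_neighbourhood) auto
    moreover have "p \<in> {x. \<forall>k\<in>K - K'. e k \<bullet> x < c k}"
      using pP P by (auto simp: K'_def less_le)
    ultimately obtain s where s: "s > 0" "\<forall>k\<in>K - K'. e k \<bullet> (p + s *\<^sub>R \<eta> i) < c k"
      using small by blast
    have "e k \<bullet> (p + s *\<^sub>R \<eta> i) \<le> c k" if "k \<in> K" for k
    proof (cases "k \<in> K'")
      case True
      then have "e k = 0" "e k \<bullet> p = c k" using no by (auto simp: K'_def)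
      then show ?thesis by simp
    qed (use s that in \<open>auto simp: less_imp_le\<close>)
    then have "p + s *\<^sub>R \<eta> i \<in> halfspace_inter UNIV I \<eta> \<kappa>" using P by auto
    then have "\<eta> i \<bullet> (p + s *\<^sub>R \<eta> i) \<le> \<kappa> i" using i by (simp add: mem_halfspace_inter)
    then have "s * (\<eta> i \<bullet> \<eta> i) \<le> 0" using p by (simp add: inner_add_right)
    moreover have "s * (\<eta> i \<bullet> \<eta> i) > 0" using s nz by (intro mult_pos_pos) auto
    ultimately show False by linarith
  qed
  then obtain k where k: "k \<in> K'" "e k \<noteq> 0" by blast
  from mult[OF k(1)] obtain t where t: "t \<ge> 0" "e k = t *\<^sub>R \<eta> i" by blast
  with k have "t > 0" by (cases "t = 0") auto
  have "c k = t * \<kappa> i" using k t p by (auto simp: K'_def)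
  show thesis
    by (rule that[of k "1 / t"]) (use \<open>t > 0\<close> t \<open>c k = t * \<kappa> i\<close> k in \<open>auto simp: K'_def\<close>)
qed

section \<open>Lattices\<close>

lemma finite_lattice_basis: "lattice_basis L B \<Longrightarrow> finite B"
  by (simp add: lattice_basis_def independent_imp_finite)

lemma int_spanI: "(\<Sum>b\<in>B. of_int (c b) *\<^sub>R b) \<in> int_span B"
  unfolding int_span_def by blast

lemma int_span_image:
  fixes x :: "'k \<Rightarrow> 'a::euclidean_space"
  assumes "finite K" "inj_on x K"
  shows "int_span (x ` K) = {\<Sum>k\<in>K. of_int (n k) *\<^sub>R x k | n :: 'k \<Rightarrow> int. True}"
proof -
  have "\<exists>n. (\<Sum>v\<in>x ` K. of_int (c v) *\<^sub>R v) = (\<Sum>k\<in>K. of_int (n k) *\<^sub>R x k)" for c :: "'a \<Rightarrow> int"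
    by (rule exI[of _ "c \<circ> x"]) (simp add: sum.reindex[OF assms(2)])
  moreover have "\<exists>c. (\<Sum>k\<in>K. of_int (n k) *\<^sub>R x k) = (\<Sum>v\<in>x ` K. of_int (c v) *\<^sub>R v)" for n :: "'k \<Rightarrow> int"
    by (rule exI[of _ "n \<circ> the_inv_into K x"]) (simp add: sum.reindex[OF assms(2)] the_inv_into_f_f[OF assms(2)])
  ultimately show ?thesis unfolding int_span_def by auto
qed

lemma int_span_add: "u \<in> int_span B \<Longrightarrow> v \<in> int_span B \<Longrightarrow> u + v \<in> int_span B"
proof -
  assume "u \<in> int_span B" "v \<in> int_span B"
  then obtain c d where "u = (\<Sum>b\<in>B. of_int (c b) *\<^sub>R b)" "v = (\<Sum>b\<in>B. of_int (d b) *\<^sub>R b)"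
    by (auto simp: int_span_def)
  then have "u + v = (\<Sum>b\<in>B. of_int (c b + d b) *\<^sub>R b)" by (simp add: scaleR_add_left sum.distrib)
  then show ?thesis using int_spanI[of "\<lambda>b. c b + d b" B] by simp
qed

lemma int_span_scale: "u \<in> int_span B \<Longrightarrow> of_int m *\<^sub>R u \<in> int_span B"
proof -
  assume "u \<in> int_span B"
  then obtain c where "u = (\<Sum>b\<in>B. of_int (c b) *\<^sub>R b)" by (auto simp: int_span_def)
  then have "of_int m *\<^sub>R u = (\<Sum>b\<in>B. of_int (m * c b) *\<^sub>R b)" by (simp add: scaleR_sum_right)
  then show ?thesis using int_spanI[of "\<lambda>b. m * c b" B] by simp
qed

lemma int_span_0: "0 \<in> int_span B"
  using int_spanI[of "\<lambda>_. 0" B] by simp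

lemma int_span_sum: "(\<And>k. k \<in> K \<Longrightarrow> x k \<in> int_span B) \<Longrightarrow> (\<Sum>k\<in>K. of_int (n k) *\<^sub>R x k) \<in> int_span B"
  by (induction K rule: infinite_finite_induct) (auto intro: int_span_0 int_span_add int_span_scale)

text \<open>
  If a basis vector of the lattice is a positive multiple of a primitive vector, then the two agree.
\<close>

lemma primitive_multiple_of_basis_vector:
  fixes w :: "'a::euclidean_space"
  assumes B: "lattice_basis L B" "b \<in> B" and w: "primitive_vector L w" and t: "t > 0" "b = t *\<^sub>R w"
  shows "b = w"
proof -
  have fin: "finite B" and ind: "independent B" using B by (auto simp: finite_lattice_basis lattice_basis_def)
  have "w \<in> int_span B" using w B by (simp add: primitive_vector_def lattice_basis_def)
  then obtain c where c: "w = (\<Sum>v\<in>B. of_int (c v) *\<^sub>R v)" by (auto simp: int_span_def)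
  have "b = (\<Sum>v\<in>B. (t * of_int (c v)) *\<^sub>R v)" using t(2) c by (simp add: scaleR_sum_right)
  moreover have "(\<Sum>v\<in>B. (if v = b then 1 else 0) *\<^sub>R v) = b"
  proof -
    have "(\<Sum>v\<in>B. (if v = b then 1 else 0) *\<^sub>R v) = (\<Sum>v\<in>B. if v = b then v else 0)" by (rule sum.cong) auto
    then show ?thesis using B(2) fin by simp
  qed
  ultimately have "(\<Sum>v\<in>B. (t * of_int (c v) - (if v = b then 1 else 0)) *\<^sub>R v) = 0"
    by (simp add: scaleR_diff_left sum_subtractf)
  then have "t * of_int (c b) - (if b = b then 1 else 0) = (0::real)"
    using ind fin B(2) by (intro independentD[of B B "\<lambda>v. t * of_int (c v) - (if v = b then 1 else 0)"]) auto
  then have tc: "t * of_int (c b) = (1::real)" by simp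
  then have "c b > 0" using t(1) by (metis mult_eq_0_iff of_int_0_less_iff zero_less_mult_pos zero_less_one)
  have "w = of_int (c b) *\<^sub>R b"
  proof -
    have "of_int (c b) *\<^sub>R b = of_int (c b) *\<^sub>R (t *\<^sub>R w)" using t(2) by (rule arg_cong)
    also have "\<dots> = (t * of_int (c b)) *\<^sub>R w" by (simp only: scaleR_scaleR mult.commute)
    finally show ?thesis by (simp only: tc scaleR_one)
  qed
  then have "w = of_nat (nat (c b)) *\<^sub>R b" using \<open>c b > 0\<close> by simp
  moreover have "b \<in> L" using B(1)
  proof -
    have "b = (\<Sum>v\<in>B. of_int (if v = b then 1 else 0) *\<^sub>R v)"
      using \<open>(\<Sum>v\<in>B. (if v = b then 1 else 0) *\<^sub>R v) = b\<close> by (simp add: if_distrib cong: if_cong)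
    then show ?thesis using int_spanI[of "\<lambda>v. if v = b then 1 else 0" B] B(1) by (simp add: lattice_basis_def)
  qed
  ultimately have "nat (c b) = 1" using w by (auto simp: primitive_vector_def)
  with \<open>w = of_nat (nat (c b)) *\<^sub>R b\<close> show ?thesis by simp
qed

section \<open>Robust symmetries permute the conormals\<close>

lemma simple_imp_facet_polytope: "simple_polytope V I \<eta> \<kappa> \<Longrightarrow> facet_polytope V I \<eta> \<kappa>"
  by (simp add: simple_polytope_def)

lemma adjoint_inner:
  fixes A :: "'a::euclidean_space \<Rightarrow> 'b::euclidean_space"
  shows "linear A \<Longrightarrow> adjoint A h \<bullet> x = h \<bullet> A x"
  by (rule adjoint_clauses(2))

lemma facet_has_extreme_point:
  assumes fp: "facet_polytope V I \<eta> \<kappa>" and i: "i \<in> I"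
  obtains v where "v extreme_point_of (halfspace_inter V I \<eta> \<kappa>)" "v \<in> facet V I \<eta> \<kappa> i"
proof -
  let ?P = "halfspace_inter V I \<eta> \<kappa>"
  have kc: "compact ?P" "convex ?P"
    using assms by (auto simp: facet_polytope_def closed_halfspace_inter compact_eq_bounded_closed convex_halfspace_inter)
  have F: "facet V I \<eta> \<kappa> i = ?P \<inter> {x. \<eta> i \<bullet> x = \<kappa> i}" by (rule facet_def)
  obtain p where "p \<in> V" "\<eta> i \<bullet> p = \<kappa> i" "\<And>k. k \<in> I \<Longrightarrow> k \<noteq> i \<Longrightarrow> \<eta> k \<bullet> p < \<kappa> k"
    using facet_only_point[OF fp i] by metis
  then have "p \<in> facet V I \<eta> \<kappa> i" by (force simp: mem_facet)
  moreover have "compact (facet V I \<eta> \<kappa> i)" "convex (facet V I \<eta> \<kappa> i)"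
    unfolding F using kc by (auto intro!: compact_Int_closed closed_hyperplane convex_Int convex_hyperplane)
  ultimately obtain v where v: "v extreme_point_of (facet V I \<eta> \<kappa> i)"
    using extreme_point_exists_convex by blast
  have "facet V I \<eta> \<kappa> i face_of ?P" unfolding F
    using kc(2) i by (intro face_of_Int_supporting_hyperplane_le) (auto simp: mem_halfspace_inter)
  then show thesis using that v by (meson extreme_point_of_def extreme_point_of_face)
qed

lemma symmetry_linear_bij:
  assumes "symmetry \<Lambda> (polytope_of \<eta> \<kappa>) a A" "facet_polytope UNIV UNIV \<eta> (($) \<kappa>)"
  shows "linear A" "inj A" "surj A"
proof -
  obtain b where A: "linear A" "\<And>x. a x = A x + b" "a ` polytope_of \<eta> \<kappa> = polytope_of \<eta> \<kappa>"
    using assms by (auto simp: symmetry_def)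
  have "polytope_of \<eta> \<kappa> \<subseteq> (+) b ` range A"
  proof
    fix y assume "y \<in> polytope_of \<eta> \<kappa>"
    then obtain x where "y = a x" using A(3) by blast
    then show "y \<in> (+) b ` range A" using A(2) by (auto simp: add.commute)
  qed
  moreover have "affine ((+) b ` range A)"
    using A(1) by (metis affine_translation subspace_UNIV linear_subspace_image subspace_imp_affine)
  ultimately have "affine hull (polytope_of \<eta> \<kappa>) \<subseteq> (+) b ` range A" by (rule hull_minimal)
  then have "(+) b ` range A = UNIV" using assms(2) by (auto simp: facet_polytope_def)
  then have "range A = UNIV" by (metis add_left_cancel image_iff UNIV_I UNIV_eq_I)
  then show "surj A" .
  then show "inj A" using A(1) by (metis linear_surjective_imp_injective)
  show "linear A" by fact
qed

lemma inj_adjoint_if_surj: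
  fixes A :: "'a::euclidean_space \<Rightarrow> 'a"
  assumes "linear A" "surj A" shows "inj (adjoint A)"
proof -
  have "h = 0" if "adjoint A h = 0" for h
  proof -
    obtain x where "h = A x" using assms(2) by (metis surjD)
    then have "h \<bullet> h = adjoint A h \<bullet> x" using assms(1) by (simp add: adjoint_inner)
    then show ?thesis using that by simp
  qed
  then show ?thesis using assms(1) by (simp add: linear_injective_0 adjoint_linear)
qed

lemma mem_image_symmetry:
  assumes "symmetry \<Lambda> P a A" "inj A"
  shows "a x \<in> P \<longleftrightarrow> x \<in> P"
proof -
  have "inj a" using assms by (auto simp: symmetry_def inj_def)
  then show ?thesis using assms(1) by (metis inj_image_mem_iff symmetry_def)
qed

lemma conormals_inj:
  assumes "facet_polytope V I \<eta> \<kappa>" shows "inj_on \<eta> I"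
  using conormal_direction_unique[OF assms, of _ _ 1] by (auto intro: inj_onI)

text \<open>
  The pulled back conormal is primitive and \<open>\<eta> i\<close> belongs to the lattice basis of a vertex of its facet,
  so the two agree.
\<close>

lemma smooth_adjoint_scaling:
  assumes sm: "smooth_polytope UNIV L UNIV \<eta> (($) \<kappa>)" and A: "linear A" "surj A" "bij_betw (adjoint A) L L"
    and t: "t > 0" "\<eta> i = t *\<^sub>R adjoint A (\<eta> k)"
  shows "\<eta> i = adjoint A (\<eta> k)"
proof -
  obtain v where v: "v extreme_point_of polytope_of \<eta> \<kappa>" "v \<in> facet_of_index \<eta> \<kappa> i"
    using facet_has_extreme_point[of UNIV UNIV \<eta> "($) \<kappa>" i] sm
    by (auto simp: smooth_polytope_def simple_imp_facet_polytope)
  have B: "lattice_basis L (\<eta> ` {i. v \<in> facet_of_index \<eta> \<kappa> i})" using sm v by (simp add: smooth_polytope_def)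
  have pk: "primitive_vector L (\<eta> k)" using sm by (simp add: smooth_polytope_def)
  have injA: "inj (adjoint A)" using A by (intro inj_adjoint_if_surj)
  have "primitive_vector L (adjoint A (\<eta> k))"
    unfolding primitive_vector_def
  proof (intro conjI ballI allI impI)
    show "adjoint A (\<eta> k) \<in> L" using A(3) pk by (auto simp: bij_betw_def primitive_vector_def)
    show "adjoint A (\<eta> k) \<noteq> 0"
      using pk injA A(1) by (metis adjoint_linear injD linear_0 primitive_vector_def)
    fix w n assume w: "w \<in> L" "adjoint A (\<eta> k) = real n *\<^sub>R w"
    obtain w' where w': "w' \<in> L" "w = adjoint A w'" using A(3) w(1) by (auto simp: bij_betw_def)
    then have "adjoint A (\<eta> k) = adjoint A (real n *\<^sub>R w')" using w A(1) by (simp add: adjoint_linear linear_scale)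
    then have "\<eta> k = real n *\<^sub>R w'" using injA by (simp add: inj_eq)
    then show "n = 1" using pk w' by (auto simp: primitive_vector_def)
  qed
  then show ?thesis using primitive_multiple_of_basis_vector[OF B _ _ t] v by auto
qed

lemma simple_or_smooth_facet_polytope:
  "simple_or_smooth_polytope \<Lambda> \<eta> \<kappa> \<Longrightarrow> facet_polytope UNIV UNIV \<eta> (($) \<kappa>)"
  by (intro simple_imp_facet_polytope simple_if_simple_or_smooth)

lemma simple_or_smooth_inj: "simple_or_smooth_polytope \<Lambda> \<eta> \<kappa> \<Longrightarrow> inj \<eta>"
  using conormals_inj simple_or_smooth_facet_polytope by blast

text \<open>
  The robust symmetry with linear part \<open>A\<close> permutes the facets by \<open>\<tau>\<close>, its adjoint permutes the
  conormals accordingly without rescaling, and every symmetry \<open>a\<close> with this linear part preserves the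
  slacks.
\<close>

definition induces_permutation ::
  "'a::euclidean_space set option \<Rightarrow> ('i::finite \<Rightarrow> 'a) \<Rightarrow> real ^ 'i \<Rightarrow> ('a \<Rightarrow> 'a) \<Rightarrow> ('i \<Rightarrow> 'i) \<Rightarrow> bool" where
  "induces_permutation \<Lambda> \<eta> \<kappa> A \<tau> \<longleftrightarrow>
     robust_symmetry \<Lambda> \<eta> \<kappa> A \<and> bij \<tau> \<and> (\<forall>i. adjoint A (\<eta> (\<tau> i)) = \<eta> i) \<and>
     (\<forall>\<kappa>'\<in>chamber \<eta> \<kappa>. \<forall>a. symmetry \<Lambda> (polytope_of \<eta> \<kappa>') a A \<longrightarrow>
        (\<forall>i x. \<eta> (\<tau> i) \<bullet> a x - \<kappa>' $ \<tau> i = \<eta> i \<bullet> x - \<kappa>' $ i))"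

text \<open>
  The inequalities pulled back along a symmetry describe the same polytope, so each facet inequality is a
  positive multiple of one of them. The factor is \<open>1\<close> by the normalization of the conormals.
\<close>

lemma robust_symmetry_induces_permutation:
  fixes \<eta> :: "'i::finite \<Rightarrow> 'a::euclidean_space"
  assumes ss: "simple_or_smooth_polytope \<Lambda> \<eta> \<kappa>" and rob: "robust_symmetry \<Lambda> \<eta> \<kappa> A"
  obtains \<tau> where "induces_permutation \<Lambda> \<eta> \<kappa> A \<tau>"
proof -
  have simp: "simple_polytope UNIV UNIV \<eta> (($) \<kappa>)" using ss by (rule simple_if_simple_or_smooth)
  have fp: "facet_polytope UNIV UNIV \<eta> (($) \<kappa>)" using simp by (rule simple_imp_facet_polytope)
  have in\<eta>: "inj \<eta>" using fp by (rule conormals_inj)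
  have \<kappa>: "\<kappa> \<in> chamber \<eta> \<kappa>" using simp by (rule self_in_chamber)
  then obtain a0 where a0: "symmetry \<Lambda> (polytope_of \<eta> \<kappa>) a0 A" using rob by (auto simp: robust_symmetry_def)
  note A = symmetry_linear_bij[OF a0 fp]
  have injA: "inj (adjoint A)" using A by (intro inj_adjoint_if_surj)
  have rescale: "\<eta> i = adjoint A (\<eta> k)" if t: "t > 0" "\<eta> i = t *\<^sub>R adjoint A (\<eta> k)" for i k t
  proof (cases \<Lambda>)
    case None
    then have "normalized_conormals None \<eta> \<kappa>" using ss by (simp add: simple_or_smooth_polytope_def)
    then obtain j where j: "adjoint A (\<eta> k) = \<eta> j" using rob None by (auto simp: normalized_conormals_def)
    then have "j = i" using conormal_direction_unique[OF fp, of j i t] t by simp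
    then show ?thesis using j by simp
  next
    case (Some L)
    then show ?thesis
      using ss a0 A t by (intro smooth_adjoint_scaling[of L \<eta> \<kappa> A t i k]) (auto simp: simple_or_smooth_polytope_def symmetry_def)
  qed
  have key: "\<exists>k. \<eta> i = adjoint A (\<eta> k) \<and> \<kappa>' $ i = \<kappa>' $ k - \<eta> k \<bullet> b"
    if \<kappa>': "\<kappa>' \<in> chamber \<eta> \<kappa>" and a: "symmetry \<Lambda> (polytope_of \<eta> \<kappa>') a A" and b: "\<And>x. a x = A x + b" for i \<kappa>' a b
  proof -
    have fp': "facet_polytope UNIV UNIV \<eta> (($) \<kappa>')"
      using \<kappa>' by (intro simple_imp_facet_polytope simple_if_in_chamber)
    have "polytope_of \<eta> \<kappa>' = {x. \<forall>k\<in>UNIV. adjoint A (\<eta> k) \<bullet> x \<le> \<kappa>' $ k - \<eta> k \<bullet> b}"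
    proof (intro set_eqI)
      fix x
      have "x \<in> polytope_of \<eta> \<kappa>' \<longleftrightarrow> a x \<in> polytope_of \<eta> \<kappa>'" using mem_image_symmetry[OF a A(2)] by simp
      also have "\<dots> \<longleftrightarrow> x \<in> {x. \<forall>k\<in>UNIV. adjoint A (\<eta> k) \<bullet> x \<le> \<kappa>' $ k - \<eta> k \<bullet> b}"
        using A(1) by (simp add: mem_halfspace_inter b inner_add_right adjoint_inner algebra_simps)
      finally show "x \<in> polytope_of \<eta> \<kappa>' \<longleftrightarrow> x \<in> {x. \<forall>k\<in>UNIV. adjoint A (\<eta> k) \<bullet> x \<le> \<kappa>' $ k - \<eta> k \<bullet> b}" .
    qed
    then obtain k t where kt: "t > 0" "\<eta> i = t *\<^sub>R adjoint A (\<eta> k)" "\<kappa>' $ i = t * (\<kappa>' $ k - \<eta> k \<bullet> b)"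
      by (rule facet_inequality_in_description[OF fp' UNIV_I finite])
    have "\<eta> i = adjoint A (\<eta> k)" using kt rescale by blast
    moreover have "\<eta> i \<noteq> 0" using fp by (auto simp: facet_polytope_def)
    ultimately have "t = 1" using kt(2) by (metis scaleR_cancel_right scaleR_one)
    with kt \<open>\<eta> i = adjoint A (\<eta> k)\<close> show ?thesis by auto
  qed
  obtain b0 where b0: "\<And>x. a0 x = A x + b0" using a0 by (auto simp: symmetry_def)
  obtain \<tau> where \<tau>: "\<And>i. \<eta> i = adjoint A (\<eta> (\<tau> i))" using key[OF \<kappa> a0 b0] by metis
  have "inj \<tau>" using \<tau> in\<eta> by (metis injD injI)
  then have "bij \<tau>" by (simp add: bij_def finite_UNIV_inj_surj)
  moreover have "\<eta> (\<tau> i) \<bullet> a x - \<kappa>' $ \<tau> i = \<eta> i \<bullet> x - \<kappa>' $ i"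
    if \<kappa>': "\<kappa>' \<in> chamber \<eta> \<kappa>" and a: "symmetry \<Lambda> (polytope_of \<eta> \<kappa>') a A" for \<kappa>' a i x
  proof -
    obtain b where b: "\<And>x. a x = A x + b" using a by (auto simp: symmetry_def)
    obtain k where k: "\<eta> i = adjoint A (\<eta> k)" "\<kappa>' $ i = \<kappa>' $ k - \<eta> k \<bullet> b" using key[OF \<kappa>' a b] by blast
    have "k = \<tau> i" using k(1) \<tau>[of i] injA in\<eta> by (metis injD)
    then show ?thesis using k A(1) \<tau>[of i] by (simp add: b inner_add_right adjoint_inner)
  qed
  ultimately show thesis using that rob \<tau> unfolding induces_permutation_def by metis
qed

lemma induces_permutation_facets:
  fixes \<eta> :: "'i::finite \<Rightarrow> 'a::euclidean_space"
  assumes ip: "induces_permutation \<Lambda> \<eta> \<kappa> A \<tau>" and \<kappa>': "\<kappa>' \<in> chamber \<eta> \<kappa>"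
    and a: "symmetry \<Lambda> (polytope_of \<eta> \<kappa>') a A"
  shows "a ` facet_of_index \<eta> \<kappa>' i = facet_of_index \<eta> \<kappa>' (\<tau> i)"
proof -
  have *: "\<eta> (\<tau> i) \<bullet> a x = \<kappa>' $ \<tau> i \<longleftrightarrow> \<eta> i \<bullet> x = \<kappa>' $ i" for x
  proof -
    have "\<eta> (\<tau> i) \<bullet> a x - \<kappa>' $ \<tau> i = \<eta> i \<bullet> x - \<kappa>' $ i"
      using ip \<kappa>' a by (auto simp: induces_permutation_def)
    then show ?thesis by linarith
  qed
  have im: "a ` polytope_of \<eta> \<kappa>' = polytope_of \<eta> \<kappa>'" using a by (simp add: symmetry_def)
  show ?thesis unfolding facet_def
  proof (intro equalityI subsetI)
    fix y assume "y \<in> a ` (polytope_of \<eta> \<kappa>' \<inter> {x. \<eta> i \<bullet> x = \<kappa>' $ i})"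
    then show "y \<in> polytope_of \<eta> \<kappa>' \<inter> {x. \<eta> (\<tau> i) \<bullet> x = \<kappa>' $ \<tau> i}" using im * by auto
  next
    fix y assume y: "y \<in> polytope_of \<eta> \<kappa>' \<inter> {x. \<eta> (\<tau> i) \<bullet> x = \<kappa>' $ \<tau> i}"
    then obtain x where x: "x \<in> polytope_of \<eta> \<kappa>'" "y = a x" using im by blast
    then show "y \<in> a ` (polytope_of \<eta> \<kappa>' \<inter> {x. \<eta> i \<bullet> x = \<kappa>' $ i})" using y * by auto
  qed
qed

lemma facets_equivalent_iff:
  fixes \<eta> :: "'i::finite \<Rightarrow> 'a::euclidean_space"
  assumes ss: "simple_or_smooth_polytope \<Lambda> \<eta> \<kappa>"
  shows "facets_equivalent \<Lambda> \<eta> \<kappa> i j \<longleftrightarrow> (\<exists>A \<tau>. induces_permutation \<Lambda> \<eta> \<kappa> A \<tau> \<and> \<tau> i = j)"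
proof
  assume "facets_equivalent \<Lambda> \<eta> \<kappa> i j"
  then obtain A where A: "robust_symmetry \<Lambda> \<eta> \<kappa> A"
    "\<And>\<kappa>' a. \<kappa>' \<in> chamber \<eta> \<kappa> \<Longrightarrow> symmetry \<Lambda> (polytope_of \<eta> \<kappa>') a A \<Longrightarrow>
        a ` facet_of_index \<eta> \<kappa>' i = facet_of_index \<eta> \<kappa>' j"
    by (auto simp: facets_equivalent_def)
  obtain \<tau> where \<tau>: "induces_permutation \<Lambda> \<eta> \<kappa> A \<tau>"
    using robust_symmetry_induces_permutation[OF ss A(1)] by blast
  have simp: "simple_polytope UNIV UNIV \<eta> (($) \<kappa>)" using ss by (rule simple_if_simple_or_smooth)
  have \<kappa>: "\<kappa> \<in> chamber \<eta> \<kappa>" using simp by (rule self_in_chamber)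
  then obtain a0 where a0: "symmetry \<Lambda> (polytope_of \<eta> \<kappa>) a0 A" using A by (auto simp: robust_symmetry_def)
  have "facet_of_index \<eta> \<kappa> (\<tau> i) = facet_of_index \<eta> \<kappa> j"
    using A(2)[OF \<kappa> a0] induces_permutation_facets[OF \<tau> \<kappa> a0] by simp
  then have "\<tau> i = j" using simp by (auto simp: simple_polytope_def facet_polytope_def dest: injD)
  with \<tau> show "\<exists>A \<tau>. induces_permutation \<Lambda> \<eta> \<kappa> A \<tau> \<and> \<tau> i = j" by blast
next
  assume "\<exists>A \<tau>. induces_permutation \<Lambda> \<eta> \<kappa> A \<tau> \<and> \<tau> i = j"
  then obtain A \<tau> where "induces_permutation \<Lambda> \<eta> \<kappa> A \<tau>" "\<tau> i = j" by blast
  then show "facets_equivalent \<Lambda> \<eta> \<kappa> i j"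
    using induces_permutation_facets[of \<Lambda> \<eta> \<kappa> A \<tau>]
    unfolding facets_equivalent_def by (intro exI[of _ A]) (simp add: induces_permutation_def)
qed

lemma induces_permutation_id:
  fixes \<eta> :: "'i::finite \<Rightarrow> 'a::euclidean_space"
  assumes ss: "simple_or_smooth_polytope \<Lambda> \<eta> \<kappa>"
  obtains A where "induces_permutation \<Lambda> \<eta> \<kappa> A id"
proof -
  have adj: "adjoint (\<lambda>x::'a. x) = (\<lambda>x. x)" by (rule adjoint_unique) simp
  have "symmetry \<Lambda> P (\<lambda>x. x) (\<lambda>x. x)" for P :: "'a set"
    by (auto simp: symmetry_def adj bij_betw_def linear_ident intro: exI[of _ 0] split: option.splits)
  then have rob: "robust_symmetry \<Lambda> \<eta> \<kappa> (\<lambda>x. x)" unfolding robust_symmetry_def using linear_ident by blast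
  then obtain \<tau> where \<tau>: "induces_permutation \<Lambda> \<eta> \<kappa> (\<lambda>x. x) \<tau>"
    using robust_symmetry_induces_permutation[OF ss] by blast
  have "inj \<eta>" using ss by (rule simple_or_smooth_inj)
  then have "\<tau> = id" using \<tau> by (auto simp: induces_permutation_def adj inj_eq)
  with \<tau> show thesis using that by simp
qed

lemma induces_permutation_comp:
  fixes \<eta> :: "'i::finite \<Rightarrow> 'a::euclidean_space"
  assumes ss: "simple_or_smooth_polytope \<Lambda> \<eta> \<kappa>"
    and 1: "induces_permutation \<Lambda> \<eta> \<kappa> A \<tau>" and 2: "induces_permutation \<Lambda> \<eta> \<kappa> B \<sigma>"
  shows "induces_permutation \<Lambda> \<eta> \<kappa> (B \<circ> A) (\<sigma> \<circ> \<tau>)"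
proof -
  have lin: "linear A" "linear B" using 1 2 by (auto simp: induces_permutation_def robust_symmetry_def)
  have adj: "adjoint (B \<circ> A) = adjoint A \<circ> adjoint B"
    by (rule adjoint_unique) (simp add: lin adjoint_works)
  have "symmetry \<Lambda> P (c \<circ> a) (B \<circ> A)" if a: "symmetry \<Lambda> P a A" and c: "symmetry \<Lambda> P c B" for P a c
    unfolding symmetry_def
  proof (intro conjI)
    show "linear (B \<circ> A)" using lin by (intro linear_compose)
    obtain b d where "\<forall>x. a x = A x + b" "\<forall>x. c x = B x + d" using a c by (auto simp: symmetry_def)
    then have "\<forall>x. (c \<circ> a) x = (B \<circ> A) x + (B b + d)" using lin by (simp add: linear_add)
    then show "\<exists>b. \<forall>x. (c \<circ> a) x = (B \<circ> A) x + b" by blast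
    show "(c \<circ> a) ` P = P" using a c unfolding image_comp[symmetric] by (simp add: symmetry_def)
    show "case \<Lambda> of None \<Rightarrow> True | Some L \<Rightarrow> bij_betw (adjoint (B \<circ> A)) L L"
      using a c by (auto simp: symmetry_def adj split: option.splits intro: bij_betw_trans)
  qed
  then have rob: "robust_symmetry \<Lambda> \<eta> \<kappa> (B \<circ> A)"
    using 1 2 lin unfolding induces_permutation_def robust_symmetry_def by (meson linear_compose)
  then obtain \<rho> where \<rho>: "induces_permutation \<Lambda> \<eta> \<kappa> (B \<circ> A) \<rho>"
    using robust_symmetry_induces_permutation[OF ss] by blast
  have in\<eta>: "inj \<eta>" using ss by (rule simple_or_smooth_inj)
  have "\<rho> i = (\<sigma> \<circ> \<tau>) i" for i
  proof -
    have fp: "facet_polytope UNIV UNIV \<eta> (($) \<kappa>)"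
      using ss by (intro simple_imp_facet_polytope simple_if_simple_or_smooth)
    have "\<kappa> \<in> chamber \<eta> \<kappa>" using ss by (intro self_in_chamber simple_if_simple_or_smooth)
    then obtain a where "symmetry \<Lambda> (polytope_of \<eta> \<kappa>) a (B \<circ> A)" using rob by (auto simp: robust_symmetry_def)
    note BA = symmetry_linear_bij[OF this fp]
    have "inj (adjoint (B \<circ> A))" using BA by (intro inj_adjoint_if_surj)
    moreover have "adjoint (B \<circ> A) (\<eta> (\<rho> i)) = adjoint (B \<circ> A) (\<eta> ((\<sigma> \<circ> \<tau>) i))"
      using \<rho> 1 2 by (simp add: induces_permutation_def adj)
    ultimately show ?thesis using in\<eta> by (metis injD)
  qed
  then have "\<rho> = \<sigma> \<circ> \<tau>" by auto
  with \<rho> show ?thesis by simp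
qed

lemma equiv_facets_equivalent:
  fixes \<eta> :: "'i::finite \<Rightarrow> 'a::euclidean_space"
  assumes ss: "simple_or_smooth_polytope \<Lambda> \<eta> \<kappa>"
  shows "equiv UNIV {(i, j). facets_equivalent \<Lambda> \<eta> \<kappa> i j}"
proof (rule equivI)
  note iff = facets_equivalent_iff[OF ss]
  show "{(i, j). facets_equivalent \<Lambda> \<eta> \<kappa> i j} \<subseteq> UNIV \<times> UNIV" by simp
  show "refl {(i, j). facets_equivalent \<Lambda> \<eta> \<kappa> i j}"
  proof (rule refl_onI, clarify)
    fix i
    obtain A where "induces_permutation \<Lambda> \<eta> \<kappa> A id" using induces_permutation_id[OF ss] .
    then show "facets_equivalent \<Lambda> \<eta> \<kappa> i i" unfolding iff by (auto intro!: exI[of _ A] exI[of _ "id :: 'i \<Rightarrow> 'i"])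
  qed
  show "trans {(i, j). facets_equivalent \<Lambda> \<eta> \<kappa> i j}"
  proof (rule transI, clarify)
    fix i j k assume "facets_equivalent \<Lambda> \<eta> \<kappa> i j" "facets_equivalent \<Lambda> \<eta> \<kappa> j k"
    then obtain A \<tau> B \<sigma> where "induces_permutation \<Lambda> \<eta> \<kappa> A \<tau>" "\<tau> i = j" "induces_permutation \<Lambda> \<eta> \<kappa> B \<sigma>" "\<sigma> j = k"
      unfolding iff by blast
    then have "induces_permutation \<Lambda> \<eta> \<kappa> (B \<circ> A) (\<sigma> \<circ> \<tau>)" "(\<sigma> \<circ> \<tau>) i = k"
      using induces_permutation_comp[OF ss] by auto
    then show "facets_equivalent \<Lambda> \<eta> \<kappa> i k" unfolding iff by blast
  qed
  show "sym {(i, j). facets_equivalent \<Lambda> \<eta> \<kappa> i j}"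
  proof (rule symI, clarify)
    fix i j assume "facets_equivalent \<Lambda> \<eta> \<kappa> i j"
    then obtain A \<tau> where \<tau>: "induces_permutation \<Lambda> \<eta> \<kappa> A \<tau>" "\<tau> i = j" unfolding iff by blast
    \<comment> \<open>the inverse of a permutation of a finite set is one of its powers\<close>
    have pow: "\<exists>B. induces_permutation \<Lambda> \<eta> \<kappa> B (\<tau> ^^ n)" for n
    proof (induction n)
      case 0 then show ?case using induces_permutation_id[OF ss] by (metis funpow_0 id_def eq_id_iff)
    next
      case (Suc n) then show ?case using induces_permutation_comp[OF ss _ \<tau>(1)] by (metis funpow.simps(2))
    qed
    have "inj \<tau>" using \<tau> by (simp add: induces_permutation_def bij_def)
    then obtain n where n: "n > 0" "(\<tau> ^^ n) i = i" using funpow_inj_finite[of \<tau> i] by auto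
    then have "(\<tau> ^^ (n - 1)) j = i"
      using \<tau>(2) by (metis Suc_diff_1 comp_apply funpow_Suc_right)
    then show "facets_equivalent \<Lambda> \<eta> \<kappa> j i" unfolding iff using pow by blast
  qed
qed

lemma card_facet_class_gt_1:
  fixes \<eta> :: "'i::finite \<Rightarrow> 'a::euclidean_space"
  assumes ss: "simple_or_smooth_polytope \<Lambda> \<eta> \<kappa>" and I: "I \<in> facet_classes \<Lambda> \<eta> \<kappa>"
    and empty: "(\<Inter>i\<in>I. facet_of_index \<eta> \<kappa> i) = {}"
  shows "card I > 1"
proof (rule ccontr)
  assume "\<not> card I > 1"
  moreover have "I \<noteq> {}" using I in_quotient_imp_non_empty[OF equiv_facets_equivalent[OF ss]]
    by (simp add: facet_classes_def)
  ultimately have "card I = 1" using card_gt_0_iff[of I] by simp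
  then obtain i where "I = {i}" by (rule card_1_singletonE)
  moreover obtain v where "v \<in> facet_of_index \<eta> \<kappa> i"
    using facet_has_extreme_point[of UNIV UNIV \<eta> "($) \<kappa>" i] ss
    by (auto intro: simple_imp_facet_polytope simple_if_simple_or_smooth)
  ultimately show False using empty by auto
qed

section \<open>Simplex blocks\<close>

text \<open>
  The combinatorial form of being a product of simplices: the facets are labelled by blocks (the
  fibres of \<open>p\<close>), the conormals of each block satisfy a linear relation with positive coefficients
  \<open>\<mu>\<close>, and there are no linear relations among the conormals but the combinations of these.
\<close>

definition simplex_blocks :: "('i::finite \<Rightarrow> 'a::euclidean_space) \<Rightarrow> ('i \<Rightarrow> real) \<Rightarrow> ('i \<Rightarrow> 'b) \<Rightarrow> bool" where
  "simplex_blocks \<eta> \<mu> p \<longleftrightarrow>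
     (\<forall>i. \<mu> i > 0) \<and> (\<forall>i. (\<Sum>k | p k = p i. \<mu> k *\<^sub>R \<eta> k) = 0) \<and>
     (\<forall>\<beta>. (\<Sum>k\<in>UNIV. \<beta> k *\<^sub>R \<eta> k) = 0 \<longrightarrow> (\<forall>i j. p i = p j \<longrightarrow> \<beta> i * \<mu> j = \<beta> j * \<mu> i))"

lemma simplex_blocks_relation:
  assumes "simplex_blocks \<eta> \<mu> p" "(\<Sum>k\<in>UNIV. \<beta> k *\<^sub>R \<eta> k) = 0" "p i = p j"
  shows "\<beta> i * \<mu> j = \<beta> j * \<mu> i"
  using assms unfolding simplex_blocks_def by blast

lemma sum_by_blocks:
  fixes h :: "'i::finite \<Rightarrow> 'c::comm_monoid_add" and p :: "'i \<Rightarrow> 'b"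
  shows "(\<Sum>b\<in>range p. \<Sum>k | p k = b. h k) = (\<Sum>k\<in>UNIV. h k)"
  using sum.group[where S = UNIV and T = "range p" and g = p and h = h] by simp

lemma simplex_blocks_sum:
  fixes \<eta> :: "'i::finite \<Rightarrow> 'a::euclidean_space" and p :: "'i \<Rightarrow> 'b"
  assumes "simplex_blocks \<eta> \<mu> p"
  shows "(\<Sum>k\<in>UNIV. f (p k) *\<^sub>R \<mu> k *\<^sub>R \<eta> k) = 0"
proof -
  have "(\<Sum>k | p k = b. f (p k) *\<^sub>R \<mu> k *\<^sub>R \<eta> k) = 0" if "b \<in> range p" for b
  proof -
    obtain i where i: "b = p i" using \<open>b \<in> range p\<close> by blast
    have "(\<Sum>k | p k = b. f (p k) *\<^sub>R \<mu> k *\<^sub>R \<eta> k) = f b *\<^sub>R (\<Sum>k | p k = p i. \<mu> k *\<^sub>R \<eta> k)"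
      unfolding scaleR_sum_right i by (rule sum.cong) auto
    then show ?thesis using assms by (simp add: simplex_blocks_def)
  qed
  then show ?thesis using sum_by_blocks[where p = p and h = "\<lambda>k. f (p k) *\<^sub>R \<mu> k *\<^sub>R \<eta> k"] by simp
qed

subsection \<open>From facet classes to blocks\<close>

lemma linear_form_zero_on_ball:
  fixes \<kappa> :: "real ^ 'i::finite"
  assumes "e > 0" "\<And>\<kappa>'. \<kappa>' \<in> ball \<kappa> e \<Longrightarrow> (\<Sum>k\<in>UNIV. c k * \<kappa>' $ k) = d"
  shows "c i = 0"
proof -
  define \<kappa>' where "\<kappa>' = \<kappa> + (e / 2) *\<^sub>R axis i 1"
  have "\<kappa>' \<in> ball \<kappa> e" using assms(1) by (simp add: \<kappa>'_def dist_norm)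
  then have "(\<Sum>k\<in>UNIV. c k * \<kappa>' $ k) = (\<Sum>k\<in>UNIV. c k * \<kappa> $ k)" using assms by simp
  also have "(\<Sum>k\<in>UNIV. c k * \<kappa>' $ k) = (\<Sum>k\<in>UNIV. c k * \<kappa> $ k) + (\<Sum>k\<in>UNIV. if k = i then c k * (e / 2) else 0)"
    unfolding sum.distrib[symmetric] by (rule sum.cong) (auto simp: \<kappa>'_def axis_def algebra_simps)
  finally show ?thesis using assms(1) by simp
qed

text \<open>
  For a relation \<open>\<beta>\<close> and a robust symmetry that permutes the facets by \<open>\<tau>\<close>, pairing \<open>\<beta>\<close> with the
  translation part of the symmetry gives \<open>(\<Sum>k. (\<beta> k - \<beta> (\<tau> k)) * \<kappa>' $ k) = 0\<close> on the chamber, which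
  contains a ball around \<open>\<kappa>\<close>; so \<open>\<beta>\<close> is invariant under \<open>\<tau>\<close>.
\<close>

lemma relation_constant_on_classes:
  fixes \<eta> :: "'i::finite \<Rightarrow> 'a::euclidean_space"
  assumes ss: "simple_or_smooth_polytope \<Lambda> \<eta> \<kappa>" and rel: "(\<Sum>k\<in>UNIV. \<beta> k *\<^sub>R \<eta> k) = 0"
    and eq: "facets_equivalent \<Lambda> \<eta> \<kappa> i j"
  shows "\<beta> i = \<beta> j"
proof -
  obtain A \<tau> where \<tau>: "induces_permutation \<Lambda> \<eta> \<kappa> A \<tau>" "\<tau> i = j" using eq facets_equivalent_iff[OF ss] by blast
  have bij: "bij \<tau>" using \<tau> by (simp add: induces_permutation_def)
  have simp: "simple_polytope UNIV UNIV \<eta> (($) \<kappa>)" using ss by (rule simple_if_simple_or_smooth)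
  obtain e where e: "e > 0" "ball \<kappa> e \<subseteq> chamber \<eta> \<kappa>" using chamber_ball[OF simp] .
  have *: "(\<Sum>k\<in>UNIV. (\<beta> k - \<beta> (\<tau> k)) * \<kappa>' $ k) = 0" if \<kappa>': "\<kappa>' \<in> chamber \<eta> \<kappa>" for \<kappa>'
  proof -
    obtain a where a: "symmetry \<Lambda> (polytope_of \<eta> \<kappa>') a A"
      using \<tau> \<kappa>' by (auto simp: induces_permutation_def robust_symmetry_def)
    have 1: "\<eta> (\<tau> k) \<bullet> a 0 = \<kappa>' $ \<tau> k - \<kappa>' $ k" for k
    proof -
      have "\<eta> (\<tau> k) \<bullet> a 0 - \<kappa>' $ \<tau> k = \<eta> k \<bullet> 0 - \<kappa>' $ k"
        using \<tau>(1) \<kappa>' a unfolding induces_permutation_def by blast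
      then show ?thesis by simp
    qed
    have "(\<Sum>k\<in>UNIV. \<beta> (\<tau> k) * (\<eta> (\<tau> k) \<bullet> a 0)) = (\<Sum>k\<in>UNIV. \<beta> k * (\<eta> k \<bullet> a 0))"
      using bij by (rule sum.reindex_bij_betw)
    also have "\<dots> = (\<Sum>k\<in>UNIV. \<beta> k *\<^sub>R \<eta> k) \<bullet> a 0" by (simp add: inner_sum_left)
    finally have "(\<Sum>k\<in>UNIV. \<beta> (\<tau> k) * \<kappa>' $ \<tau> k) - (\<Sum>k\<in>UNIV. \<beta> (\<tau> k) * \<kappa>' $ k) = 0"
      using rel by (simp add: 1 right_diff_distrib sum_subtractf)
    moreover have "(\<Sum>k\<in>UNIV. \<beta> (\<tau> k) * \<kappa>' $ \<tau> k) = (\<Sum>k\<in>UNIV. \<beta> k * \<kappa>' $ k)"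
      using bij by (rule sum.reindex_bij_betw)
    ultimately show ?thesis by (simp add: left_diff_distrib sum_subtractf)
  qed
  have "\<beta> i - \<beta> (\<tau> i) = 0"
    using linear_form_zero_on_ball[OF e(1), where c = "\<lambda>k. \<beta> k - \<beta> (\<tau> k)" and d = 0] * e(2) by blast
  then show ?thesis using \<tau>(2) by simp
qed

text \<open>The equivalence class of the facet \<open>i\<close>; as a function of \<open>i\<close> it labels the facets by their classes.\<close>

definition facet_class :: "'a::euclidean_space set option \<Rightarrow> ('i::finite \<Rightarrow> 'a) \<Rightarrow> real ^ 'i \<Rightarrow> 'i \<Rightarrow> 'i set" where
  "facet_class \<Lambda> \<eta> \<kappa> i = {j. facets_equivalent \<Lambda> \<eta> \<kappa> i j}"

lemma facet_classes_eq: "facet_classes \<Lambda> \<eta> \<kappa> = range (facet_class \<Lambda> \<eta> \<kappa>)"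
  by (auto simp: facet_classes_def facet_class_def quotient_def)

lemma facet_class_eq_iff:
  assumes "simple_or_smooth_polytope \<Lambda> \<eta> \<kappa>"
  shows "facet_class \<Lambda> \<eta> \<kappa> i = facet_class \<Lambda> \<eta> \<kappa> j \<longleftrightarrow> facets_equivalent \<Lambda> \<eta> \<kappa> i j"
proof -
  have "facet_class \<Lambda> \<eta> \<kappa> k = {(i, j). facets_equivalent \<Lambda> \<eta> \<kappa> i j} `` {k}" for k
    by (auto simp: facet_class_def)
  then show ?thesis using eq_equiv_class_iff[OF equiv_facets_equivalent[OF assms], of i j] by simp
qed

lemma facet_class_fibre:
  assumes "simple_or_smooth_polytope \<Lambda> \<eta> \<kappa>"
  shows "{k. facet_class \<Lambda> \<eta> \<kappa> k = facet_class \<Lambda> \<eta> \<kappa> i} = facet_class \<Lambda> \<eta> \<kappa> i"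
  using facet_class_eq_iff[OF assms, of i] by (auto simp: facet_class_def)

text \<open>
  It suffices that the indicator of each class is a relation, because every relation is constant on
  classes.
\<close>

lemma class_blocks:
  fixes \<eta> :: "'i::finite \<Rightarrow> 'a::euclidean_space"
  assumes ss: "simple_or_smooth_polytope \<Lambda> \<eta> \<kappa>"
    and rel: "\<And>i. (\<Sum>k\<in>facet_class \<Lambda> \<eta> \<kappa> i. \<eta> k) = 0"
  shows "simplex_blocks \<eta> (\<lambda>_. 1) (facet_class \<Lambda> \<eta> \<kappa>)"
  unfolding simplex_blocks_def
  using rel relation_constant_on_classes[OF ss] facet_class_eq_iff[OF ss] facet_class_fibre[OF ss] by auto

text \<open>
  Writing the sum of the conormals of a class as an inessential combination gives a relation with the
  same class sums as the indicator of the class; being constant on classes, it is that indicator.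
\<close>

lemma blocks_if_all_inessential:
  fixes \<eta> :: "'i::finite \<Rightarrow> 'a::euclidean_space"
  assumes ss: "simple_or_smooth_polytope \<Lambda> \<eta> \<kappa>" and all: "\<And>H. inessential \<Lambda> \<eta> \<kappa> H"
  shows "simplex_blocks \<eta> (\<lambda>_. 1) (facet_class \<Lambda> \<eta> \<kappa>)"
proof (rule class_blocks[OF ss])
  fix i
  let ?I = "facet_class \<Lambda> \<eta> \<kappa> i"
  have iI: "i \<in> ?I" using facet_class_fibre[OF ss, of i] by blast
  obtain \<beta> where \<beta>: "(\<Sum>k\<in>?I. \<eta> k) = (\<Sum>k\<in>UNIV. \<beta> k *\<^sub>R \<eta> k)" "\<And>j. (\<Sum>k\<in>facet_class \<Lambda> \<eta> \<kappa> j. \<beta> k) = 0"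
    using all[of "\<Sum>k\<in>?I. \<eta> k"] by (auto simp: inessential_def facet_classes_eq)
  define \<gamma> where "\<gamma> k = of_bool (k \<in> ?I) - \<beta> k" for k
  have "(\<Sum>k\<in>UNIV. \<gamma> k *\<^sub>R \<eta> k) = (\<Sum>k\<in>UNIV. if k \<in> ?I then \<eta> k else 0) - (\<Sum>k\<in>UNIV. \<beta> k *\<^sub>R \<eta> k)"
    unfolding sum_subtractf[symmetric] by (rule sum.cong) (auto simp: \<gamma>_def algebra_simps)
  also have "\<dots> = 0" using \<beta>(1) by (simp add: sum.If_cases)
  finally have rel: "(\<Sum>k\<in>UNIV. \<gamma> k *\<^sub>R \<eta> k) = 0" .
  have sum_\<gamma>: "(\<Sum>k\<in>facet_class \<Lambda> \<eta> \<kappa> j. \<gamma> k) = real (card (facet_class \<Lambda> \<eta> \<kappa> j)) * of_bool (j \<in> ?I)" for j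
  proof -
    have "k \<in> ?I \<longleftrightarrow> j \<in> ?I" if "k \<in> facet_class \<Lambda> \<eta> \<kappa> j" for k
      using that facet_class_fibre[OF ss, of i] facet_class_fibre[OF ss, of j] by blast
    then have "(\<Sum>k\<in>facet_class \<Lambda> \<eta> \<kappa> j. of_bool (k \<in> ?I)) = (\<Sum>k\<in>facet_class \<Lambda> \<eta> \<kappa> j. of_bool (j \<in> ?I) :: real)"
      by (intro sum.cong) auto
    then show ?thesis by (simp add: \<gamma>_def sum_subtractf \<beta>(2))
  qed
  have \<gamma>: "\<gamma> j = of_bool (j \<in> ?I)" for j
  proof -
    have "\<gamma> k = \<gamma> j" if "k \<in> facet_class \<Lambda> \<eta> \<kappa> j" for k
      using relation_constant_on_classes[OF ss rel, of j k] that by (simp add: facet_class_def)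
    then have "(\<Sum>k\<in>facet_class \<Lambda> \<eta> \<kappa> j. \<gamma> k) = real (card (facet_class \<Lambda> \<eta> \<kappa> j)) * \<gamma> j" by simp
    moreover have "j \<in> facet_class \<Lambda> \<eta> \<kappa> j" using facet_class_fibre[OF ss, of j] by blast
    then have "card (facet_class \<Lambda> \<eta> \<kappa> j) \<noteq> 0" by auto
    ultimately show ?thesis using sum_\<gamma>[of j] by simp
  qed
  have "(\<Sum>k\<in>?I. \<eta> k) = (\<Sum>k\<in>UNIV. \<gamma> k *\<^sub>R \<eta> k)"
    by (simp add: \<gamma> of_bool_def if_distrib[of "\<lambda>c. c *\<^sub>R _"] sum.If_cases cong: if_cong)
  then show "(\<Sum>k\<in>?I. \<eta> k) = 0" using rel by simp
qed

text \<open>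
  Here a vertex avoids some facet \<open>i\<close> of the class. Expanding \<open>\<eta> i\<close> in the conormals active at the
  vertex gives a relation that is \<open>1\<close> on the class of \<open>i\<close> and \<open>0\<close> on all other classes, since each
  class has a facet that the vertex avoids.
\<close>

lemma blocks_if_class_intersections_empty:
  fixes \<eta> :: "'i::finite \<Rightarrow> 'a::euclidean_space"
  assumes ss: "simple_or_smooth_polytope \<Lambda> \<eta> \<kappa>"
    and empty: "\<And>I. I \<in> facet_classes \<Lambda> \<eta> \<kappa> \<Longrightarrow> (\<Inter>i\<in>I. facet_of_index \<eta> \<kappa> i) = {}"
  shows "simplex_blocks \<eta> (\<lambda>_. 1) (facet_class \<Lambda> \<eta> \<kappa>)"
proof (rule class_blocks[OF ss])
  fix i0
  have fp: "facet_polytope UNIV UNIV \<eta> (($) \<kappa>)" using ss by (rule simple_or_smooth_facet_polytope)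
  obtain v where v: "v extreme_point_of polytope_of \<eta> \<kappa>" using halfspace_inter_has_extreme_point[OF fp] .
  define J where "J = {i. v \<in> facet_of_index \<eta> \<kappa> i}"
  have spJ: "span (\<eta> ` J) = UNIV" using active_span_at_extreme_point[OF subspace_UNIV _ _ v] by (simp add: J_def)
  \<comment> \<open>\<open>v\<close> avoids some facet of each class\<close>
  have off: "\<exists>k\<in>facet_class \<Lambda> \<eta> \<kappa> i. k \<notin> J" for i
    using empty[of "facet_class \<Lambda> \<eta> \<kappa> i"] by (auto simp: J_def facet_classes_eq)
  obtain i where i: "i \<in> facet_class \<Lambda> \<eta> \<kappa> i0" "i \<notin> J" using off by blast
  let ?I = "facet_class \<Lambda> \<eta> \<kappa> i"
  have I: "facet_class \<Lambda> \<eta> \<kappa> i0 = ?I" using i(1) facet_class_fibre[OF ss, of i0] by blast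
  have iI: "i \<in> ?I" using i(1) I by simp
  have "\<eta> i \<in> span (\<eta> ` J)" using spJ by simp
  then obtain r where r: "\<eta> i = (\<Sum>k\<in>J. r k *\<^sub>R \<eta> k)" using span_imageE[OF finite] by blast
  define \<beta> where "\<beta> k = of_bool (k = i) - (if k \<in> J then r k else 0)" for k
  have "(\<Sum>k\<in>UNIV. \<beta> k *\<^sub>R \<eta> k) = (\<Sum>k\<in>UNIV. if k = i then \<eta> k else 0) - (\<Sum>k\<in>UNIV. if k \<in> J then r k *\<^sub>R \<eta> k else 0)"
    unfolding sum_subtractf[symmetric] by (rule sum.cong) (auto simp: \<beta>_def algebra_simps)
  also have "\<dots> = 0" using r by (simp add: sum.If_cases)
  finally have rel: "(\<Sum>k\<in>UNIV. \<beta> k *\<^sub>R \<eta> k) = 0" .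
  have const: "\<beta> k = \<beta> l" if "k \<in> facet_class \<Lambda> \<eta> \<kappa> l" for k l
    using relation_constant_on_classes[OF ss rel, of l k] that by (simp add: facet_class_def)
  have \<beta>: "\<beta> k = of_bool (k \<in> ?I)" for k
  proof (cases "k \<in> ?I")
    case True
    then show ?thesis using const[OF True] i(2) by (simp add: \<beta>_def)
  next
    case False
    obtain l where l: "l \<in> facet_class \<Lambda> \<eta> \<kappa> k" "l \<notin> J" using off by blast
    then have "l \<noteq> i" using False facet_class_fibre[OF ss, of k] facet_class_fibre[OF ss, of i] by blast
    then show ?thesis using const[OF l(1)] l(2) False by (simp add: \<beta>_def)
  qed
  have "(\<Sum>k\<in>?I. \<eta> k) = (\<Sum>k\<in>UNIV. \<beta> k *\<^sub>R \<eta> k)"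
    by (simp add: \<beta> of_bool_def if_distrib[of "\<lambda>c. c *\<^sub>R _"] sum.If_cases cong: if_cong)
  then show "(\<Sum>k\<in>facet_class \<Lambda> \<eta> \<kappa> i0. \<eta> k) = 0" using rel I by simp
qed

subsection \<open>Symmetries of a polytope with simplex blocks\<close>

text \<open>Two conormals of one block, suitably scaled, are exchanged by a robust symmetry.\<close>

lemma block_transposition:
  fixes \<eta> :: "'i::finite \<Rightarrow> 'a::euclidean_space"
  assumes bl: "simplex_blocks \<eta> \<mu> p" and ij: "p i = p j" and sp: "span (range \<eta>) = UNIV"
  defines "\<sigma> \<equiv> Transposition.transpose i j"
  obtains T where "linear T" "\<And>k. \<mu> k *\<^sub>R T (\<eta> k) = \<mu> (\<sigma> k) *\<^sub>R \<eta> (\<sigma> k)" "\<And>h. T (T h) = h"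
    "\<And>\<kappa>. \<exists>a b. (\<forall>x. a x = adjoint T x + b) \<and> a ` polytope_of \<eta> \<kappa> = polytope_of \<eta> \<kappa>"
proof -
  have pos: "\<mu> k > 0" for k using bl by (simp add: simplex_blocks_def)
  have bij: "bij \<sigma>" and inv: "\<sigma> (\<sigma> k) = k" for k by (simp_all add: \<sigma>_def)
  have invariant: "\<beta> (\<sigma> k) = \<beta> k" if "(\<Sum>k\<in>UNIV. \<beta> k *\<^sub>R (\<mu> k *\<^sub>R \<eta> k)) = 0" for \<beta> k
  proof -
    have "(\<Sum>k\<in>UNIV. (\<beta> k * \<mu> k) *\<^sub>R \<eta> k) = 0" using that by simp
    from simplex_blocks_relation[OF bl this ij]
    have "(\<beta> i * \<mu> i) * \<mu> j = (\<beta> j * \<mu> j) * \<mu> i" .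
    then have "\<beta> i = \<beta> j" using pos[of i] pos[of j] by simp
    then show ?thesis by (simp add: \<sigma>_def Transposition.transpose_def)
  qed
  have reindex: "(\<Sum>k\<in>UNIV. h (\<sigma> k)) = (\<Sum>k\<in>UNIV. h k)" for h :: "'i \<Rightarrow> 'c::comm_monoid_add"
    using bij by (rule sum.reindex_bij_betw)
  obtain T where T: "linear T" "\<And>k. T (\<mu> k *\<^sub>R \<eta> k) = \<mu> (\<sigma> k) *\<^sub>R \<eta> (\<sigma> k)"
  proof (rule linear_extension_of_family[of UNIV "\<lambda>k. \<mu> k *\<^sub>R \<eta> k" "\<lambda>k. \<mu> (\<sigma> k) *\<^sub>R \<eta> (\<sigma> k)"])
    fix \<beta> assume rel: "(\<Sum>k\<in>UNIV. \<beta> k *\<^sub>R (\<mu> k *\<^sub>R \<eta> k)) = 0"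
    have "(\<Sum>k\<in>UNIV. \<beta> k *\<^sub>R (\<mu> (\<sigma> k) *\<^sub>R \<eta> (\<sigma> k))) = (\<Sum>k\<in>UNIV. \<beta> (\<sigma> k) *\<^sub>R (\<mu> (\<sigma> k) *\<^sub>R \<eta> (\<sigma> k)))"
      using invariant[OF rel] by simp
    also have "\<dots> = 0" using rel reindex[of "\<lambda>k. \<beta> k *\<^sub>R (\<mu> k *\<^sub>R \<eta> k)"] by simp
    finally show "(\<Sum>k\<in>UNIV. \<beta> k *\<^sub>R (\<mu> (\<sigma> k) *\<^sub>R \<eta> (\<sigma> k))) = 0" .
  qed auto
  have T2: "\<mu> k *\<^sub>R T (\<eta> k) = \<mu> (\<sigma> k) *\<^sub>R \<eta> (\<sigma> k)" for k
    using T(2)[of k] T(1) by (simp add: linear_scale)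
  have TT: "T (T h) = h" for h
  proof -
    have "T (T (\<eta> k)) = \<eta> k" for k
    proof -
      have "\<mu> k *\<^sub>R T (T (\<eta> k)) = T (\<mu> k *\<^sub>R T (\<eta> k))" using T(1) by (simp add: linear_scale)
      also have "\<dots> = T (\<mu> (\<sigma> k) *\<^sub>R \<eta> (\<sigma> k))" by (simp only: T2)
      also have "\<dots> = \<mu> k *\<^sub>R \<eta> k" using T(2)[of "\<sigma> k"] by (simp only: inv)
      finally show ?thesis using pos[of k] by simp
    qed
    then show ?thesis using linear_eq_on_span[of "T \<circ> T" id "range \<eta>" h] T(1) sp
      linear_compose[OF T(1) T(1)] by (auto intro: linear_ident simp: comp_def id_def)
  qed
  have "\<exists>a b. (\<forall>x. a x = adjoint T x + b) \<and> a ` polytope_of \<eta> \<kappa> = polytope_of \<eta> \<kappa>" for \<kappa>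
  proof -
    obtain b where b: "\<And>k. k \<in> UNIV \<Longrightarrow> (\<mu> k *\<^sub>R \<eta> k) \<bullet> b = \<mu> k * \<kappa> $ k - \<mu> (\<sigma> k) * \<kappa> $ \<sigma> k"
    proof (rule inner_system_solvable[of UNIV "\<lambda>k. \<mu> k *\<^sub>R \<eta> k" "\<lambda>k. \<mu> k * \<kappa> $ k - \<mu> (\<sigma> k) * \<kappa> $ \<sigma> k"])
      fix \<beta> assume rel: "(\<Sum>k\<in>UNIV. \<beta> k *\<^sub>R (\<mu> k *\<^sub>R \<eta> k)) = 0"
      have "(\<Sum>k\<in>UNIV. \<beta> k * (\<mu> (\<sigma> k) * \<kappa> $ \<sigma> k)) = (\<Sum>k\<in>UNIV. \<beta> (\<sigma> k) * (\<mu> (\<sigma> k) * \<kappa> $ \<sigma> k))"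
        using invariant[OF rel] by simp
      also have "\<dots> = (\<Sum>k\<in>UNIV. \<beta> k * (\<mu> k * \<kappa> $ k))" using reindex[of "\<lambda>k. \<beta> k * (\<mu> k * \<kappa> $ k)"] by simp
      finally show "(\<Sum>k\<in>UNIV. \<beta> k * (\<mu> k * \<kappa> $ k - \<mu> (\<sigma> k) * \<kappa> $ \<sigma> k)) = 0"
        by (simp add: right_diff_distrib sum_subtractf)
    qed auto
    define a where "a x = adjoint T x + b" for x
    have slack: "\<mu> k * (\<eta> k \<bullet> a x - \<kappa> $ k) = \<mu> (\<sigma> k) * (\<eta> (\<sigma> k) \<bullet> x - \<kappa> $ \<sigma> k)" for k x
    proof -
      have "\<mu> k * (\<eta> k \<bullet> adjoint T x) = (\<mu> k *\<^sub>R T (\<eta> k)) \<bullet> x" using T(1) by (simp add: adjoint_works)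
      also have "\<dots> = \<mu> (\<sigma> k) * (\<eta> (\<sigma> k) \<bullet> x)" by (simp add: T2)
      finally show ?thesis using b[of k] by (simp add: a_def inner_add_right algebra_simps)
    qed
    have leq: "\<eta> k \<bullet> a x \<le> \<kappa> $ k \<longleftrightarrow> \<eta> (\<sigma> k) \<bullet> x \<le> \<kappa> $ \<sigma> k" for k x
    proof -
      have "\<eta> k \<bullet> a x - \<kappa> $ k \<le> 0 \<longleftrightarrow> \<eta> (\<sigma> k) \<bullet> x - \<kappa> $ \<sigma> k \<le> 0"
        using slack[of k x] pos[of k] pos[of "\<sigma> k"] by (metis mult_le_0_iff not_less order_less_imp_le)
      then show ?thesis by simp
    qed
    have mem: "a x \<in> polytope_of \<eta> \<kappa> \<longleftrightarrow> x \<in> polytope_of \<eta> \<kappa>" for x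
      unfolding mem_halfspace_inter leq using inv by (metis UNIV_I)
    have "adjoint T (adjoint T x) = x" for x
    proof -
      have "adjoint T \<circ> adjoint T = adjoint (T \<circ> T)"
        by (rule adjoint_unique[symmetric]) (simp add: T(1) adjoint_works)
      also have "T \<circ> T = id" using TT by auto
      also have "adjoint id = (id :: 'a \<Rightarrow> 'a)" by (rule adjoint_unique) simp
      finally show ?thesis by (metis comp_apply id_apply)
    qed
    then have onto: "a (adjoint T (y - b)) = y" for y by (simp add: a_def)
    have "a ` polytope_of \<eta> \<kappa> = polytope_of \<eta> \<kappa>"
    proof (intro equalityI subsetI)
      fix y assume "y \<in> polytope_of \<eta> \<kappa>"
      then have "adjoint T (y - b) \<in> polytope_of \<eta> \<kappa>" using mem onto by metis
      then show "y \<in> a ` polytope_of \<eta> \<kappa>" using onto by (rule image_eqI[rotated, OF _ sym])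
    qed (use mem in auto)
    then show ?thesis using a_def by blast
  qed
  with T(1) T2 TT show thesis by (rule that)
qed

text \<open>The lattice of a smooth polytope is generated by its conormals.\<close>

lemma smooth_lattice:
  fixes \<eta> :: "'i::finite \<Rightarrow> 'a::euclidean_space"
  assumes sm: "smooth_polytope UNIV L UNIV \<eta> (($) \<kappa>)"
  shows "L = range (\<lambda>n :: 'i \<Rightarrow> int. \<Sum>k\<in>UNIV. of_int (n k) *\<^sub>R \<eta> k)"
proof -
  have fp: "facet_polytope UNIV UNIV \<eta> (($) \<kappa>)" using sm by (simp add: smooth_polytope_def simple_imp_facet_polytope)
  obtain B where B: "lattice_basis L B" using sm by (auto simp: smooth_polytope_def integer_lattice_def)
  have \<eta>L: "\<eta> k \<in> L" for k using sm by (simp add: smooth_polytope_def primitive_vector_def)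
  have "(\<Sum>k\<in>UNIV. of_int (n k) *\<^sub>R \<eta> k) \<in> L" for n :: "'i \<Rightarrow> int"
    using int_span_sum[of UNIV \<eta> B n] \<eta>L B by (simp add: lattice_basis_def)
  moreover have "h \<in> range (\<lambda>n :: 'i \<Rightarrow> int. \<Sum>k\<in>UNIV. of_int (n k) *\<^sub>R \<eta> k)" if "h \<in> L" for h
  proof -
    obtain v where v: "v extreme_point_of polytope_of \<eta> \<kappa>" using halfspace_inter_has_extreme_point[OF fp] .
    define J where "J = {i. v \<in> facet_of_index \<eta> \<kappa> i}"
    have "lattice_basis L (\<eta> ` J)" using sm v by (simp add: smooth_polytope_def J_def)
    then have "h \<in> int_span (\<eta> ` J)" using that by (simp add: lattice_basis_def)
    moreover have "inj_on \<eta> J" using conormals_inj[OF fp] by (rule inj_on_subset) simp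
    ultimately obtain n :: "'i \<Rightarrow> int" where n: "h = (\<Sum>k\<in>J. of_int (n k) *\<^sub>R \<eta> k)"
      by (auto simp: int_span_image)
    have "(\<Sum>k\<in>J. of_int (n k) *\<^sub>R \<eta> k) = (\<Sum>k\<in>UNIV. of_int (if k \<in> J then n k else 0) *\<^sub>R \<eta> k)"
      by (intro sum.mono_neutral_cong_left) auto
    then show ?thesis using n rangeI[of "(\<lambda>n :: 'i \<Rightarrow> int. \<Sum>k\<in>UNIV. of_int (n k) *\<^sub>R \<eta> k)" "\<lambda>k. if k \<in> J then n k else 0"] by simp
  qed
  ultimately show ?thesis by auto
qed

text \<open>
  Expanding \<open>\<eta> i\<close> in the lattice basis of a vertex off the facet \<open>i\<close> shows that \<open>\<mu> j\<close> is an integer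
  multiple of \<open>\<mu> i\<close>. By symmetry the two are equal.
\<close>

lemma smooth_block_coefficients_le:
  fixes \<eta> :: "'i::finite \<Rightarrow> 'a::euclidean_space"
  assumes sm: "smooth_polytope UNIV L UNIV \<eta> (($) \<kappa>)" and bl: "simplex_blocks \<eta> \<mu> p" and ij: "p i = p j"
  shows "\<mu> i \<le> \<mu> j"
proof (cases "i = j")
  case False
  have fp: "facet_polytope UNIV UNIV \<eta> (($) \<kappa>)" using sm by (simp add: smooth_polytope_def simple_imp_facet_polytope)
  have pos: "\<mu> k > 0" for k using bl by (simp add: simplex_blocks_def)
  obtain v where v: "v extreme_point_of polytope_of \<eta> \<kappa>" "v \<notin> facet_of_index \<eta> \<kappa> i"
    using extreme_point_off_facet[OF fp, of i] by auto
  define J where "J = {i. v \<in> facet_of_index \<eta> \<kappa> i}"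
  have "i \<notin> J" using v by (simp add: J_def)
  have "lattice_basis L (\<eta> ` J)" using sm v by (simp add: smooth_polytope_def J_def)
  then have "\<eta> i \<in> int_span (\<eta> ` J)"
    using sm by (simp add: lattice_basis_def smooth_polytope_def primitive_vector_def)
  moreover have "inj_on \<eta> J" using conormals_inj[OF fp] by (rule inj_on_subset) simp
  ultimately obtain n :: "'i \<Rightarrow> int" where n: "\<eta> i = (\<Sum>k\<in>J. of_int (n k) *\<^sub>R \<eta> k)"
    by (auto simp: int_span_image)
  define \<beta> :: "'i \<Rightarrow> real" where "\<beta> k = of_bool (k = i) - (if k \<in> J then of_int (n k) else 0)" for k
  have "(\<Sum>k\<in>UNIV. \<beta> k *\<^sub>R \<eta> k) = (\<Sum>k\<in>UNIV. if k = i then \<eta> k else 0) - (\<Sum>k\<in>UNIV. if k \<in> J then of_int (n k) *\<^sub>R \<eta> k else 0)"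
    unfolding sum_subtractf[symmetric] by (rule sum.cong) (auto simp: \<beta>_def algebra_simps)
  also have "\<dots> = 0" using n by (simp add: sum.If_cases)
  finally have "\<beta> i * \<mu> j = \<beta> j * \<mu> i" using simplex_blocks_relation[OF bl _ ij] by blast
  then have "\<mu> j = of_int (if j \<in> J then - n j else 0) * \<mu> i"
    using False \<open>i \<notin> J\<close> by (simp add: \<beta>_def split: if_splits)
  moreover define m where "m = (if j \<in> J then - n j else 0)"
  ultimately have \<mu>j: "\<mu> j = of_int m * \<mu> i" by simp
  then have "m > 0" using pos[of i] pos[of j] by (simp add: zero_less_mult_iff)
  then have "1 \<le> real_of_int m" by simp
  then show ?thesis using \<mu>j pos[of i] by simp
qed simp

text \<open>
  The normalization of the conormals makes the coefficients constant on blocks: in the simple case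
  because the adjoint of the transposition of \<open>i\<close> and \<open>j\<close> takes \<open>\<eta> i\<close> to a multiple of \<open>\<eta> j\<close>, which
  has to be a conormal.
\<close>

lemma blocks_normalized:
  fixes \<eta> :: "'i::finite \<Rightarrow> 'a::euclidean_space"
  assumes ss: "simple_or_smooth_polytope \<Lambda> \<eta> \<kappa>" and bl: "simplex_blocks \<eta> \<mu> p"
  shows "simplex_blocks \<eta> (\<lambda>_. 1) p"
proof -
  have fp: "facet_polytope UNIV UNIV \<eta> (($) \<kappa>)" using ss by (rule simple_or_smooth_facet_polytope)
  have pos: "\<mu> k > 0" for k using bl by (simp add: simplex_blocks_def)
  have eq: "\<mu> i = \<mu> j" if ij: "p i = p j" for i j
  proof (cases \<Lambda>)
    case None
    obtain T where T: "linear T" "\<And>k. \<mu> k *\<^sub>R T (\<eta> k) = \<mu> (Transposition.transpose i j k) *\<^sub>R \<eta> (Transposition.transpose i j k)"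
      "\<And>\<kappa>. \<exists>a b. (\<forall>x. a x = adjoint T x + b) \<and> a ` polytope_of \<eta> \<kappa> = polytope_of \<eta> \<kappa>"
      using block_transposition[OF bl ij conormals_span[OF fp]] by metis
    have "robust_symmetry None \<eta> \<kappa> (adjoint T)"
      using T(1,3) unfolding robust_symmetry_def symmetry_def option.case by (meson adjoint_linear)
    moreover have "normalized_conormals None \<eta> \<kappa>" using ss None by (simp add: simple_or_smooth_polytope_def)
    ultimately obtain l where l: "T (\<eta> i) = \<eta> l"
      using T(1) unfolding normalized_conormals_def by (metis adjoint_adjoint)
    have e: "\<mu> i *\<^sub>R \<eta> l = \<mu> j *\<^sub>R \<eta> j" using T(2)[of i] l by simp
    then have "(1 / \<mu> i) *\<^sub>R (\<mu> i *\<^sub>R \<eta> l) = (1 / \<mu> i) *\<^sub>R (\<mu> j *\<^sub>R \<eta> j)" by simp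
    then have "\<eta> l = (\<mu> j / \<mu> i) *\<^sub>R \<eta> j" using pos[of i] by simp
    then have "j = l" using pos[of i] pos[of j] by (intro conormal_direction_unique[OF fp, of j l "\<mu> j / \<mu> i"]) auto
    then have "(\<mu> i - \<mu> j) *\<^sub>R \<eta> j = 0" using e \<open>j = l\<close> by (simp add: scaleR_diff_left)
    then show ?thesis using fp by (auto simp: facet_polytope_def)
  next
    case (Some L)
    then have sm: "smooth_polytope UNIV L UNIV \<eta> (($) \<kappa>)" using ss by (simp add: simple_or_smooth_polytope_def)
    then show ?thesis using smooth_block_coefficients_le[OF sm bl ij] smooth_block_coefficients_le[OF sm bl ij[symmetric]] by simp
  qed
  show ?thesis unfolding simplex_blocks_def
  proof (intro conjI allI impI)
    fix i
    have "(\<Sum>k | p k = p i. \<mu> k *\<^sub>R \<eta> k) = \<mu> i *\<^sub>R (\<Sum>k | p k = p i. \<eta> k)"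
      unfolding scaleR_sum_right
    proof (rule sum.cong)
      fix k assume "k \<in> {k. p k = p i}"
      then have "\<mu> k = \<mu> i" by (intro eq) simp
      then show "\<mu> k *\<^sub>R \<eta> k = \<mu> i *\<^sub>R \<eta> k" by simp
    qed simp
    moreover have "(\<Sum>k | p k = p i. \<mu> k *\<^sub>R \<eta> k) = 0" using bl unfolding simplex_blocks_def by blast
    ultimately have "(\<Sum>k | p k = p i. \<eta> k) = 0" using pos[of i] by auto
    then show "(\<Sum>k | p k = p i. 1 *\<^sub>R \<eta> k) = 0" by simp
  next
    fix \<beta> i j assume "(\<Sum>k\<in>UNIV. \<beta> k *\<^sub>R \<eta> k) = 0" "p i = p j"
    from simplex_blocks_relation[OF bl this] eq[OF this(2)] pos[of j] show "\<beta> i * 1 = \<beta> j * 1" by simp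
  qed simp
qed

lemma facets_equivalent_if_same_block:
  fixes \<eta> :: "'i::finite \<Rightarrow> 'a::euclidean_space"
  assumes ss: "simple_or_smooth_polytope \<Lambda> \<eta> \<kappa>" and bl: "simplex_blocks \<eta> (\<lambda>_. 1) p" and ij: "p i = p j"
  shows "facets_equivalent \<Lambda> \<eta> \<kappa> i j"
proof -
  have fp: "facet_polytope UNIV UNIV \<eta> (($) \<kappa>)" using ss by (rule simple_or_smooth_facet_polytope)
  define \<sigma> where "\<sigma> = Transposition.transpose i j"
  obtain T where T: "linear T" "\<And>k. 1 *\<^sub>R T (\<eta> k) = 1 *\<^sub>R \<eta> (\<sigma> k)" "\<And>h. T (T h) = h"
      "\<And>\<kappa>. \<exists>a b. (\<forall>x. a x = adjoint T x + b) \<and> a ` polytope_of \<eta> \<kappa> = polytope_of \<eta> \<kappa>"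
    using block_transposition[OF bl ij conormals_span[OF fp]] unfolding \<sigma>_def by metis
  have T\<eta>: "T (\<eta> k) = \<eta> (\<sigma> k)" for k using T(2)[of k] by simp
  have adj: "adjoint (adjoint T) = T" using T(1) by (rule adjoint_adjoint)
  have lat: "bij_betw T L L" if \<Lambda>: "\<Lambda> = Some L" for L
  proof -
    have sm: "smooth_polytope UNIV L UNIV \<eta> (($) \<kappa>)" using ss \<Lambda> by (simp add: simple_or_smooth_polytope_def)
    have TL: "T h \<in> L" if "h \<in> L" for h
    proof -
      obtain n :: "'i \<Rightarrow> int" where n: "h = (\<Sum>k\<in>UNIV. of_int (n k) *\<^sub>R \<eta> k)"
        using \<open>h \<in> L\<close> smooth_lattice[OF sm] by blast
      have "T h = (\<Sum>k\<in>UNIV. of_int (n k) *\<^sub>R \<eta> (\<sigma> k))"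
        using T(1) by (simp add: n linear_sum linear_scale T\<eta>)
      also have "\<dots> = (\<Sum>k\<in>UNIV. of_int (n (\<sigma> (\<sigma> k))) *\<^sub>R \<eta> (\<sigma> k))" by (simp add: \<sigma>_def)
      also have "\<dots> = (\<Sum>k\<in>UNIV. of_int (n (\<sigma> k)) *\<^sub>R \<eta> k)"
        by (rule sum.reindex_bij_betw) (simp add: \<sigma>_def)
      finally show ?thesis using smooth_lattice[OF sm] rangeI[of "(\<lambda>n :: 'i \<Rightarrow> int. \<Sum>k\<in>UNIV. of_int (n k) *\<^sub>R \<eta> k)" "\<lambda>k. n (\<sigma> k)"] by simp
    qed
    show ?thesis by (rule bij_betw_byWitness[where f' = T]) (use TL T(3) in auto)
  qed
  have rob: "robust_symmetry \<Lambda> \<eta> \<kappa> (adjoint T)"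
    using T(4) adjoint_linear[OF T(1)] lat unfolding robust_symmetry_def symmetry_def adj
    by (auto split: option.splits)
  then obtain \<tau> where \<tau>: "induces_permutation \<Lambda> \<eta> \<kappa> (adjoint T) \<tau>"
    using robust_symmetry_induces_permutation[OF ss] by blast
  then have "\<eta> (\<sigma> (\<tau> i)) = \<eta> i" by (simp add: induces_permutation_def adj T\<eta>)
  then have "\<sigma> (\<tau> i) = i" using simple_or_smooth_inj[OF ss] by (simp add: inj_eq)
  then have "\<tau> i = j" unfolding \<sigma>_def by (metis transpose_apply_first transpose_involutory)
  with \<tau> show ?thesis using facets_equivalent_iff[OF ss] by blast
qed

text \<open>Facets whose conormals add up to zero have no common point.\<close>

lemma not_all_active:
  assumes fp: "facet_polytope V I \<eta> \<kappa>" and B: "B \<subseteq> I" "B \<noteq> {}" and rel: "(\<Sum>k\<in>B. \<eta> k) = 0"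
  shows "\<not> (\<forall>k\<in>B. x \<in> facet V I \<eta> \<kappa> k)"
proof
  assume x: "\<forall>k\<in>B. x \<in> facet V I \<eta> \<kappa> k"
  have fin: "finite B" using fp B by (meson facet_polytope_def finite_subset)
  have zero: "(\<Sum>k\<in>B. \<eta> k \<bullet> y) = 0" for y using rel by (simp add: inner_sum_left[symmetric])
  have "(\<Sum>k\<in>B. \<kappa> k) = (\<Sum>k\<in>B. \<eta> k \<bullet> x)" using x by (intro sum.cong) (auto simp: mem_facet)
  moreover obtain q where q: "\<And>i. i \<in> I \<Longrightarrow> \<eta> i \<bullet> q < \<kappa> i" using strict_interior_point[OF fp] by metis
  then have "(\<Sum>k\<in>B. \<eta> k \<bullet> q) < (\<Sum>k\<in>B. \<kappa> k)" using B fin by (intro sum_strict_mono) auto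
  ultimately show False using zero by simp
qed

lemma class_intersections_empty_if_blocks:
  fixes \<eta> :: "'i::finite \<Rightarrow> 'a::euclidean_space"
  assumes ss: "simple_or_smooth_polytope \<Lambda> \<eta> \<kappa>" and bl: "simplex_blocks \<eta> (\<lambda>_. 1) p"
    and I: "I \<in> facet_classes \<Lambda> \<eta> \<kappa>"
  shows "(\<Inter>i\<in>I. facet_of_index \<eta> \<kappa> i) = {}"
proof -
  have fp: "facet_polytope UNIV UNIV \<eta> (($) \<kappa>)" using ss by (rule simple_or_smooth_facet_polytope)
  obtain i where i: "I = facet_class \<Lambda> \<eta> \<kappa> i" using I by (auto simp: facet_classes_eq)
  let ?B = "{k. p k = p i}"
  have "?B \<subseteq> I" using facets_equivalent_if_same_block[OF ss bl, of i] by (auto simp: i facet_class_def)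
  moreover have "(\<Sum>k\<in>?B. \<eta> k) = 0" using bl by (simp add: simplex_blocks_def)
  then have "\<not> (\<forall>k\<in>?B. x \<in> facet_of_index \<eta> \<kappa> k)" for x
    by (intro not_all_active[OF fp]) auto
  ultimately show ?thesis by blast
qed

text \<open>
  Subtracting its block averages from the coefficients of any expansion of \<open>H\<close> does not change the value,
  and the classes are unions of blocks.
\<close>

lemma inessential_if_blocks:
  fixes \<eta> :: "'i::finite \<Rightarrow> 'a::euclidean_space"
  assumes ss: "simple_or_smooth_polytope \<Lambda> \<eta> \<kappa>" and bl: "simplex_blocks \<eta> (\<lambda>_. 1) p"
  shows "inessential \<Lambda> \<eta> \<kappa> H"
proof -
  have "H \<in> span (range \<eta>)" using conormals_span[OF simple_or_smooth_facet_polytope[OF ss]] by simp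
  then obtain r where r: "H = (\<Sum>k\<in>UNIV. r k *\<^sub>R \<eta> k)" using span_imageE[OF finite] by blast
  define avg where "avg b = (\<Sum>k | p k = b. r k) / real (card {k. p k = b})" for b
  define \<beta> where "\<beta> k = r k - avg (p k)" for k
  have "(\<Sum>k\<in>UNIV. avg (p k) *\<^sub>R \<eta> k) = 0" using simplex_blocks_sum[OF bl, of avg] by simp
  then have H: "H = (\<Sum>k\<in>UNIV. \<beta> k *\<^sub>R \<eta> k)" by (simp add: r \<beta>_def scaleR_diff_left sum_subtractf)
  have block: "(\<Sum>k | p k = p i. \<beta> k) = 0" for i
  proof -
    have "(\<Sum>k | p k = p i. \<beta> k) = (\<Sum>k | p k = p i. r k - avg (p i))"
      by (rule sum.cong) (auto simp: \<beta>_def)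
    also have "\<dots> = (\<Sum>k | p k = p i. r k) - real (card {k. p k = p i}) * avg (p i)"
      by (simp add: sum_subtractf)
    also have "card {k. p k = p i} \<noteq> 0" by auto
    then have "real (card {k. p k = p i}) * avg (p i) = (\<Sum>k | p k = p i. r k)" by (simp add: avg_def)
    finally show ?thesis by simp
  qed
  have "(\<Sum>k\<in>I. \<beta> k) = 0" if I: "I \<in> facet_classes \<Lambda> \<eta> \<kappa>" for I
  proof -
    obtain i where i: "I = facet_class \<Lambda> \<eta> \<kappa> i" using I by (auto simp: facet_classes_eq)
    have union: "{k \<in> I. p k = b} = {k. p k = b}" if b: "b \<in> p ` I" for b
    proof -
      obtain l where l: "l \<in> I" "b = p l" using b by blast
      have "k \<in> I" if "p k = b" for k
      proof -
        have "facets_equivalent \<Lambda> \<eta> \<kappa> l k" using facets_equivalent_if_same_block[OF ss bl] l that by simp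
        then show ?thesis using l(1) facet_class_eq_iff[OF ss] by (auto simp: i facet_class_def)
      qed
      then show ?thesis by blast
    qed
    have "(\<Sum>k\<in>I. \<beta> k) = (\<Sum>b\<in>p ` I. \<Sum>k | k \<in> I \<and> p k = b. \<beta> k)"
      by (rule sum.group[symmetric]) auto
    also have "\<dots> = 0" using union block by (intro sum.neutral) auto
    finally show ?thesis .
  qed
  with H show ?thesis unfolding inessential_def by blast
qed

section \<open>Products of simplices\<close>

subsection \<open>A product of simplices has simplex blocks\<close>

text \<open>The linear relations among the conormals of a simplex are the multiples of one positive relation.\<close>

lemma simplex_relations:
  assumes fp: "facet_polytope V I \<eta> \<kappa>" and card: "card I = dim V + 1"
  shows "\<exists>\<mu>. (\<forall>i\<in>I. \<mu> i > (0::real)) \<and> (\<Sum>i\<in>I. \<mu> i *\<^sub>R \<eta> i) = 0 \<and>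
    (\<forall>\<beta>. (\<Sum>i\<in>I. \<beta> i *\<^sub>R \<eta> i) = 0 \<longrightarrow> (\<forall>i\<in>I. \<forall>j\<in>I. \<beta> i * \<mu> j = \<beta> j * \<mu> i))"
proof -
  obtain \<mu> where \<mu>: "\<And>i. i \<in> I \<Longrightarrow> \<mu> i > (0::real)" "(\<Sum>i\<in>I. \<mu> i *\<^sub>R \<eta> i) = 0"
    using positive_relation[OF fp] by metis
  have V: "subspace V" "finite I" using fp by (auto simp: facet_polytope_def)
  have "\<beta> i * \<mu> j = \<beta> j * \<mu> i" if rel: "(\<Sum>i\<in>I. \<beta> i *\<^sub>R \<eta> i) = 0" and ij: "i \<in> I" "j \<in> I" for \<beta> i j
  proof (cases "i = j")
    case False
    have sum0: "(\<Sum>k\<in>I - {j}. \<gamma> k *\<^sub>R \<eta> k) = - (\<gamma> j *\<^sub>R \<eta> j)" if "(\<Sum>k\<in>I. \<gamma> k *\<^sub>R \<eta> k) = 0" for \<gamma>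
      using that V(2) ij(2) by (simp add: sum.remove[of I j] eq_neg_iff_add_eq_0 add.commute)
    have "span (\<eta> ` (I - {j})) = V"
    proof -
      have "\<eta> j = (- 1 / \<mu> j) *\<^sub>R (\<Sum>k\<in>I - {j}. \<mu> k *\<^sub>R \<eta> k)" using sum0[OF \<mu>(2)] \<mu>(1)[OF ij(2)] by simp
      also have "\<dots> \<in> span (\<eta> ` (I - {j}))" by (intro span_scale span_sum span_base) auto
      finally have "\<eta> ` I \<subseteq> span (\<eta> ` (I - {j}))" by (auto intro: span_base)
      then have "span (\<eta> ` I) \<subseteq> span (\<eta> ` (I - {j}))" by (simp add: span_minimal)
      moreover have "span (\<eta> ` (I - {j})) \<subseteq> span (\<eta> ` I)" by (intro span_mono) auto
      ultimately show ?thesis using conormals_span[OF fp] by auto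
    qed
    moreover have "(\<Sum>k\<in>I - {j}. (\<beta> k * \<mu> j - \<beta> j * \<mu> k) *\<^sub>R \<eta> k) = 0"
    proof -
      have "(\<Sum>k\<in>I - {j}. (\<beta> k * \<mu> j - \<beta> j * \<mu> k) *\<^sub>R \<eta> k)
        = \<mu> j *\<^sub>R (\<Sum>k\<in>I - {j}. \<beta> k *\<^sub>R \<eta> k) - \<beta> j *\<^sub>R (\<Sum>k\<in>I - {j}. \<mu> k *\<^sub>R \<eta> k)"
        by (simp add: scaleR_sum_right scaleR_diff_left sum_subtractf mult.commute)
      then show ?thesis by (simp add: sum0[OF rel] sum0[OF \<mu>(2)] mult.commute)
    qed
    ultimately have "\<beta> i * \<mu> j - \<beta> j * \<mu> i = 0"
      using V card ij False by (intro no_relation_if_spanning[of "I - {j}" V \<eta> "\<lambda>k. \<beta> k * \<mu> j - \<beta> j * \<mu> k" i]) auto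
    then show ?thesis by simp
  qed simp
  with \<mu> show ?thesis by blast
qed

lemma no_recession_direction:
  assumes fp: "facet_polytope V I \<eta> \<kappa>" and d: "d \<in> V" "\<And>i. i \<in> I \<Longrightarrow> \<eta> i \<bullet> d \<le> 0"
  shows "d = 0"
proof -
  obtain \<mu> where \<mu>: "\<And>i. i \<in> I \<Longrightarrow> \<mu> i > (0::real)" "(\<Sum>i\<in>I. \<mu> i *\<^sub>R \<eta> i) = 0"
    using positive_relation[OF fp] by metis
  have fin: "finite I" using fp by (simp add: facet_polytope_def)
  have "(\<Sum>i\<in>I. - (\<mu> i * (\<eta> i \<bullet> d))) = - ((\<Sum>i\<in>I. \<mu> i *\<^sub>R \<eta> i) \<bullet> d)"
    by (simp add: inner_sum_left sum_negf)
  also have "\<dots> = 0" using \<mu>(2) by simp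
  finally have "- (\<mu> i * (\<eta> i \<bullet> d)) = 0" if "i \<in> I" for i
    using that d(2) \<mu>(1) fin
    by (subst (asm) sum_nonneg_eq_0_iff) (auto simp: mult_nonneg_nonpos less_imp_le)
  then have "\<eta> i \<bullet> d = 0" if "i \<in> I" for i using \<mu>(1) that by force
  then show ?thesis using d(1) conormals_span[OF fp] by (intro inner_eq_on_spanning[of d 0 \<eta> I]) auto
qed

text \<open>Without one of its inequalities a simplex is unbounded.\<close>

lemma simplex_direction:
  assumes fp: "facet_polytope V I \<eta> \<kappa>" and card: "card I = dim V + 1" and k: "k \<in> I"
  obtains d where "d \<in> V" "d \<noteq> 0" "\<And>l. l \<in> I \<Longrightarrow> l \<noteq> k \<Longrightarrow> \<eta> l \<bullet> d = -1"
proof -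
  have V: "subspace V" "finite I" and \<eta>: "\<And>i. i \<in> I \<Longrightarrow> \<eta> i \<in> V" "\<eta> k \<noteq> 0"
    using fp k by (auto simp: facet_polytope_def)
  obtain \<mu> where pos: "\<forall>i\<in>I. \<mu> i > (0::real)"
    and rels: "\<forall>\<beta>. (\<Sum>i\<in>I. \<beta> i *\<^sub>R \<eta> i) = 0 \<longrightarrow> (\<forall>i\<in>I. \<forall>j\<in>I. \<beta> i * \<mu> j = \<beta> j * \<mu> i)"
    using simplex_relations[OF fp card] by blast
  define u where "u l = (if l = k then (\<Sum>l\<in>I - {k}. \<mu> l) / \<mu> k else - 1)" for l
  obtain d' where d': "\<And>l. l \<in> I \<Longrightarrow> \<eta> l \<bullet> d' = u l"
  proof (rule inner_system_solvable[OF V(2)])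
    fix \<beta> assume rel: "(\<Sum>k\<in>I. \<beta> k *\<^sub>R \<eta> k) = 0"
    have "\<beta> l = \<beta> k / \<mu> k * \<mu> l" if "l \<in> I" for l
    proof -
      have "\<beta> l * \<mu> k = \<beta> k * \<mu> l" using rels rel that k by blast
      moreover have "\<mu> k > 0" using pos k by blast
      ultimately show ?thesis by (simp add: field_simps)
    qed
    then have "(\<Sum>l\<in>I. \<beta> l * u l) = (\<Sum>l\<in>I. \<beta> k / \<mu> k * (\<mu> l * u l))"
      by (intro sum.cong) auto
    also have "\<dots> = \<beta> k / \<mu> k * (\<Sum>l\<in>I. \<mu> l * u l)" by (simp add: sum_distrib_left)
    also have "(\<Sum>l\<in>I. \<mu> l * u l) = \<mu> k * u k + (\<Sum>l\<in>I - {k}. \<mu> l * u l)"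
      using V(2) k by (rule sum.remove)
    also have "(\<Sum>l\<in>I - {k}. \<mu> l * u l) = - (\<Sum>l\<in>I - {k}. \<mu> l)"
      unfolding sum_negf[symmetric] by (rule sum.cong) (auto simp: u_def)
    also have "\<mu> k * u k = (\<Sum>l\<in>I - {k}. \<mu> l)" using pos[rule_format, OF k] by (simp add: u_def)
    finally show "(\<Sum>l\<in>I. \<beta> l * u l) = 0" by simp
  qed blast
  obtain d where d: "d \<in> V" "\<And>w. w \<in> V \<Longrightarrow> w \<bullet> d = w \<bullet> d'" using orthogonal_part[OF V(1), of d'] by blast
  have 1: "\<eta> l \<bullet> d = -1" if "l \<in> I" "l \<noteq> k" for l using d(2) \<eta>(1) d' that by (simp add: u_def)
  have "dim V \<noteq> 0" using \<eta> k by auto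
  then have "card I \<noteq> 1" using card by simp
  then have "I \<noteq> {k}" by auto
  then obtain l where "l \<in> I" "l \<noteq> k" using k by blast
  then have "d \<noteq> 0" using 1 by fastforce
  with d(1) 1 show thesis using that by blast
qed

text \<open>
  The facet inequalities of the factors, pulled back to the product, describe the polytope. Each conormal
  is a positive multiple \<open>t i\<close> of exactly one pulled back conormal \<open>E (m i)\<close>, and none of these is left out,
  for otherwise the polytope would be unbounded. So the relations of the factors give the blocks.
\<close>

lemma blocks_if_product_of_simplices:
  fixes \<eta> :: "'i::finite \<Rightarrow> 'a::euclidean_space"
  assumes fp: "facet_polytope UNIV UNIV \<eta> (($) \<kappa>)"
    and prod: "\<forall>j<r. simplex_in (V j) (S j)" "product_affine_equivalence r V A b S (polytope_of \<eta> \<kappa>)"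
  obtains \<mu> and p :: "'i \<Rightarrow> nat" where "simplex_blocks \<eta> \<mu> p"
proof -
  let ?R = "{..<r}" and ?\<Phi> = "product_linear r A"
  obtain I e c where fpj: "\<And>j. j \<in> ?R \<Longrightarrow> facet_polytope (V j) (I j :: nat set) (e j) (c j)"
    and cardj: "\<And>j. j \<in> ?R \<Longrightarrow> card (I j) = dim (V j) + 1"
    and S: "\<And>j. j \<in> ?R \<Longrightarrow> S j = halfspace_inter (V j) (I j) (e j) (c j)"
  proof -
    have "\<forall>j. \<exists>I e c. j \<in> ?R \<longrightarrow> facet_polytope (V j) (I :: nat set) e c \<and> card I = dim (V j) + 1 \<and> S j = halfspace_inter (V j) I e c"
      using prod(1) unfolding simplex_in_def by auto
    then show thesis using that unfolding choice_iff by blast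
  qed
  have V: "subspace (V j)" "finite (I j)" "\<And>k. k \<in> I j \<Longrightarrow> e j k \<in> V j" if "j \<in> ?R" for j
    using fpj[OF that] by (auto simp: facet_polytope_def)
  have linA: "\<And>j. j \<in> ?R \<Longrightarrow> linear (A j)" and bij: "bij_betw ?\<Phi> (PiE ?R V) UNIV"
    and P: "(\<lambda>f. ?\<Phi> f + b) ` PiE ?R S = polytope_of \<eta> \<kappa>"
    using prod(2) by (auto simp: product_affine_equivalence_def)
  define \<Psi> where "\<Psi> = the_inv_into (PiE ?R V) ?\<Phi>"
  have \<Psi>1: "\<Psi> x \<in> PiE ?R V" "?\<Phi> (\<Psi> x) = x" for x
    using bij unfolding \<Psi>_def bij_betw_def
    by (metis UNIV_I order_refl the_inv_into_into) (metis UNIV_I bij bij_betw_def f_the_inv_into_f)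
  have \<Psi>2: "\<Psi> (?\<Phi> f) = f" if "f \<in> PiE ?R V" for f
    using bij that unfolding \<Psi>_def bij_betw_def by (metis the_inv_into_f_f)
  define g where "g j x = \<Psi> x j" for j x
  have gV: "g j x \<in> V j" if "j \<in> ?R" for j x using \<Psi>1(1)[of x] that by (auto simp: g_def)
  have lin_g: "linear (g j)" if j: "j \<in> ?R" for j
  proof (rule linearI)
    fix x y
    let ?f = "restrict (\<lambda>j. \<Psi> x j + \<Psi> y j) ?R"
    have "?f \<in> PiE ?R V" using V gV by (auto simp: subspace_add g_def)
    moreover have "?\<Phi> ?f = ?\<Phi> (\<Psi> x) + ?\<Phi> (\<Psi> y)"
      using linA by (auto simp: product_linear_def linear_add sum.distrib[symmetric] intro!: sum.cong)
    ultimately have "\<Psi> (x + y) = ?f" using \<Psi>1 \<Psi>2 by metis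
    then show "g j (x + y) = g j x + g j y" using j by (simp add: g_def)
  next
    fix s x
    let ?f = "restrict (\<lambda>j. s *\<^sub>R \<Psi> x j) ?R"
    have "?f \<in> PiE ?R V" using V gV by (auto simp: subspace_scale g_def)
    moreover have "?\<Phi> ?f = s *\<^sub>R ?\<Phi> (\<Psi> x)"
      using linA by (auto simp: product_linear_def linear_scale scaleR_sum_right intro!: sum.cong)
    ultimately have "\<Psi> (s *\<^sub>R x) = ?f" using \<Psi>1 \<Psi>2 by metis
    then show "g j (s *\<^sub>R x) = s *\<^sub>R g j x" using j by (simp add: g_def)
  qed
  \<comment> \<open>the vector of the product with the single nonzero component \<open>d\<close>\<close>
  have single: "\<exists>D. \<forall>l\<in>?R. g l D = (if l = j then d else 0)" if "j \<in> ?R" "d \<in> V j" for j d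
  proof -
    let ?f = "restrict (\<lambda>l. if l = j then d else 0) ?R"
    have "?f \<in> PiE ?R V" using V that by (auto simp: subspace_0)
    then have "\<forall>l\<in>?R. g l (?\<Phi> ?f) = (if l = j then d else 0)" using \<Psi>2 by (auto simp: g_def)
    then show ?thesis by blast
  qed
  define K where "K = Sigma ?R I"
  \<comment> \<open>the conormal of facet \<open>k\<close> of factor \<open>j\<close>, as a vector of the whole space\<close>
  define E where "E jk = adjoint (g (fst jk)) (e (fst jk) (snd jk))" for jk
  have E: "E jk \<bullet> x = e (fst jk) (snd jk) \<bullet> g (fst jk) x" if "jk \<in> K" for jk x
    unfolding E_def using that by (intro adjoint_inner lin_g) (auto simp: K_def)
  have finK: "finite K" unfolding K_def using V by (intro finite_SigmaI) auto
  have descr: "polytope_of \<eta> \<kappa> = {x. \<forall>jk\<in>K. E jk \<bullet> x \<le> c (fst jk) (snd jk) + E jk \<bullet> b}"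
  proof (rule set_eqI)
    fix x
    have "x \<in> polytope_of \<eta> \<kappa> \<longleftrightarrow> \<Psi> (x - b) \<in> PiE ?R S"
    proof
      assume "x \<in> polytope_of \<eta> \<kappa>"
      then obtain f where f: "f \<in> PiE ?R S" "x = ?\<Phi> f + b" using P by auto
      moreover have "f \<in> PiE ?R V" using f S by (auto simp: mem_halfspace_inter PiE_iff)
      ultimately show "\<Psi> (x - b) \<in> PiE ?R S" using \<Psi>2 by simp
    next
      assume "\<Psi> (x - b) \<in> PiE ?R S"
      moreover have "x = ?\<Phi> (\<Psi> (x - b)) + b" using \<Psi>1(2) by simp
      ultimately show "x \<in> polytope_of \<eta> \<kappa>" using P by blast
    qed
    also have "\<dots> \<longleftrightarrow> (\<forall>j\<in>?R. g j (x - b) \<in> S j)" using \<Psi>1(1)[of "x - b"] by (auto simp: g_def PiE_iff)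
    also have "\<dots> \<longleftrightarrow> (\<forall>j\<in>?R. \<forall>k\<in>I j. e j k \<bullet> g j (x - b) \<le> c j k)"
      using S gV by (simp add: mem_halfspace_inter)
    also have "\<dots> \<longleftrightarrow> (\<forall>jk\<in>K. E jk \<bullet> (x - b) \<le> c (fst jk) (snd jk))"
      using E by (auto simp: K_def)
    finally show "x \<in> polytope_of \<eta> \<kappa> \<longleftrightarrow> x \<in> {x. \<forall>jk\<in>K. E jk \<bullet> x \<le> c (fst jk) (snd jk) + E jk \<bullet> b}"
      by (simp add: inner_diff_right algebra_simps)
  qed
  have "\<exists>jk t. jk \<in> K \<and> t > 0 \<and> \<eta> i = t *\<^sub>R E jk" for i
    using facet_inequality_in_description[OF fp UNIV_I finK descr, of i] by metis
  then obtain m t where m: "\<And>i. m i \<in> K" and t: "\<And>i. t i > 0" and \<eta>: "\<And>i. \<eta> i = t i *\<^sub>R E (m i)" by metis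
  have "inj m"
  proof (rule injI)
    fix i l assume il: "m i = m l"
    have "\<eta> l = (t l / t i) *\<^sub>R \<eta> i" using \<eta>[of i] \<eta>[of l] il t[of i] by simp
    then show "i = l" using t by (intro conormal_direction_unique[OF fp, of i l "t l / t i"]) auto
  qed
  have "K \<subseteq> range m"
  proof (rule subsetI, rule ccontr)
    fix jk assume jk: "jk \<in> K" "jk \<notin> range m"
    obtain j k where [simp]: "jk = (j, k)" by (cases jk)
    have j: "j \<in> ?R" "k \<in> I j" using jk by (auto simp: K_def)
    obtain d where d: "d \<in> V j" "d \<noteq> 0" "\<And>l. l \<in> I j \<Longrightarrow> l \<noteq> k \<Longrightarrow> e j l \<bullet> d = -1"
      using simplex_direction[OF fpj[OF j(1)] cardj[OF j(1)] j(2)] by metis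
    obtain D where D: "\<And>l. l \<in> ?R \<Longrightarrow> g l D = (if l = j then d else 0)" using single[OF j(1) d(1)] by metis
    have "\<eta> i \<bullet> D \<le> 0" for i
    proof -
      obtain a l where al: "m i = (a, l)" by (cases "m i")
      have "a \<in> ?R" "l \<in> I a" using m[of i] al by (auto simp: K_def)
      moreover have "(a, l) \<noteq> (j, k)" using jk(2) al rangeI[of m i] by auto
      ultimately have "e a l \<bullet> g a D \<le> 0" using D d by auto
      then have "E (m i) \<bullet> D \<le> 0" using E[OF m, of i D] al by simp
      then show ?thesis using \<eta>[of i] t[of i] by (simp add: mult_nonneg_nonpos)
    qed
    then have "D = 0" by (intro no_recession_direction[OF fp]) auto
    then have "g j D = 0" using lin_g[OF j(1)] by (simp add: linear_0)
    then show False using D j d by simp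
  qed
  then have bijm: "bij_betw m UNIV K" using \<open>inj m\<close> m by (auto simp: bij_betw_def)
  define n where "n = the_inv_into UNIV m"
  have n: "m (n jk) = jk" if "jk \<in> K" for jk
    unfolding n_def using \<open>inj m\<close> bijm that by (intro f_the_inv_into_f) (auto simp: bij_betw_def)
  have n2: "n (m i) = i" for i unfolding n_def using \<open>inj m\<close> by (intro the_inv_into_f_f) auto
  define p where "p i = fst (m i)" for i
  have block: "(\<Sum>i | p i = j. h i) = (\<Sum>k\<in>I j. h (n (j, k)))" if "j \<in> ?R" for j and h :: "'i \<Rightarrow> 'z::comm_monoid_add"
  proof (rule sum.reindex_bij_witness[where i = "\<lambda>k. n (j, k)" and j = "\<lambda>i. snd (m i)"])
    fix i assume "i \<in> {i. p i = j}"
    then have mi: "m i = (j, snd (m i))" by (simp add: p_def prod_eq_iff)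
    then show "n (j, snd (m i)) = i" using n2[of i] by simp
    then show "h (n (j, snd (m i))) = h i" by simp
    show "snd (m i) \<in> I j" using m[of i] mi by (auto simp: K_def)
  next
    fix k assume "k \<in> I j"
    then have "(j, k) \<in> K" using that by (simp add: K_def)
    from n[OF this] show "snd (m (n (j, k))) = k" "n (j, k) \<in> {i. p i = j}" by (auto simp: p_def)
  qed
  have "\<forall>j. \<exists>\<mu>. j \<in> ?R \<longrightarrow> (\<forall>i\<in>I j. \<mu> i > (0::real)) \<and> (\<Sum>i\<in>I j. \<mu> i *\<^sub>R e j i) = 0 \<and>
    (\<forall>\<beta>. (\<Sum>i\<in>I j. \<beta> i *\<^sub>R e j i) = 0 \<longrightarrow> (\<forall>i\<in>I j. \<forall>l\<in>I j. \<beta> i * \<mu> l = \<beta> l * \<mu> i))"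
    using simplex_relations fpj cardj by blast
  then obtain M where M: "\<And>j i. j \<in> ?R \<Longrightarrow> i \<in> I j \<Longrightarrow> M j i > (0::real)"
     "\<And>j. j \<in> ?R \<Longrightarrow> (\<Sum>i\<in>I j. M j i *\<^sub>R e j i) = 0"
     "\<And>j \<beta> i l. j \<in> ?R \<Longrightarrow> (\<Sum>i\<in>I j. \<beta> i *\<^sub>R e j i) = 0 \<Longrightarrow> i \<in> I j \<Longrightarrow> l \<in> I j \<Longrightarrow> \<beta> i * M j l = \<beta> l * M j i"
    unfolding choice_iff by blast
  have pR: "p i \<in> ?R" "snd (m i) \<in> I (p i)" for i using m[of i] by (auto simp: K_def p_def)
  define \<mu> where "\<mu> i = M (p i) (snd (m i)) / t i" for i
  have "simplex_blocks \<eta> \<mu> p"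
    unfolding simplex_blocks_def
  proof (intro conjI allI impI)
    show "\<mu> i > 0" for i using M(1)[OF pR] t[of i] by (simp add: \<mu>_def)
  next
    fix i
    let ?j = "p i"
    have "(\<Sum>k | p k = ?j. \<mu> k *\<^sub>R \<eta> k) = (\<Sum>k | p k = ?j. M (p k) (snd (m k)) *\<^sub>R E (m k))"
    proof (rule sum.cong)
      fix k show "\<mu> k *\<^sub>R \<eta> k = M (p k) (snd (m k)) *\<^sub>R E (m k)"
        using t[of k] \<eta>[of k] by (simp add: \<mu>_def)
    qed simp
    also have "\<dots> = (\<Sum>k\<in>I ?j. M (p (n (?j, k))) (snd (m (n (?j, k)))) *\<^sub>R E (m (n (?j, k))))"
      by (rule block) (rule pR)
    also have "\<dots> = (\<Sum>k\<in>I ?j. M ?j k *\<^sub>R adjoint (g ?j) (e ?j k))"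
    proof (rule sum.cong)
      fix k assume "k \<in> I ?j"
      then have "m (n (?j, k)) = (?j, k)" using pR by (intro n) (simp add: K_def)
      then show "M (p (n (?j, k))) (snd (m (n (?j, k)))) *\<^sub>R E (m (n (?j, k))) = M ?j k *\<^sub>R adjoint (g ?j) (e ?j k)"
        by (simp add: p_def[of "n _"] E_def)
    qed simp
    also have "\<dots> = adjoint (g ?j) (\<Sum>k\<in>I ?j. M ?j k *\<^sub>R e ?j k)"
      using adjoint_linear[OF lin_g[OF pR(1)]] by (simp add: linear_sum linear_scale)
    also have "\<dots> = 0" using M(2)[OF pR(1)] adjoint_linear[OF lin_g[OF pR(1)]] by (simp add: linear_0)
    finally show "(\<Sum>k | p k = p i. \<mu> k *\<^sub>R \<eta> k) = 0" .
  next
    fix \<beta> i l assume rel: "(\<Sum>k\<in>UNIV. \<beta> k *\<^sub>R \<eta> k) = 0" and il: "p i = p l"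
    let ?j = "p i"
    define \<gamma> where "\<gamma> k = \<beta> (n (?j, k)) * t (n (?j, k))" for k
    define w where "w = (\<Sum>k\<in>I ?j. \<gamma> k *\<^sub>R e ?j k)"
    have wV: "w \<in> V ?j" unfolding w_def using V[OF pR(1)] by (intro subspace_sum subspace_scale) auto
    obtain D where D: "\<And>l. l \<in> ?R \<Longrightarrow> g l D = (if l = ?j then w else 0)" using single[OF pR(1) wV] by metis
    have "0 = (\<Sum>k\<in>UNIV. \<beta> k *\<^sub>R \<eta> k) \<bullet> D" using rel by simp
    also have "\<dots> = (\<Sum>k\<in>UNIV. \<beta> k * t k * (e (p k) (snd (m k)) \<bullet> g (p k) D))"
      unfolding inner_sum_left by (rule sum.cong) (simp_all add: \<eta> E[OF m] p_def)
    also have "\<dots> = (\<Sum>k | p k = ?j. \<beta> k * t k * (e (p k) (snd (m k)) \<bullet> w))"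
      using D pR(1) by (intro sum.mono_neutral_cong_right) auto
    also have "\<dots> = (\<Sum>k\<in>I ?j. \<beta> (n (?j, k)) * t (n (?j, k)) * (e (p (n (?j, k))) (snd (m (n (?j, k)))) \<bullet> w))"
      by (rule block) (rule pR)
    also have "\<dots> = (\<Sum>k\<in>I ?j. \<gamma> k * (e ?j k \<bullet> w))"
    proof (rule sum.cong)
      fix k assume "k \<in> I ?j"
      then have "m (n (?j, k)) = (?j, k)" using pR by (intro n) (simp add: K_def)
      then show "\<beta> (n (?j, k)) * t (n (?j, k)) * (e (p (n (?j, k))) (snd (m (n (?j, k)))) \<bullet> w) = \<gamma> k * (e ?j k \<bullet> w)"
        by (simp add: p_def[of "n _"] \<gamma>_def)
    qed simp
    also have "\<dots> = w \<bullet> w" by (subst (2) w_def) (simp add: inner_sum_left)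
    finally have "w = 0" by simp
    then have rel': "(\<Sum>k\<in>I ?j. \<gamma> k *\<^sub>R e ?j k) = 0" by (simp add: w_def)
    have \<gamma>: "\<gamma> (snd (m k)) = \<beta> k * t k" if "p k = ?j" for k
    proof -
      have "(?j, snd (m k)) = m k" using that by (simp add: p_def prod_eq_iff)
      then show ?thesis by (simp add: \<gamma>_def n2)
    qed
    have "\<gamma> (snd (m i)) * M ?j (snd (m l)) = \<gamma> (snd (m l)) * M ?j (snd (m i))"
      using pR(2)[of i] pR(2)[of l] il by (intro M(3)[OF pR(1) rel']) auto
    then have "\<beta> i * t i * M ?j (snd (m l)) = \<beta> l * t l * M ?j (snd (m i))"
      using \<gamma>[of i] \<gamma>[of l] il by simp
    then show "\<beta> i * \<mu> l = \<beta> l * \<mu> i"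
      using t[of i] t[of l] il by (simp add: \<mu>_def field_simps)
  qed
  then show thesis by (rule that)
qed

subsection \<open>A polytope with simplex blocks is a product of simplices\<close>

text \<open>The facets of a simplex factor are indexed by natural numbers, whence some reindexing.\<close>

lemma halfspace_inter_reindex:
  assumes "\<forall>i\<in>B. g (f i) = i"
  shows "halfspace_inter V (f ` B) (\<lambda>k. \<eta> (g k)) (\<lambda>k. \<kappa> (g k)) = halfspace_inter V B \<eta> \<kappa>"
  using assms by (simp add: halfspace_inter_def)

lemma facet_reindex:
  assumes "\<forall>i\<in>B. g (f i) = i" "i \<in> B"
  shows "facet V (f ` B) (\<lambda>k. \<eta> (g k)) (\<lambda>k. \<kappa> (g k)) (f i) = facet V B \<eta> \<kappa> i"
  using assms by (simp add: facet_def halfspace_inter_reindex[where g = g and f = f, OF assms(1)])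

lemma facet_polytope_reindex:
  assumes inv: "\<forall>i\<in>B. g (f i) = i" and fp: "facet_polytope V B \<eta> \<kappa>"
  shows "facet_polytope V (f ` B) (\<lambda>k. \<eta> (g k)) (\<lambda>k. \<kappa> (g k))"
proof -
  have "inj_on (facet V (f ` B) (\<lambda>k. \<eta> (g k)) (\<lambda>k. \<kappa> (g k))) (f ` B)"
    using fp unfolding facet_polytope_def inj_on_def
    by (simp add: facet_reindex[where g = g and f = f, OF inv]) blast
  moreover have "(\<lambda>k. \<eta> (g k)) ` f ` B = \<eta> ` B" using inv by (force simp: image_image)
  ultimately show ?thesis
    using fp inv unfolding facet_polytope_def halfspace_inter_reindex[where g = g and f = f, OF inv] by (simp add: facet_reindex[where g = g and f = f, OF inv])
qed

lemma active_reindex: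
  assumes inv: "\<forall>i\<in>B. g (f i) = i"
  shows "{k \<in> f ` B. v \<in> facet V (f ` B) (\<lambda>k. \<eta> (g k)) (\<lambda>k. \<kappa> (g k)) k} = f ` {i \<in> B. v \<in> facet V B \<eta> \<kappa> i}"
  by (auto simp: facet_reindex[where g = g and f = f, OF inv])

lemma smooth_polytope_reindex:
  assumes inv: "\<forall>i\<in>B. g (f i) = i" and sm: "smooth_polytope V M B \<eta> \<kappa>"
  shows "smooth_polytope V M (f ` B) (\<lambda>k. \<eta> (g k)) (\<lambda>k. \<kappa> (g k))"
proof -
  have "inj_on f B" using inv by (intro inj_on_inverseI[of B g]) blast
  then have "inj_on f {i \<in> B. Q i}" for Q by (rule inj_on_subset) blast
  then have c: "card (f ` {i \<in> B. Q i}) = card {i \<in> B. Q i}" for Q by (rule card_image)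
  have im: "(\<lambda>k. \<eta> (g k)) ` f ` {i \<in> B. Q i} = \<eta> ` {i \<in> B. Q i}" for Q using inv by (force simp: image_image)
  have "facet_polytope V B \<eta> \<kappa>" using sm by (simp add: smooth_polytope_def simple_polytope_def)
  from facet_polytope_reindex[where g = g and f = f, OF inv this] sm inv show ?thesis
    unfolding smooth_polytope_def simple_polytope_def c im
      active_reindex[where g = g and f = f, OF inv] halfspace_inter_reindex[where g = g and f = f, OF inv]
    by simp
qed

text \<open>
  The factor that belongs to the block \<open>B j\<close> lives in the span \<open>W j\<close> of the conormals of the block, with
  the same inequalities; the space is the direct sum of the \<open>W j\<close>.
\<close>

locale simplex_block_polytope =
  fixes \<eta> :: "'i::finite \<Rightarrow> 'a::euclidean_space" and \<kappa> :: "real ^ 'i" and p :: "'i \<Rightarrow> nat"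
  assumes fp: "facet_polytope UNIV UNIV \<eta> (($) \<kappa>)" and bl: "simplex_blocks \<eta> (\<lambda>_. 1) p"
begin

definition B :: "nat \<Rightarrow> 'i set" where "B j = {i. p i = j}"
definition W :: "nat \<Rightarrow> 'a set" where "W j = span (\<eta> ` B j)"

lemma block_sum: "j \<in> range p \<Longrightarrow> (\<Sum>k\<in>B j. \<eta> k) = 0"
  using bl by (auto simp: simplex_blocks_def B_def)

lemma relation_on_block:
  assumes "(\<Sum>k\<in>UNIV. \<beta> k *\<^sub>R \<eta> k) = 0" "i \<in> B j" "l \<in> B j"
  shows "\<beta> i = \<beta> l"
  using simplex_blocks_relation[OF bl assms(1), of i l] assms by (simp add: B_def)

lemma relation_sum_by_blocks:
  fixes y :: "'i \<Rightarrow> 'z::real_normed_vector"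
  assumes rel: "(\<Sum>k\<in>UNIV. \<beta> k *\<^sub>R \<eta> k) = 0" and "\<And>j. j \<in> range p \<Longrightarrow> (\<Sum>k\<in>B j. y k) = 0"
  shows "(\<Sum>k\<in>UNIV. \<beta> k *\<^sub>R y k) = 0"
proof -
  have "(\<Sum>k | p k = j. \<beta> k *\<^sub>R y k) = 0" if j: "j \<in> range p" for j
  proof -
    obtain i where i: "j = p i" using j by blast
    have "(\<Sum>k | p k = j. \<beta> k *\<^sub>R y k) = \<beta> i *\<^sub>R (\<Sum>k\<in>B j. y k)"
      unfolding scaleR_sum_right
    proof (rule sum.cong)
      fix k assume "k \<in> B j"
      then have "\<beta> k = \<beta> i" using relation_on_block[OF rel, of k j i] i by (simp add: B_def)
      then show "\<beta> k *\<^sub>R y k = \<beta> i *\<^sub>R y k" by simp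
    qed (simp add: B_def)
    then show ?thesis using assms(2)[OF j] by simp
  qed
  then show ?thesis using sum_by_blocks[where p = p and h = "\<lambda>k. \<beta> k *\<^sub>R y k"] by simp
qed

lemma \<eta>_in_W: "i \<in> B j \<Longrightarrow> \<eta> i \<in> W j"
  unfolding W_def by (auto intro: span_base)

lemma subspace_W: "subspace (W j)"
  by (simp add: W_def)

text \<open>A point of the space is determined by its pairings with the conormals, which in turn can be
  prescribed block by block.\<close>

lemma glue:
  obtains x where "\<And>i. \<eta> i \<bullet> x = \<eta> i \<bullet> f (p i)"
proof (rule inner_system_solvable[of UNIV \<eta> "\<lambda>i. \<eta> i \<bullet> f (p i)"])
  fix \<beta> assume rel: "(\<Sum>k\<in>UNIV. \<beta> k *\<^sub>R \<eta> k) = 0"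
  have "(\<Sum>k\<in>UNIV. \<beta> k *\<^sub>R (\<eta> k \<bullet> f (p k))) = 0"
  proof (rule relation_sum_by_blocks[OF rel])
    fix j assume j: "j \<in> range p"
    have "(\<Sum>k\<in>B j. \<eta> k \<bullet> f (p k)) = (\<Sum>k\<in>B j. \<eta> k) \<bullet> f j"
      unfolding inner_sum_left by (rule sum.cong) (auto simp: B_def)
    then show "(\<Sum>k\<in>B j. \<eta> k \<bullet> f (p k)) = 0" using block_sum[OF j] by simp
  qed
  then show "(\<Sum>k\<in>UNIV. \<beta> k * (\<eta> k \<bullet> f (p k))) = 0" by simp
qed (use that in auto)

lemma separating: "(\<And>i. \<eta> i \<bullet> x = \<eta> i \<bullet> y) \<Longrightarrow> x = y"
  using conormals_span[OF fp] by (intro inner_eq_on_spanning[of x y \<eta> UNIV]) auto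

lemma separating_W: "x \<in> W j \<Longrightarrow> y \<in> W j \<Longrightarrow> (\<And>i. i \<in> B j \<Longrightarrow> \<eta> i \<bullet> x = \<eta> i \<bullet> y) \<Longrightarrow> x = y"
  unfolding W_def by (intro inner_eq_on_spanning[of x y \<eta> "B j"]) (auto intro: span_diff)

lemma block_relation_zero:
  assumes "i \<in> B j" "J \<subseteq> B j" "i \<notin> J" and rel: "(\<Sum>k\<in>J. \<beta> k *\<^sub>R \<eta> k) = 0" and "k \<in> J"
  shows "\<beta> k = 0"
proof -
  define \<gamma> where "\<gamma> l = (if l \<in> J then \<beta> l else 0)" for l
  have "(\<Sum>l\<in>UNIV. \<gamma> l *\<^sub>R \<eta> l) = (\<Sum>l\<in>J. \<beta> l *\<^sub>R \<eta> l)"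
    by (rule sum.mono_neutral_cong_right) (auto simp: \<gamma>_def)
  then have "\<gamma> k = \<gamma> i" using rel assms by (intro relation_on_block[of _ _ j]) auto
  then show ?thesis using assms by (simp add: \<gamma>_def)
qed

lemma in\<eta>: "inj_on \<eta> J"
  using conormals_inj[OF fp] by (rule inj_on_subset) simp

lemma independent_block_remove:
  assumes i: "i \<in> B j"
  shows "independent (\<eta> ` (B j - {i}))" "span (\<eta> ` (B j - {i})) = W j" "dim (W j) = card (B j) - 1"
proof -
  show ind: "independent (\<eta> ` (B j - {i}))"
  proof (rule independent_if_scalars_zero)
    fix f x assume "(\<Sum>x\<in>\<eta> ` (B j - {i}). f x *\<^sub>R x) = 0" and x: "x \<in> \<eta> ` (B j - {i})"
    then have "(\<Sum>k\<in>B j - {i}. f (\<eta> k) *\<^sub>R \<eta> k) = 0" by (simp add: sum.reindex in\<eta>)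
    then show "f x = 0" using x block_relation_zero[OF i, of "B j - {i}" "\<lambda>k. f (\<eta> k)"] by auto
  qed simp
  show sp: "span (\<eta> ` (B j - {i})) = W j"
  proof -
    have "j \<in> range p" using i by (auto simp: B_def)
    then have "\<eta> i + (\<Sum>k\<in>B j - {i}. \<eta> k) = 0" using block_sum[of j] i by (simp add: sum.remove[of "B j" i])
    then have "\<eta> i = - (\<Sum>k\<in>B j - {i}. \<eta> k)" by (simp add: eq_neg_iff_add_eq_0)
    also have "\<dots> \<in> span (\<eta> ` (B j - {i}))" by (intro span_neg span_sum span_base) auto
    finally have "\<eta> ` B j \<subseteq> span (\<eta> ` (B j - {i}))" by (auto intro: span_base)
    then have "W j \<subseteq> span (\<eta> ` (B j - {i}))" unfolding W_def by (simp add: span_minimal)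
    moreover have "span (\<eta> ` (B j - {i})) \<subseteq> W j" unfolding W_def by (intro span_mono) auto
    ultimately show ?thesis by auto
  qed
  have "dim (W j) = card (\<eta> ` (B j - {i}))" using dim_span[of "\<eta> ` (B j - {i})"] dim_eq_card_independent[OF ind] sp by simp
  then show "dim (W j) = card (B j) - 1" using i by (simp add: card_image in\<eta>)
qed

lemma facet_polytope_block: "facet_polytope (W j) (B j) \<eta> (($) \<kappa>)"
proof -
  have part: "\<exists>y\<in>W j. \<forall>w\<in>W j. w \<bullet> y = w \<bullet> x" for x
    using subspace_W by (rule orthogonal_part)
  obtain q where q: "\<And>i. \<eta> i \<bullet> q < \<kappa> $ i" using strict_interior_point[OF fp] by auto
  obtain q' where q': "q' \<in> W j" "\<forall>w\<in>W j. w \<bullet> q' = w \<bullet> q" using part by blast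
  have "\<exists>y. y \<in> W j \<and> \<eta> i \<bullet> y = \<kappa> $ i \<and> (\<forall>k\<in>B j. k \<noteq> i \<longrightarrow> \<eta> k \<bullet> y < \<kappa> $ k)" if i: "i \<in> B j" for i
  proof -
    obtain x where x: "\<eta> i \<bullet> x = \<kappa> $ i" "\<And>k. k \<noteq> i \<Longrightarrow> \<eta> k \<bullet> x < \<kappa> $ k"
      using facet_only_point[OF fp, of i] by auto
    obtain y where y: "y \<in> W j" "\<forall>w\<in>W j. w \<bullet> y = w \<bullet> x" using part by blast
    then show ?thesis using x i \<eta>_in_W by (intro exI[of _ y]) auto
  qed
  then obtain s where s: "\<And>i. i \<in> B j \<Longrightarrow> s i \<in> W j \<and> \<eta> i \<bullet> s i = \<kappa> $ i \<and> (\<forall>k\<in>B j. k \<noteq> i \<longrightarrow> \<eta> k \<bullet> s i < \<kappa> $ k)"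
    by metis
  have "bounded (halfspace_inter (W j) (B j) \<eta> (($) \<kappa>))"
  proof -
    obtain C where C: "\<And>x. x \<in> polytope_of \<eta> \<kappa> \<Longrightarrow> norm x \<le> C"
      using fp by (auto simp: facet_polytope_def bounded_iff)
    have "norm y \<le> C" if y: "y \<in> halfspace_inter (W j) (B j) \<eta> (($) \<kappa>)" for y
    proof -
      obtain x where x: "\<And>i. \<eta> i \<bullet> x = \<eta> i \<bullet> (if p i = j then y else q)"
        using glue[of "\<lambda>l. if l = j then y else q"] by blast
      have "x \<in> polytope_of \<eta> \<kappa>" using x y q by (auto simp: mem_halfspace_inter B_def less_imp_le)
      have "w \<bullet> (x - y) = 0" if "w \<in> W j" for w
        using that unfolding W_def
      proof (induction rule: span_induct)
        case base then show ?case by (simp add: subspace_def inner_add_left)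
      next
        case (step w) then show ?case using x by (auto simp: B_def inner_diff_right)
      qed
      then have "y \<bullet> y = y \<bullet> x" using y by (simp add: mem_halfspace_inter inner_diff_right)
      then have "norm y * norm y \<le> norm y * norm x"
        by (metis Cauchy_Schwarz_ineq2 abs_ge_self order_trans power2_eq_square power2_norm_eq_inner)
      then have "norm y \<le> norm x" by (cases "y = 0") auto
      then show ?thesis using C[OF \<open>x \<in> polytope_of \<eta> \<kappa>\<close>] by simp
    qed
    then show ?thesis by (auto simp: bounded_iff)
  qed
  moreover have "\<eta> i \<noteq> 0" for i using fp by (auto simp: facet_polytope_def)
  ultimately show ?thesis
    using subspace_W q q' s \<eta>_in_W
    by (intro facet_polytopeI[where q = q' and p = s]) auto
qed

text \<open>As for every simplex, exactly one facet misses a given vertex.\<close>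

lemma active_at_extreme_point:
  assumes j: "j \<in> range p" and v: "v extreme_point_of halfspace_inter (W j) (B j) \<eta> (($) \<kappa>)"
  obtains i where "i \<in> B j" "{k \<in> B j. v \<in> facet (W j) (B j) \<eta> (($) \<kappa>) k} = B j - {i}"
proof -
  let ?J = "{k \<in> B j. v \<in> facet (W j) (B j) \<eta> (($) \<kappa>) k}"
  have "B j \<noteq> {}" using j by (auto simp: B_def)
  then obtain i where i: "i \<in> B j" "i \<notin> ?J"
    using not_all_active[OF facet_polytope_block, of "B j" j v] block_sum[OF j] by auto
  have sp: "span (\<eta> ` ?J) = W j"
    using v \<eta>_in_W subspace_W by (intro active_span_at_extreme_point) auto
  have "k \<in> ?J" if k: "k \<in> B j" "k \<noteq> i" for k
  proof (rule ccontr)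
    assume kJ: "k \<notin> ?J"
    have "\<eta> k \<in> span (\<eta> ` ?J)" using sp \<eta>_in_W k by simp
    then obtain r where r: "\<eta> k = (\<Sum>l\<in>?J. r l *\<^sub>R \<eta> l)" using span_imageE[of ?J] by auto
    define \<beta> where "\<beta> l = (if l = k then - 1 else r l)" for l
    have "(\<Sum>l\<in>insert k ?J. \<beta> l *\<^sub>R \<eta> l) = - \<eta> k + (\<Sum>l\<in>?J. \<beta> l *\<^sub>R \<eta> l)"
      using kJ by (subst sum.insert) (auto simp: \<beta>_def)
    also have "(\<Sum>l\<in>?J. \<beta> l *\<^sub>R \<eta> l) = \<eta> k"
      unfolding r using kJ by (intro sum.cong) (auto simp: \<beta>_def)
    finally have "\<beta> k = 0" using i k by (intro block_relation_zero[of i j "insert k ?J" \<beta> k]) auto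
    then show False by (simp add: \<beta>_def)
  qed
  then have "?J = B j - {i}" using i by blast
  with i(1) show thesis by (rule that)
qed

text \<open>
  The projection onto \<open>W j\<close> along the other summands. It is unique because the conormals span.
  Its adjoint, restricted to \<open>W j\<close>, embeds the \<open>j\<close>-th factor of the product.
\<close>

definition T :: "nat \<Rightarrow> 'a \<Rightarrow> 'a" where
  "T j = (SOME f. linear f \<and> (\<forall>i. f (\<eta> i) = (if p i = j then \<eta> i else 0)))"

lemma T: "linear (T j)" "T j (\<eta> i) = (if p i = j then \<eta> i else 0)"
proof -
  obtain f where "linear f" "\<And>k. k \<in> UNIV \<Longrightarrow> f (\<eta> k) = (if p k = j then \<eta> k else 0)"
  proof (rule linear_extension_of_family[of UNIV \<eta> "\<lambda>k. if p k = j then \<eta> k else 0"])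
    fix \<beta> assume "(\<Sum>k\<in>UNIV. \<beta> k *\<^sub>R \<eta> k) = 0"
    then show "(\<Sum>k\<in>UNIV. \<beta> k *\<^sub>R (if p k = j then \<eta> k else 0)) = 0"
    proof (rule relation_sum_by_blocks)
      fix l assume l: "l \<in> range p"
      have "(\<Sum>k\<in>B l. if p k = j then \<eta> k else 0) = (if l = j then \<Sum>k\<in>B l. \<eta> k else 0)"
        by (auto simp: B_def intro!: sum.cong sum.neutral)
      then show "(\<Sum>k\<in>B l. if p k = j then \<eta> k else 0) = 0" using block_sum[OF l] by auto
    qed
  qed auto
  then have "\<exists>f. linear f \<and> (\<forall>i. f (\<eta> i) = (if p i = j then \<eta> i else 0))" by blast
  from someI_ex[OF this] show "linear (T j)" "T j (\<eta> i) = (if p i = j then \<eta> i else 0)"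
    unfolding T_def by auto
qed

lemma T_in_W: "T j h \<in> W j"
proof -
  have "h \<in> span (range \<eta>)" using conormals_span[OF fp] by simp
  then show ?thesis
  proof (induction rule: span_induct)
    case base
    show ?case using T(1)[of j] subspace_W[of j]
      by (auto simp: subspace_def linear_add linear_scale linear_0)
  next
    case (step h) then show ?case using \<eta>_in_W subspace_W by (auto simp: T(2) B_def subspace_0)
  qed
qed

lemma inner_product_linear:
  assumes "range p = {..<r}"
  shows "\<eta> i \<bullet> product_linear r (\<lambda>j. adjoint (T j)) f = \<eta> i \<bullet> f (p i)"
proof -
  have "\<eta> i \<bullet> product_linear r (\<lambda>j. adjoint (T j)) f = (\<Sum>j<r. T j (\<eta> i) \<bullet> f j)"
    by (simp add: product_linear_def inner_sum_right adjoint_works T(1))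
  also have "\<dots> = (\<Sum>j<r. if j = p i then \<eta> i \<bullet> f j else 0)"
    by (intro sum.cong) (auto simp: T(2))
  also have "\<dots> = \<eta> i \<bullet> f (p i)" using assms by auto
  finally show ?thesis .
qed

lemma product_affine_equivalence_blocks:
  assumes r: "range p = {..<r}"
  shows "product_affine_equivalence r W (\<lambda>j. adjoint (T j)) 0
    (\<lambda>j. halfspace_inter (W j) (B j) \<eta> (($) \<kappa>)) (polytope_of \<eta> \<kappa>)"
proof -
  let ?\<Phi> = "product_linear r (\<lambda>j. adjoint (T j))"
  let ?S = "\<lambda>j. halfspace_inter (W j) (B j) \<eta> (($) \<kappa>)"
  note inner = inner_product_linear[OF r]
  have inj: "inj_on ?\<Phi> (PiE {..<r} W)"
  proof (rule inj_onI)
    fix f g assume fg: "f \<in> PiE {..<r} W" "g \<in> PiE {..<r} W" "?\<Phi> f = ?\<Phi> g"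
    show "f = g"
    proof (rule PiE_ext[OF fg(1,2)])
      fix j assume j: "j \<in> {..<r}"
      show "f j = g j"
      proof (rule separating_W)
        show "f j \<in> W j" "g j \<in> W j" using fg j by auto
        fix i assume "i \<in> B j"
        then show "\<eta> i \<bullet> f j = \<eta> i \<bullet> g j" using inner[of i f] inner[of i g] fg(3) by (simp add: B_def)
      qed
    qed
  qed
  have onto: "\<exists>f\<in>PiE {..<r} W. ?\<Phi> f = x \<and> (\<forall>i. \<eta> i \<bullet> f (p i) = \<eta> i \<bullet> x)" for x
  proof -
    have "\<exists>y\<in>W j. \<forall>w\<in>W j. w \<bullet> y = w \<bullet> x" for j
      using subspace_W by (rule orthogonal_part)
    then obtain y where y: "\<And>j. y j \<in> W j" "\<And>j w. w \<in> W j \<Longrightarrow> w \<bullet> y j = w \<bullet> x" by metis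
    let ?f = "restrict y {..<r}"
    have f: "\<eta> i \<bullet> ?f (p i) = \<eta> i \<bullet> x" for i
    proof -
      have "p i \<in> {..<r}" using r by auto
      moreover have "\<eta> i \<in> W (p i)" by (rule \<eta>_in_W) (simp add: B_def)
      ultimately show ?thesis using y by simp
    qed
    have "?\<Phi> ?f = x" by (rule separating) (simp only: inner f)
    have "?f \<in> PiE {..<r} W" using y(1) by (simp add: restrict_PiE_iff)
    show ?thesis by (intro bexI[of _ ?f] conjI allI) (rule f | fact)+
  qed
  have "?\<Phi> ` PiE {..<r} W = UNIV"
  proof (intro equalityI subset_UNIV subsetI)
    fix x
    obtain f where "f \<in> PiE {..<r} W" "?\<Phi> f = x" using onto by blast
    then show "x \<in> ?\<Phi> ` PiE {..<r} W" by (intro image_eqI[of _ _ f]) auto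
  qed
  moreover have "(\<lambda>f. ?\<Phi> f + 0) ` PiE {..<r} ?S = polytope_of \<eta> \<kappa>"
  proof (intro equalityI subsetI)
    fix x assume "x \<in> (\<lambda>f. ?\<Phi> f + 0) ` PiE {..<r} ?S"
    then obtain f where f: "f \<in> PiE {..<r} ?S" "x = ?\<Phi> f" by auto
    have "\<eta> i \<bullet> x \<le> \<kappa> $ i" for i
    proof -
      have "p i \<in> {..<r}" using r by auto
      then have "f (p i) \<in> ?S (p i)" using f by auto
      then show ?thesis by (simp add: f(2) inner mem_halfspace_inter B_def)
    qed
    then show "x \<in> polytope_of \<eta> \<kappa>" by (simp add: mem_halfspace_inter)
  next
    fix x assume x: "x \<in> polytope_of \<eta> \<kappa>"
    obtain f where f: "f \<in> PiE {..<r} W" "?\<Phi> f = x" "\<And>i. \<eta> i \<bullet> f (p i) = \<eta> i \<bullet> x" using onto by blast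
    have "f j \<in> ?S j" if "j \<in> {..<r}" for j
      using f(1,3) x that by (auto simp: mem_halfspace_inter B_def)
    then have "f \<in> PiE {..<r} ?S" using f(1) by (auto simp: PiE_iff)
    then show "x \<in> (\<lambda>f. ?\<Phi> f + 0) ` PiE {..<r} ?S" using f(2) by force
  qed
  ultimately show ?thesis
    unfolding product_affine_equivalence_def bij_betw_def using adjoint_linear[OF T(1)] inj by blast
qed

text \<open>The lattice of the factor, generated by the conormals of the block.\<close>

definition M :: "nat \<Rightarrow> 'a set" where
  "M j = range (\<lambda>n :: 'i \<Rightarrow> int. \<Sum>k\<in>B j. of_int (n k) *\<^sub>R \<eta> k)"

lemma M_subset_W: "M j \<subseteq> W j"
  unfolding M_def using \<eta>_in_W subspace_W by (auto intro!: subspace_sum subspace_scale)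

lemma lattice_basis_block:
  assumes i: "i \<in> B j"
  shows "lattice_basis (M j) (\<eta> ` (B j - {i}))"
proof -
  have "int_span (\<eta> ` (B j - {i})) = M j"
  proof (intro equalityI subsetI)
    fix h assume "h \<in> int_span (\<eta> ` (B j - {i}))"
    then obtain n :: "'i \<Rightarrow> int" where n: "h = (\<Sum>k\<in>B j - {i}. of_int (n k) *\<^sub>R \<eta> k)"
      by (auto simp: int_span_image in\<eta>)
    have "h = (\<Sum>k\<in>B j. of_int (if k = i then 0 else n k) *\<^sub>R \<eta> k)"
      unfolding n by (rule sum.mono_neutral_cong_left) auto
    then show "h \<in> M j"
      using rangeI[of "\<lambda>n :: 'i \<Rightarrow> int. \<Sum>k\<in>B j. of_int (n k) *\<^sub>R \<eta> k" "\<lambda>k. if k = i then 0 else n k"]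
      by (simp add: M_def)
  next
    fix h assume "h \<in> M j"
    then obtain n :: "'i \<Rightarrow> int" where n: "h = (\<Sum>k\<in>B j. of_int (n k) *\<^sub>R \<eta> k)" by (auto simp: M_def)
    have "j \<in> range p" using i by (auto simp: B_def)
    then have "h = (\<Sum>k\<in>B j. of_int (n k) *\<^sub>R \<eta> k) - of_int (n i) *\<^sub>R (\<Sum>k\<in>B j. \<eta> k)"
      using n block_sum by simp
    also have "\<dots> = (\<Sum>k\<in>B j. of_int (n k - n i) *\<^sub>R \<eta> k)"
      by (simp add: scaleR_sum_right sum_subtractf scaleR_diff_left)
    also have "\<dots> = (\<Sum>k\<in>B j - {i}. of_int (n k - n i) *\<^sub>R \<eta> k)"
      using i by (intro sum.mono_neutral_cong_right) auto
    finally have h: "h = (\<Sum>k\<in>B j - {i}. of_int (n k - n i) *\<^sub>R \<eta> k)" .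
    then show "h \<in> int_span (\<eta> ` (B j - {i}))"
      unfolding int_span_image[OF finite in\<eta>] by (intro CollectI exI[of _ "\<lambda>k. n k - n i"]) simp
  qed
  then show ?thesis using independent_block_remove[OF i] by (simp add: lattice_basis_def)
qed

lemma smooth_polytope_block:
  assumes sm: "smooth_polytope UNIV L UNIV \<eta> (($) \<kappa>)" and j: "j \<in> range p"
  shows "smooth_polytope (W j) (M j) (B j) \<eta> (($) \<kappa>)"
proof -
  let ?P = "halfspace_inter (W j) (B j) \<eta> (($) \<kappa>)"
  obtain i where i: "i \<in> B j" using j by (auto simp: B_def)
  have "integer_lattice (W j) (M j)"
    unfolding integer_lattice_def using lattice_basis_block[OF i] independent_block_remove[OF i] by blast
  moreover have "simple_polytope (W j) (B j) \<eta> (($) \<kappa>)"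
    unfolding simple_polytope_def
  proof (intro conjI allI impI facet_polytope_block)
    fix v assume "v extreme_point_of ?P"
    then obtain l where l: "l \<in> B j" "{k \<in> B j. v \<in> facet (W j) (B j) \<eta> (($) \<kappa>) k} = B j - {l}"
      by (rule active_at_extreme_point[OF j])
    then show "card {k \<in> B j. v \<in> facet (W j) (B j) \<eta> (($) \<kappa>) k} = dim (W j)"
      using independent_block_remove(3)[OF l(1)] by simp
  qed
  moreover have "primitive_vector (M j) (\<eta> k)" if k: "k \<in> B j" for k
  proof -
    have prim: "primitive_vector L (\<eta> k)" using sm by (simp add: smooth_polytope_def)
    have "M j \<subseteq> L"
    proof
      fix h assume "h \<in> M j"
      then obtain n :: "'i \<Rightarrow> int" where n: "h = (\<Sum>k\<in>B j. of_int (n k) *\<^sub>R \<eta> k)" by (auto simp: M_def)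
      have "h = (\<Sum>k\<in>UNIV. of_int (if k \<in> B j then n k else 0) *\<^sub>R \<eta> k)"
        unfolding n by (rule sum.mono_neutral_cong_left) auto
      then show "h \<in> L"
        using smooth_lattice[OF sm]
          rangeI[of "\<lambda>n :: 'i \<Rightarrow> int. \<Sum>k\<in>UNIV. of_int (n k) *\<^sub>R \<eta> k" "\<lambda>k. if k \<in> B j then n k else 0"]
        by simp
    qed
    moreover have "\<eta> k \<in> M j"
    proof -
      have "\<eta> k = (\<Sum>l\<in>B j. if l = k then \<eta> l else 0)" using k by simp
      also have "\<dots> = (\<Sum>l\<in>B j. of_int (if l = k then 1 else 0) *\<^sub>R \<eta> l)" by (rule sum.cong) auto
      finally show ?thesis
        using rangeI[of "\<lambda>n :: 'i \<Rightarrow> int. \<Sum>k\<in>B j. of_int (n k) *\<^sub>R \<eta> k" "\<lambda>l. if l = k then 1 else 0"]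
        by (simp add: M_def)
    qed
    ultimately show ?thesis using prim unfolding primitive_vector_def by blast
  qed
  moreover have "lattice_basis (M j) (\<eta> ` {k \<in> B j. v \<in> facet (W j) (B j) \<eta> (($) \<kappa>) k})"
    if v: "v extreme_point_of ?P" for v
  proof -
    obtain l where l: "l \<in> B j" "{k \<in> B j. v \<in> facet (W j) (B j) \<eta> (($) \<kappa>) k} = B j - {l}"
      using v by (rule active_at_extreme_point[OF j])
    then show ?thesis using lattice_basis_block[OF l(1)] by simp
  qed
  ultimately show ?thesis by (simp add: smooth_polytope_def)
qed

lemma product_lattice_preserving_blocks:
  assumes sm: "smooth_polytope UNIV L UNIV \<eta> (($) \<kappa>)" and r: "range p = {..<r}"
  shows "product_lattice_preserving r W (\<lambda>j. adjoint (T j)) M L"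
proof -
  let ?\<Phi> = "product_linear r (\<lambda>j. adjoint (T j))"
  have dual: "h \<bullet> ?\<Phi> f = (\<Sum>j<r. T j h \<bullet> f j)" for h f
    by (simp add: product_linear_def inner_sum_right adjoint_works T(1))
  have T_sum: "T j (\<Sum>k\<in>UNIV. of_int (n k) *\<^sub>R \<eta> k) = (\<Sum>k\<in>B j. of_int (n k) *\<^sub>R \<eta> k)" for j and n :: "'i \<Rightarrow> int"
  proof -
    have "T j (\<Sum>k\<in>UNIV. of_int (n k) *\<^sub>R \<eta> k) = (\<Sum>k\<in>UNIV. of_int (n k) *\<^sub>R (if p k = j then \<eta> k else 0))"
      using T(1)[of j] by (simp add: linear_sum linear_scale T(2))
    also have "\<dots> = (\<Sum>k\<in>B j. of_int (n k) *\<^sub>R \<eta> k)"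
      by (rule sum.mono_neutral_cong_right) (auto simp: B_def)
    finally show ?thesis .
  qed
  have "{w \<in> PiE {..<r} W. \<exists>h\<in>L. \<forall>f \<in> PiE {..<r} W. (\<Sum>j<r. w j \<bullet> f j) = h \<bullet> ?\<Phi> f} = PiE {..<r} M"
  proof (intro equalityI subsetI)
    fix w assume "w \<in> {w \<in> PiE {..<r} W. \<exists>h\<in>L. \<forall>f \<in> PiE {..<r} W. (\<Sum>j<r. w j \<bullet> f j) = h \<bullet> ?\<Phi> f}"
    then obtain h where w: "w \<in> PiE {..<r} W" and h: "h \<in> L"
      and eq: "\<And>f. f \<in> PiE {..<r} W \<Longrightarrow> (\<Sum>j<r. w j \<bullet> f j) = h \<bullet> ?\<Phi> f" by blast
    obtain n :: "'i \<Rightarrow> int" where n: "h = (\<Sum>k\<in>UNIV. of_int (n k) *\<^sub>R \<eta> k)" using h smooth_lattice[OF sm] by auto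
    have "w j \<in> M j" if j: "j \<in> {..<r}" for j
    proof -
      define d where "d = w j - T j h"
      have dW: "d \<in> W j" unfolding d_def using w j T_in_W subspace_W by (intro subspace_diff) auto
      let ?f = "restrict (\<lambda>l. if l = j then d else 0) {..<r}"
      have "?f \<in> PiE {..<r} W" using dW subspace_W by (auto simp: subspace_0)
      from eq[OF this] have "(\<Sum>l<r. w l \<bullet> ?f l) = (\<Sum>l<r. T l h \<bullet> ?f l)" by (simp only: dual)
      moreover have "(\<Sum>l<r. g l \<bullet> ?f l) = g j \<bullet> d" for g :: "nat \<Rightarrow> 'a"
      proof -
        have "(\<Sum>l<r. g l \<bullet> ?f l) = (\<Sum>l<r. if l = j then g l \<bullet> d else 0)" by (rule sum.cong) auto
        then show ?thesis using j by simp
      qed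
      ultimately have "w j \<bullet> d = T j h \<bullet> d" by simp
      then have "d \<bullet> d = 0" by (simp add: d_def inner_diff_left)
      then have "w j = T j h" by (simp add: d_def)
      then show ?thesis unfolding n T_sum M_def by simp
    qed
    then show "w \<in> PiE {..<r} M" using w by (auto simp: PiE_iff)
  next
    fix w assume w: "w \<in> PiE {..<r} M"
    then have "\<exists>n :: 'i \<Rightarrow> int. w j = (\<Sum>k\<in>B j. of_int (n k) *\<^sub>R \<eta> k)" if "j \<in> {..<r}" for j
      using that by (auto simp: PiE_iff M_def)
    then obtain n :: "nat \<Rightarrow> 'i \<Rightarrow> int" where n: "\<And>j. j \<in> {..<r} \<Longrightarrow> w j = (\<Sum>k\<in>B j. of_int (n j k) *\<^sub>R \<eta> k)"
      by metis
    define h where "h = (\<Sum>k\<in>UNIV. of_int (n (p k) k) *\<^sub>R \<eta> k)"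
    have "h \<in> L" using smooth_lattice[OF sm]
        rangeI[of "\<lambda>n :: 'i \<Rightarrow> int. \<Sum>k\<in>UNIV. of_int (n k) *\<^sub>R \<eta> k" "\<lambda>k. n (p k) k"]
      by (simp add: h_def)
    moreover have "T j h = w j" if "j \<in> {..<r}" for j
      unfolding h_def T_sum n[OF that] by (rule sum.cong) (auto simp: B_def)
    then have "(\<Sum>j<r. w j \<bullet> f j) = h \<bullet> ?\<Phi> f" for f unfolding dual by (intro sum.cong) auto
    moreover have "w \<in> PiE {..<r} W" using w M_subset_W by (auto simp: PiE_iff)
    ultimately show "w \<in> {w \<in> PiE {..<r} W. \<exists>h\<in>L. \<forall>f \<in> PiE {..<r} W. (\<Sum>j<r. w j \<bullet> f j) = h \<bullet> ?\<Phi> f}"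
      by blast
  qed
  then show ?thesis by (simp add: product_lattice_preserving_def)
qed

lemma card_block: "j \<in> range p \<Longrightarrow> card (B j) = dim (W j) + 1"
proof -
  assume "j \<in> range p"
  then obtain i where "i \<in> B j" by (auto simp: B_def)
  then show ?thesis using independent_block_remove(3)[of i j] card_gt_0_iff[of "B j"] by auto
qed

end

lemma product_if_blocks:
  fixes \<eta> :: "'i::finite \<Rightarrow> 'a::euclidean_space" and p0 :: "'i \<Rightarrow> 'b"
  assumes ss: "simple_or_smooth_polytope \<Lambda> \<eta> \<kappa>" and bl0: "simplex_blocks \<eta> (\<lambda>_. 1) p0"
  shows "product_of_simplices \<Lambda> (polytope_of \<eta> \<kappa>)"
proof -
  \<comment> \<open>number the blocks by \<open>0, \<dots>, r - 1\<close>\<close>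
  obtain h :: "'b \<Rightarrow> nat" where h: "bij_betw h (range p0) {0..<card (range p0)}"
    using ex_bij_betw_finite_nat[of "range p0"] by auto
  define r where "r = card (range p0)"
  define p where "p = h \<circ> p0"
  have "p i = p j \<longleftrightarrow> p0 i = p0 j" for i j
    using h by (auto simp: p_def bij_betw_def inj_on_eq_iff)
  then have bl: "simplex_blocks \<eta> (\<lambda>_. 1) p" using bl0 by (simp add: simplex_blocks_def)
  have "range p = h ` range p0" by (simp add: p_def image_comp)
  then have r: "range p = {..<r}" using h by (simp add: r_def bij_betw_def atLeast0LessThan)
  interpret simplex_block_polytope \<eta> \<kappa> p
    using simple_or_smooth_facet_polytope[OF ss] bl by unfold_locales
  obtain f :: "'i \<Rightarrow> nat" where f: "inj f" using finite_imp_inj_to_nat_seg[of "UNIV :: 'i set"] by auto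
  define g where "g = the_inv_into UNIV f"
  have fg: "\<forall>i\<in>B j. g (f i) = i" for j using f by (simp add: g_def the_inv_into_f_f)
  have card: "card (f ` B j) = card (B j)" for j using f by (intro card_image) (rule inj_on_subset, auto)
  let ?S = "\<lambda>j. halfspace_inter (W j) (B j) \<eta> (($) \<kappa>)"
  have reindex: "?S j = halfspace_inter (W j) (f ` B j) (\<lambda>k. \<eta> (g k)) (\<lambda>k. \<kappa> $ g k)" for j
    using halfspace_inter_reindex[where g = g and f = f and V = "W j" and \<eta> = \<eta> and \<kappa> = "($) \<kappa>", OF fg] by simp
  show ?thesis
  proof (cases \<Lambda>)
    case None
    have "simplex_in (W j) (?S j)" if "j < r" for j
      unfolding simplex_in_def
      using facet_polytope_reindex[where g = g and f = f, OF fg facet_polytope_block, of j] card_block[of j] that r card[of j] reindex[of j]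
      by (intro exI[of _ "f ` B j"] exI[of _ "\<lambda>k. \<eta> (g k)"] exI[of _ "\<lambda>k. \<kappa> $ g k"]) auto
    then show ?thesis unfolding product_of_simplices_def None option.case
      using product_affine_equivalence_blocks[OF r]
      by (intro exI[of _ r] exI[of _ W] exI[of _ ?S] exI[of _ "\<lambda>j. adjoint (T j)"] exI[of _ 0]) simp
  next
    case (Some L)
    have sm: "smooth_polytope UNIV L UNIV \<eta> (($) \<kappa>)" using ss Some by (simp add: simple_or_smooth_polytope_def)
    have "smooth_simplex_in (W j) (M j) (?S j)" if "j < r" for j
      unfolding smooth_simplex_in_def
      using smooth_polytope_reindex[where g = g and f = f, OF fg smooth_polytope_block[OF sm], of j] card_block[of j] that r card[of j] reindex[of j]
      by (intro exI[of _ "f ` B j"] exI[of _ "\<lambda>k. \<eta> (g k)"] exI[of _ "\<lambda>k. \<kappa> $ g k"]) auto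
    then show ?thesis unfolding product_of_simplices_def Some option.case
      using product_affine_equivalence_blocks[OF r] product_lattice_preserving_blocks[OF sm r]
      by (intro exI[of _ r] exI[of _ W] exI[of _ ?S] exI[of _ "\<lambda>j. adjoint (T j)"] exI[of _ 0] exI[of _ M]) simp
  qed
qed

lemma blocks_if_product:
  fixes \<eta> :: "'i::finite \<Rightarrow> 'a::euclidean_space"
  assumes ss: "simple_or_smooth_polytope \<Lambda> \<eta> \<kappa>" and prod: "product_of_simplices \<Lambda> (polytope_of \<eta> \<kappa>)"
  shows "\<exists>p :: 'i \<Rightarrow> nat. simplex_blocks \<eta> (\<lambda>_. 1) p"
proof -
  have "\<exists>r V S A b. (\<forall>j<r. simplex_in (V j) (S j)) \<and> product_affine_equivalence r V A b S (polytope_of \<eta> \<kappa>)"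
  proof (cases \<Lambda>)
    case None then show ?thesis using prod by (simp add: product_of_simplices_def)
  next
    case (Some L)
    have "simplex_in V S" if "smooth_simplex_in V M S" for V M S :: "'a set"
      using that unfolding smooth_simplex_in_def simplex_in_def smooth_polytope_def simple_polytope_def by blast
    then show ?thesis using prod Some unfolding product_of_simplices_def by simp blast
  qed
  then obtain r V S A b where "\<forall>j<r. simplex_in (V j) (S j)" "product_affine_equivalence r V A b S (polytope_of \<eta> \<kappa>)"
    by blast
  then obtain \<mu> and p :: "'i \<Rightarrow> nat" where "simplex_blocks \<eta> \<mu> p"
    using blocks_if_product_of_simplices[OF simple_or_smooth_facet_polytope[OF ss]] by blast
  then show ?thesis using blocks_normalized[OF ss] by blast
qed

section \<open>The center of mass\<close>

lemma nn_integral_lborel_translate: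
  fixes g :: "'a::euclidean_space \<Rightarrow> ennreal"
  assumes [measurable]: "g \<in> borel_measurable borel"
  shows "(\<integral>\<^sup>+x. g (c + x) \<partial>lborel) = (\<integral>\<^sup>+x. g x \<partial>lborel)"
proof -
  have "(\<integral>\<^sup>+x. g x \<partial>distr lborel borel ((+) c)) = (\<integral>\<^sup>+x. g (c + x) \<partial>lborel)"
    by (rule nn_integral_distr) auto
  then show ?thesis by (simp add: lborel_distr_plus)
qed

text \<open>
  A linear bijection scales Lebesgue measure by a constant: this is uniqueness of the translation
  invariant measure, by Fubini's theorem applied to \<open>f x * g (A y + x)\<close> with a fixed even \<open>f\<close>.
\<close>

lemma nn_integral_linear_exchange:
  fixes A :: "'a::euclidean_space \<Rightarrow> 'a" and f g :: "'a \<Rightarrow> ennreal"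
  assumes A: "linear A" "surj A" and [measurable]: "f \<in> borel_measurable borel" "g \<in> borel_measurable borel"
    and even: "\<And>x. f (- x) = f x"
  shows "(\<integral>\<^sup>+x. f x \<partial>lborel) * (\<integral>\<^sup>+y. g (A y) \<partial>lborel) = (\<integral>\<^sup>+y. f (A y) \<partial>lborel) * (\<integral>\<^sup>+x. g x \<partial>lborel)"
proof -
  have [measurable]: "A \<in> borel_measurable borel"
    using A(1) by (intro borel_measurable_continuous_onI linear_continuous_on) (simp add: linear_conv_bounded_linear)
  have shift: "(\<integral>\<^sup>+y. h (A y + x) \<partial>lborel) = (\<integral>\<^sup>+y. h (A y) \<partial>lborel)"
    if [measurable]: "h \<in> borel_measurable borel" for h :: "'a \<Rightarrow> ennreal" and x
  proof -
    obtain z where z: "x = A z" using A(2) by (metis surjD)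
    have "(\<integral>\<^sup>+y. h (A y + x) \<partial>lborel) = (\<integral>\<^sup>+y. h (A (z + y)) \<partial>lborel)"
      using A(1) by (simp add: z linear_add add.commute)
    also have "\<dots> = (\<integral>\<^sup>+y. h (A y) \<partial>lborel)"
      by (rule nn_integral_lborel_translate) measurable
    finally show ?thesis .
  qed
  have "(\<integral>\<^sup>+x. f x \<partial>lborel) * (\<integral>\<^sup>+y. g (A y) \<partial>lborel) = (\<integral>\<^sup>+x. f x * (\<integral>\<^sup>+y. g (A y + x) \<partial>lborel) \<partial>lborel)"
    by (subst nn_integral_multc[symmetric]) (simp_all add: shift)
  also have "\<dots> = (\<integral>\<^sup>+x. \<integral>\<^sup>+y. f x * g (A y + x) \<partial>lborel \<partial>lborel)"
    by (intro nn_integral_cong nn_integral_cmult[symmetric]) measurable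
  also have "\<dots> = (\<integral>\<^sup>+y. \<integral>\<^sup>+x. f x * g (A y + x) \<partial>lborel \<partial>lborel)"
    by (rule lborel_pair.Fubini') measurable
  also have "\<dots> = (\<integral>\<^sup>+y. \<integral>\<^sup>+x. f (- A y + x) * g x \<partial>lborel \<partial>lborel)"
  proof (rule nn_integral_cong)
    fix y
    have "(\<integral>\<^sup>+x. f (- A y + (A y + x)) * g (A y + x) \<partial>lborel) = (\<integral>\<^sup>+x. f (- A y + x) * g x \<partial>lborel)"
      by (rule nn_integral_lborel_translate[where g = "\<lambda>x. f (- A y + x) * g x"]) measurable
    then show "(\<integral>\<^sup>+x. f x * g (A y + x) \<partial>lborel) = (\<integral>\<^sup>+x. f (- A y + x) * g x \<partial>lborel)" by simp
  qed
  also have "\<dots> = (\<integral>\<^sup>+x. \<integral>\<^sup>+y. f (- A y + x) * g x \<partial>lborel \<partial>lborel)"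
    by (rule lborel_pair.Fubini'[symmetric]) measurable
  also have "\<dots> = (\<integral>\<^sup>+x. (\<integral>\<^sup>+y. f (A y + - x) \<partial>lborel) * g x \<partial>lborel)"
  proof (rule nn_integral_cong)
    fix x
    have "f (- A y + x) = f (A y + - x)" for y using even[of "A y - x"] by simp
    then show "(\<integral>\<^sup>+y. f (- A y + x) * g x \<partial>lborel) = (\<integral>\<^sup>+y. f (A y + - x) \<partial>lborel) * g x"
      by (simp add: nn_integral_multc)
  qed
  also have "\<dots> = (\<integral>\<^sup>+y. f (A y) \<partial>lborel) * (\<integral>\<^sup>+x. g x \<partial>lborel)"
    by (simp add: shift nn_integral_cmult del: add_uminus_conv_diff)
  finally show ?thesis .
qed

lemma emeasure_ball_pos: "r > 0 \<Longrightarrow> emeasure lborel (ball (c::'a::euclidean_space) r) > 0"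
  using content_ball_pos[of r c] by (simp add: measure_def enn2real_positive_iff)

lemma lborel_distr_linear:
  fixes A :: "'a::euclidean_space \<Rightarrow> 'a"
  assumes A: "linear A" "surj A"
  obtains C :: real where "C > 0" "distr lborel borel A = density lborel (\<lambda>_. ennreal C)"
proof -
  have [measurable]: "A \<in> borel_measurable borel"
    using A(1) by (intro borel_measurable_continuous_onI linear_continuous_on) (simp add: linear_conv_bounded_linear)
  let ?D = "ball (0::'a) 1"
  define a where "a = emeasure lborel ?D"
  have a: "a \<noteq> 0" "a \<noteq> \<infinity>"
    using emeasure_ball_pos[of 1 "0::'a"] emeasure_lborel_ball_finite[of "0::'a" 1] by (auto simp: a_def)
  have inj: "inj A" using A by (metis linear_surjective_imp_injective)
  define c where "c = emeasure lborel (A -` ?D)"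
  have "open (A -` ?D)"
    using A(1) by (intro open_vimage linear_continuous_on) (auto simp: linear_conv_bounded_linear)
  moreover have "0 \<in> A -` ?D" using A(1) by (simp add: linear_0)
  ultimately obtain r where r: "r > 0" "ball 0 r \<subseteq> A -` ?D" by (meson open_contains_ball)
  have sets: "A -` ?D \<in> sets borel" using \<open>open (A -` ?D)\<close> by simp
  have "emeasure lborel (ball (0::'a) r) \<le> c" unfolding c_def using r sets by (intro emeasure_mono) auto
  then have c0: "c \<noteq> 0" using emeasure_ball_pos[OF r(1), of "0::'a"] by auto
  have "bounded (A -` ?D)"
  proof -
    obtain B where B: "B > 0" "\<And>x. B * norm x \<le> norm (A x)"
      using linear_inj_bounded_below_pos[OF A(1) inj] by metis
    have "norm x \<le> 1 / B" if "x \<in> A -` ?D" for x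
    proof -
      have "B * norm x \<le> 1" using B(2)[of x] that by simp
      then show ?thesis using B(1) by (simp add: field_simps)
    qed
    then show ?thesis unfolding bounded_iff by blast
  qed
  then have c1: "c \<noteq> \<infinity>" using emeasure_bounded_finite[of "A -` ?D"] by (auto simp: c_def)
  have key: "a * (\<integral>\<^sup>+y. g (A y) \<partial>lborel) = c * (\<integral>\<^sup>+x. g x \<partial>lborel)" if [measurable]: "g \<in> borel_measurable borel" for g
  proof -
    have 1: "(\<integral>\<^sup>+x. indicator ?D x \<partial>lborel) = a" by (simp add: a_def)
    have "(\<integral>\<^sup>+y. indicator ?D (A y) \<partial>lborel) = (\<integral>\<^sup>+y. indicator (A -` ?D) y \<partial>lborel)"
      by (rule nn_integral_cong) (simp add: indicator_def)
    also have "\<dots> = c" using sets by (simp add: c_def)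
    finally have 2: "(\<integral>\<^sup>+y. indicator ?D (A y) \<partial>lborel) = c" .
    show ?thesis
      using nn_integral_linear_exchange[OF A borel_measurable_indicator[of ?D borel] that] unfolding 1 2
      by (simp add: indicator_def)
  qed
  define C where "C = enn2real (c / a)"
  have ca: "c / a = ennreal C" "C > 0"
  proof -
    have "c / a \<noteq> \<infinity>" using a c1 by (simp add: ennreal_divide_eq_top_iff)
    moreover have "c / a \<noteq> 0" using a c0 by (simp add: ennreal_divide_eq_0_iff)
    ultimately show "c / a = ennreal C" "C > 0"
      by (auto simp: C_def enn2real_positive_iff less_top zero_less_iff_neq_zero)
  qed
  have "distr lborel borel A = density lborel (\<lambda>_. ennreal C)"
  proof (rule measure_eqI)
    fix X assume "X \<in> sets (distr lborel borel A)"
    then have X [measurable]: "X \<in> sets borel" by simp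
    have "a * emeasure (distr lborel borel A) X = a * (\<integral>\<^sup>+y. indicator X (A y) \<partial>lborel)"
    proof -
      have "emeasure (distr lborel borel A) X = (\<integral>\<^sup>+x. indicator X x \<partial>distr lborel borel A)" by simp
      also have "\<dots> = (\<integral>\<^sup>+y. indicator X (A y) \<partial>lborel)" by (rule nn_integral_distr) auto
      finally show ?thesis by simp
    qed
    also have "\<dots> = c * emeasure lborel X" using key[of "indicator X"] by simp
    also have "\<dots> = a * (c / a * emeasure lborel X)"
    proof -
      have "a * (c / a) = c * a / a" by (simp add: ennreal_times_divide mult.commute)
      also have "\<dots> = c" using a by (intro ennreal_mult_divide_eq) auto
      finally show ?thesis by (simp add: mult.assoc[symmetric])
    qed
    finally have "emeasure (distr lborel borel A) X = c / a * emeasure lborel X"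
      using a by (simp add: ennreal_mult_cancel_left)
    then show "emeasure (distr lborel borel A) X = emeasure (density lborel (\<lambda>_. ennreal C)) X"
      by (simp add: emeasure_density_const ca(1))
  qed simp
  with ca(2) show thesis by (rule that)
qed

text \<open>The last two parts differ in type only: \<open>C\<close> is the same for vector valued and for real integrands.\<close>

lemma integral_affine_bijection:
  fixes A :: "'a::euclidean_space \<Rightarrow> 'a"
  assumes A: "linear A" "surj A"
  obtains C :: real where "C > 0"
    "\<And>h :: 'a \<Rightarrow> 'b::{banach, second_countable_topology}. h \<in> borel_measurable borel \<Longrightarrow>
       (LINT y|lborel. h (A y + b)) = C *\<^sub>R (LINT x|lborel. h x)"
    "\<And>h :: 'a \<Rightarrow> real. h \<in> borel_measurable borel \<Longrightarrow>
       (LINT y|lborel. h (A y + b)) = C *\<^sub>R (LINT x|lborel. h x)"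
proof -
  obtain C where C: "C > 0" "distr lborel borel A = density lborel (\<lambda>_. ennreal C)"
    using lborel_distr_linear[OF A] .
  have mA [measurable]: "A \<in> borel_measurable borel"
    using A(1) by (intro borel_measurable_continuous_onI linear_continuous_on) (simp add: linear_conv_bounded_linear)
  have "(LINT y|lborel. h (A y + b)) = C *\<^sub>R (LINT x|lborel. h x)"
    if [measurable]: "h \<in> borel_measurable borel" for h :: "'a \<Rightarrow> 'z::{banach, second_countable_topology}"
  proof -
    have "(LINT y|lborel. h (A y + b)) = (LINT x|distr lborel borel A. h (x + b))"
      by (rule integral_distr[symmetric]) auto
    also have "\<dots> = C *\<^sub>R (LINT x|lborel. h (b + x))"
      unfolding C(2) using C(1) by (subst integral_density) (auto simp: add.commute)
    also have "(LINT x|lborel. h (b + x)) = (LINT x|distr lborel borel ((+) b). h x)"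
      by (rule integral_distr[symmetric]) auto
    also have "\<dots> = (LINT x|lborel. h x)" by (simp add: lborel_distr_plus)
    finally show ?thesis .
  qed
  note * = this
  show thesis by (rule that[OF C(1)]) (rule *, assumption)+
qed

lemma center_of_mass_affine_image:
  fixes A :: "'a::euclidean_space \<Rightarrow> 'a"
  assumes A: "linear A" "surj A" and S: "compact S" "measure lborel S > 0"
  shows "center_of_mass ((\<lambda>x. A x + b) ` S) = A (center_of_mass S) + b"
proof -
  let ?a = "\<lambda>x. A x + b"
  have blA: "bounded_linear A" using A(1) by (simp add: linear_conv_bounded_linear)
  have "inj A" using A by (metis linear_surjective_imp_injective)
  then have inja: "inj ?a" by (simp add: inj_def)
  have cont: "continuous_on X ?a" for X using blA by (intro continuous_intros linear_continuous_on)
  have caS: "compact (?a ` S)" using S(1) cont by (rule compact_continuous_image[rotated])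
  have meas [measurable]: "S \<in> sets borel" "?a ` S \<in> sets borel" using S(1) caS by (auto intro: borel_compact)
  obtain C where C: "C > 0"
    "\<And>h :: 'a \<Rightarrow> 'a. h \<in> borel_measurable borel \<Longrightarrow> (LINT y|lborel. h (A y + b)) = C *\<^sub>R (LINT x|lborel. h x)"
    "\<And>h :: 'a \<Rightarrow> real. h \<in> borel_measurable borel \<Longrightarrow> (LINT y|lborel. h (A y + b)) = C *\<^sub>R (LINT x|lborel. h x)"
    by (rule integral_affine_bijection[OF A, where b = b and ?'b = 'a]) (rule that, assumption+)
  have ind: "indicator (?a ` S) (A y + b) = (indicator S y :: real)" for y
    using inj_image_mem_iff[OF inja, of y S] by (simp only: indicator_def)
  have vol: "measure lborel S = C * measure lborel (?a ` S)"
    using C(3)[of "indicator (?a ` S)"] by (simp add: ind)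
  have int: "integrable lborel (\<lambda>x. indicator S x *\<^sub>R (x::'a))" "integrable lborel (\<lambda>x. indicator S x *\<^sub>R b)"
    using S(1) by (auto intro!: borel_integrable_compact continuous_intros)
  have "C *\<^sub>R (LINT x:?a ` S|lborel. x) = (LINT y|lborel. indicator S y *\<^sub>R (A y + b))"
    unfolding set_lebesgue_integral_def using C(2)[of "\<lambda>x. indicator (?a ` S) x *\<^sub>R x"] by (simp add: ind)
  also have "\<dots> = (LINT y|lborel. A (indicator S y *\<^sub>R y) + indicator S y *\<^sub>R b)"
    using A(1) by (simp add: linear_scale scaleR_add_right)
  also have "\<dots> = A (LINT y|lborel. indicator S y *\<^sub>R y) + (LINT y|lborel. indicator S y *\<^sub>R b)"
    using integrable_bounded_linear[OF blA int(1)] int(2)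
    by (simp only: Bochner_Integration.integral_add integral_bounded_linear[OF blA int(1)])
  also have "(LINT y|lborel. indicator S y *\<^sub>R b) = measure lborel S *\<^sub>R b"
  proof -
    have "integrable lborel (indicator S :: 'a \<Rightarrow> real)"
      using borel_integrable_compact[OF S(1), of "\<lambda>_. 1::real"] by simp
    then show ?thesis by (subst integral_scaleR_left) auto
  qed
  finally have M: "C *\<^sub>R (LINT x:?a ` S|lborel. x) = A (LINT x:S|lborel. x) + measure lborel S *\<^sub>R b"
    by (simp add: set_lebesgue_integral_def)
  have "measure lborel (?a ` S) > 0" using vol S(2) C(1) by (simp add: zero_less_mult_iff)
  have "center_of_mass (?a ` S) = (1 / (C * measure lborel (?a ` S))) *\<^sub>R (C *\<^sub>R (LINT x:?a ` S|lborel. x))"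
    using C(1) by (simp add: center_of_mass_def divide_simps)
  also have "\<dots> = (1 / measure lborel S) *\<^sub>R (A (LINT x:S|lborel. x) + measure lborel S *\<^sub>R b)"
    unfolding M vol ..
  also have "\<dots> = A (center_of_mass S) + b"
    using A(1) S(2) by (simp add: center_of_mass_def linear_scale scaleR_add_right divide_simps)
  finally show ?thesis .
qed

lemma compact_polytope:
  assumes fp: "facet_polytope V I \<eta> \<kappa>"
  shows "compact (halfspace_inter V I \<eta> \<kappa>)"
  using fp by (simp add: facet_polytope_def closed_halfspace_inter compact_eq_bounded_closed)

lemma measure_less_if_open_between:
  fixes S T :: "'a::euclidean_space set"
  assumes "compact S" "compact T" "S \<subseteq> T" "open U" "U \<noteq> {}" "U \<subseteq> T - S"
  shows "measure lborel S < measure lborel T"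
proof -
  have fin: "X \<in> fmeasurable lborel" if "compact X" for X :: "'a set"
    using that emeasure_compact_finite[of X] by (intro fmeasurableI) (auto intro: borel_compact)
  obtain c r where r: "r > 0" "ball c r \<subseteq> U" using assms(4,5) by (meson ex_in_conv open_contains_ball)
  have TS: "T - S \<in> fmeasurable lborel" using fin assms by (intro fmeasurable.Diff) auto
  have "0 < measure lborel (ball c r)" using content_ball_pos[OF r(1)] by simp
  also have "\<dots> \<le> measure lborel (T - S)"
    using r assms(6) TS by (intro measure_mono_fmeasurable) auto
  also have "\<dots> = measure lborel T - measure lborel S"
    using fin assms by (intro measurable_measure_Diff) (auto intro: borel_compact)
  finally show ?thesis by simp
qed

lemma polytope_measure_pos:
  fixes \<eta> :: "'i \<Rightarrow> 'a::euclidean_space"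
  assumes fp: "facet_polytope UNIV I \<eta> \<kappa>"
  shows "measure lborel (halfspace_inter UNIV I \<eta> \<kappa>) > 0"
proof -
  let ?U = "{x. \<forall>i\<in>I. \<eta> i \<bullet> x < \<kappa> i}"
  obtain q where "\<And>i. i \<in> I \<Longrightarrow> \<eta> i \<bullet> q < \<kappa> i" using strict_interior_point[OF fp] by metis
  then have "q \<in> ?U" by simp
  moreover have "open ?U" using fp by (intro strict_neighbourhood) (simp add: facet_polytope_def)
  moreover have "?U \<subseteq> halfspace_inter UNIV I \<eta> \<kappa> - {}" by (auto simp: mem_halfspace_inter less_imp_le)
  ultimately have "measure lborel ({} :: 'a set) < measure lborel (halfspace_inter UNIV I \<eta> \<kappa>)"
    using compact_polytope[OF fp] by (intro measure_less_if_open_between[of _ _ ?U]) auto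
  then show ?thesis by simp
qed

lemma inner_first_moment:
  fixes S :: "'a::euclidean_space set"
  assumes "compact S"
  shows "integrable lborel (\<lambda>x. indicator S x * (e \<bullet> x))"
    "e \<bullet> (LINT x:S|lborel. x) = (LINT x|lborel. indicator S x * (e \<bullet> x))"
proof -
  have int: "integrable lborel (\<lambda>x. indicator S x *\<^sub>R (x::'a))"
    using assms by (intro borel_integrable_compact) (auto intro: continuous_intros)
  have 1: "e \<bullet> (indicator S x *\<^sub>R x) = indicator S x * (e \<bullet> x)" for x by simp
  show "integrable lborel (\<lambda>x. indicator S x * (e \<bullet> x))"
    unfolding 1[symmetric] using int by (rule integrable_inner_right)
  show "e \<bullet> (LINT x:S|lborel. x) = (LINT x|lborel. indicator S x * (e \<bullet> x))"
    unfolding set_lebesgue_integral_def 1[symmetric] using int by (rule integral_inner_right[symmetric])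
qed

lemma first_moment_eq:
  "measure lborel S > 0 \<Longrightarrow> (LINT x:S|lborel. x) = measure lborel S *\<^sub>R center_of_mass S"
  by (simp add: center_of_mass_def)

text \<open>
  Where a body grows, the first moment grows by a vector whose pairing with \<open>e\<close> is controlled by the
  values of \<open>e\<close> on the difference.
\<close>

lemma moment_increment_bounds:
  fixes S T :: "'a::euclidean_space set"
  assumes "compact S" "compact T" "S \<subseteq> T" "\<And>x. x \<in> T - S \<Longrightarrow> a \<le> e \<bullet> x \<and> e \<bullet> x \<le> b"
  shows "a * (measure lborel T - measure lborel S) \<le> e \<bullet> (LINT x:T|lborel. x) - e \<bullet> (LINT x:S|lborel. x)"
    "e \<bullet> (LINT x:T|lborel. x) - e \<bullet> (LINT x:S|lborel. x) \<le> b * (measure lborel T - measure lborel S)"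
proof -
  have int: "integrable lborel (\<lambda>x. indicator X x * c)" if "compact X" for X :: "'a set" and c :: real
    using borel_integrable_compact[OF that, of "\<lambda>_. c"] by simp
  have vol: "(LINT x|lborel. indicator T x * c - indicator S x * c) = c * (measure lborel T - measure lborel S)" for c
    using int[OF assms(1), of c] int[OF assms(2), of c] assms(1,2)
    by (subst Bochner_Integration.integral_diff) (auto simp: algebra_simps borel_compact)
  have mom: "e \<bullet> (LINT x:T|lborel. x) - e \<bullet> (LINT x:S|lborel. x)
      = (LINT x|lborel. indicator T x * (e \<bullet> x) - indicator S x * (e \<bullet> x))"
    using inner_first_moment[OF assms(1), of e] inner_first_moment[OF assms(2), of e] by simp
  have ineq: "indicator T x * a - indicator S x * a \<le> indicator T x * (e \<bullet> x) - indicator S x * (e \<bullet> x)"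
    "indicator T x * (e \<bullet> x) - indicator S x * (e \<bullet> x) \<le> indicator T x * b - indicator S x * b" for x
    using assms(3) assms(4)[of x] by (auto simp: indicator_def)
  show "a * (measure lborel T - measure lborel S) \<le> e \<bullet> (LINT x:T|lborel. x) - e \<bullet> (LINT x:S|lborel. x)"
    unfolding mom vol[symmetric]
    using inner_first_moment(1)[OF assms(1), of e] inner_first_moment(1)[OF assms(2), of e] int assms(1,2) ineq
    by (intro integral_mono Bochner_Integration.integrable_diff) auto
  show "e \<bullet> (LINT x:T|lborel. x) - e \<bullet> (LINT x:S|lborel. x) \<le> b * (measure lborel T - measure lborel S)"
    unfolding mom vol[symmetric]
    using inner_first_moment(1)[OF assms(1), of e] inner_first_moment(1)[OF assms(2), of e] int assms(1,2) ineq
    by (intro integral_mono Bochner_Integration.integrable_diff) auto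
qed

lemma center_of_mass_strict:
  fixes \<eta> :: "'i \<Rightarrow> 'a::euclidean_space"
  assumes fp: "facet_polytope UNIV I \<eta> \<kappa>" and i: "i \<in> I"
  shows "\<eta> i \<bullet> center_of_mass (halfspace_inter UNIV I \<eta> \<kappa>) < \<kappa> i"
proof -
  let ?P = "halfspace_inter UNIV I \<eta> \<kappa>"
  obtain q where q: "\<And>i. i \<in> I \<Longrightarrow> \<eta> i \<bullet> q < \<kappa> i" using strict_interior_point[OF fp] by metis
  define c where "c = (\<eta> i \<bullet> q + \<kappa> i) / 2"
  have c: "\<eta> i \<bullet> q < c" "c < \<kappa> i" using q[OF i] by (auto simp: c_def)
  \<comment> \<open>cut the polytope at an intermediate level\<close>
  define S where "S = ?P \<inter> {x. \<eta> i \<bullet> x \<ge> c}"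
  have cP: "compact ?P" using fp by (rule compact_polytope)
  have cS: "compact S" unfolding S_def using cP by (intro compact_Int_closed closed_halfspace_ge)
  let ?U = "{x. \<forall>i\<in>I. \<eta> i \<bullet> x < \<kappa> i} \<inter> {x. \<eta> i \<bullet> x < c}"
  have "open {x. \<forall>i\<in>I. \<eta> i \<bullet> x < \<kappa> i}" using fp by (intro strict_neighbourhood) (simp add: facet_polytope_def)
  then have "open ?U" by (intro open_Int open_halfspace_lt)
  moreover have "q \<in> ?U" using q c by auto
  moreover have "?U \<subseteq> ?P - S" by (auto simp: S_def mem_halfspace_inter less_imp_le)
  ultimately have less: "measure lborel S < measure lborel ?P"
    using cP cS by (intro measure_less_if_open_between[of S ?P ?U]) (auto simp: S_def)
  have "\<eta> i \<bullet> (LINT x:?P|lborel. x) - \<eta> i \<bullet> (LINT x:S|lborel. x) \<le> c * (measure lborel ?P - measure lborel S)"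
  proof -
    obtain a where a: "\<And>x. x \<in> ?P \<Longrightarrow> a \<le> \<eta> i \<bullet> x"
    proof -
      have "bounded ((\<lambda>x. \<eta> i \<bullet> x) ` ?P)"
        using cP by (intro compact_imp_bounded compact_continuous_image continuous_intros)
      then obtain B where B: "\<And>x. x \<in> ?P \<Longrightarrow> \<bar>\<eta> i \<bullet> x\<bar> \<le> B" by (auto simp: bounded_iff)
      show thesis
      proof (rule that[of "- B"])
        fix x assume "x \<in> ?P"
        from B[OF this] show "- B \<le> \<eta> i \<bullet> x" by linarith
      qed
    qed
    show ?thesis
    proof (rule moment_increment_bounds(2)[OF cS cP])
      show "S \<subseteq> ?P" by (auto simp: S_def)
      fix x assume "x \<in> ?P - S"
      then show "a \<le> \<eta> i \<bullet> x \<and> \<eta> i \<bullet> x \<le> c" using a[of x] by (auto simp: S_def)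
    qed
  qed
  moreover have "\<eta> i \<bullet> (LINT x:S|lborel. x) \<le> \<kappa> i * measure lborel S"
  proof -
    have "\<eta> i \<bullet> (LINT x:S|lborel. x) - \<eta> i \<bullet> (LINT x:{}|lborel. x) \<le> \<kappa> i * (measure lborel S - measure lborel ({} :: 'a set))"
    proof (rule moment_increment_bounds(2)[OF compact_empty cS empty_subsetI])
      fix x assume "x \<in> S - {}"
      then show "c \<le> \<eta> i \<bullet> x \<and> \<eta> i \<bullet> x \<le> \<kappa> i" using i by (simp add: S_def mem_halfspace_inter)
    qed
    then show ?thesis by (simp add: set_lebesgue_integral_def)
  qed
  ultimately have "\<eta> i \<bullet> (LINT x:?P|lborel. x) \<le> c * (measure lborel ?P - measure lborel S) + \<kappa> i * measure lborel S"
    by linarith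
  also have "\<dots> < \<kappa> i * (measure lborel ?P - measure lborel S) + \<kappa> i * measure lborel S"
    using less c by (intro add_strict_right_mono mult_strict_right_mono) auto
  also have "\<dots> = \<kappa> i * measure lborel ?P" by (simp add: algebra_simps)
  finally have "measure lborel ?P * (\<eta> i \<bullet> center_of_mass ?P) < \<kappa> i * measure lborel ?P"
    using first_moment_eq[OF polytope_measure_pos[OF fp]] by simp
  then show ?thesis using polytope_measure_pos[OF fp] by (simp add: mult.commute)
qed

subsection \<open>Inessential functions are mass linear\<close>

text \<open>A symmetry fixes the center of mass and preserves slacks.\<close>

lemma equivalent_facets_center:
  fixes \<eta> :: "'i::finite \<Rightarrow> 'a::euclidean_space"
  assumes ss: "simple_or_smooth_polytope \<Lambda> \<eta> \<kappa>" and eq: "facets_equivalent \<Lambda> \<eta> \<kappa> i j"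
    and \<kappa>': "\<kappa>' \<in> chamber \<eta> \<kappa>"
  shows "\<eta> j \<bullet> center_of_mass (polytope_of \<eta> \<kappa>') - \<kappa>' $ j = \<eta> i \<bullet> center_of_mass (polytope_of \<eta> \<kappa>') - \<kappa>' $ i"
proof -
  obtain A \<tau> where \<tau>: "induces_permutation \<Lambda> \<eta> \<kappa> A \<tau>" "\<tau> i = j" using eq facets_equivalent_iff[OF ss] by blast
  obtain a where a: "symmetry \<Lambda> (polytope_of \<eta> \<kappa>') a A"
    using \<tau> \<kappa>' by (auto simp: induces_permutation_def robust_symmetry_def)
  have fp: "facet_polytope UNIV UNIV \<eta> (($) \<kappa>')"
    using \<kappa>' by (intro simple_imp_facet_polytope simple_if_in_chamber)
  note A = symmetry_linear_bij[OF a fp]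
  obtain b where "\<forall>x. a x = A x + b" using a by (auto simp: symmetry_def)
  then have b: "a = (\<lambda>x. A x + b)" by auto
  have "a (center_of_mass (polytope_of \<eta> \<kappa>')) = center_of_mass (a ` polytope_of \<eta> \<kappa>')"
    unfolding b using center_of_mass_affine_image[OF A(1,3) compact_polytope[OF fp] polytope_measure_pos[OF fp]] by simp
  also have "\<dots> = center_of_mass (polytope_of \<eta> \<kappa>')" using a by (simp add: symmetry_def)
  finally have fix_c: "a (center_of_mass (polytope_of \<eta> \<kappa>')) = center_of_mass (polytope_of \<eta> \<kappa>')" .
  have "\<forall>x. \<eta> (\<tau> i) \<bullet> a x - \<kappa>' $ \<tau> i = \<eta> i \<bullet> x - \<kappa>' $ i"
    using \<tau>(1) \<kappa>' a by (auto simp: induces_permutation_def)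
  from this[rule_format, of "center_of_mass (polytope_of \<eta> \<kappa>')"] show ?thesis by (simp add: fix_c \<tau>(2))
qed

lemma mass_linear_if_inessential:
  fixes \<eta> :: "'i::finite \<Rightarrow> 'a::euclidean_space"
  assumes ss: "simple_or_smooth_polytope \<Lambda> \<eta> \<kappa>" and H: "inessential \<Lambda> \<eta> \<kappa> H"
  shows "mass_linear \<eta> \<kappa> H"
proof -
  obtain \<beta> where \<beta>: "H = (\<Sum>i\<in>UNIV. \<beta> i *\<^sub>R \<eta> i)" "\<And>i. (\<Sum>k\<in>facet_class \<Lambda> \<eta> \<kappa> i. \<beta> k) = 0"
    using H by (auto simp: inessential_def facet_classes_eq)
  have "H \<bullet> center_of_mass (polytope_of \<eta> \<kappa>') = (\<Sum>i\<in>UNIV. \<beta> i * \<kappa>' $ i) + 0" if \<kappa>': "\<kappa>' \<in> chamber \<eta> \<kappa>" for \<kappa>'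
  proof -
    define s where "s k = \<eta> k \<bullet> center_of_mass (polytope_of \<eta> \<kappa>') - \<kappa>' $ k" for k
    have "(\<Sum>k | facet_class \<Lambda> \<eta> \<kappa> k = I. \<beta> k * s k) = 0" if "I \<in> range (facet_class \<Lambda> \<eta> \<kappa>)" for I
    proof -
      obtain i where i: "I = facet_class \<Lambda> \<eta> \<kappa> i" using \<open>I \<in> range (facet_class \<Lambda> \<eta> \<kappa>)\<close> by blast
      have "(\<Sum>k | facet_class \<Lambda> \<eta> \<kappa> k = I. \<beta> k * s k) = (\<Sum>k\<in>facet_class \<Lambda> \<eta> \<kappa> i. \<beta> k * s i)"
        unfolding i facet_class_fibre[OF ss]
      proof (rule sum.cong)
        fix k assume "k \<in> facet_class \<Lambda> \<eta> \<kappa> i"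
        then have "s k = s i" unfolding s_def facet_class_def
          using equivalent_facets_center[OF ss _ \<kappa>', of i k] by simp
        then show "\<beta> k * s k = \<beta> k * s i" by simp
      qed simp
      also have "\<dots> = 0" using \<beta>(2)[of i] by (simp add: sum_distrib_right[symmetric])
      finally show ?thesis .
    qed
    then have "(\<Sum>k\<in>UNIV. \<beta> k * s k) = 0"
      using sum_by_blocks[where p = "facet_class \<Lambda> \<eta> \<kappa>" and h = "\<lambda>k. \<beta> k * s k"] by simp
    then show ?thesis
      by (simp add: \<beta>(1) s_def inner_sum_left right_diff_distrib sum_subtractf)
  qed
  then show ?thesis unfolding mass_linear_def by blast
qed

section \<open>All linear functions mass linear\<close>

subsection \<open>Two facts on real functions\<close>

text \<open>
  The increments say that \<open>(v * \<phi>)' = v\<close> in the form of two inequalities; for affine \<open>\<phi>\<close> of slope \<open>b\<close>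
  this amounts to \<open>v' / v = (1 - b) / \<phi>\<close>.
\<close>

lemma log_derivative_from_increments:
  fixes v \<phi> :: "real \<Rightarrow> real"
  assumes pos: "\<And>t. \<bar>t\<bar> < r \<Longrightarrow> v t > 0" "\<And>t. \<bar>t\<bar> < r \<Longrightarrow> \<phi> t > 0"
    and \<phi>: "\<And>t. \<phi> t = a + b * t"
    and inc: "\<And>s t. \<bar>s\<bar> < r \<Longrightarrow> \<bar>t\<bar> < r \<Longrightarrow> s < t \<Longrightarrow>
      (t - s) * v s \<le> v t * \<phi> t - v s * \<phi> s \<and> v t * \<phi> t - v s * \<phi> s \<le> (t - s) * v t"
    and t: "\<bar>t\<bar> < r"
  shows "((\<lambda>t. ln (v t)) has_real_derivative (1 - b) / \<phi> t) (at t)"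
proof -
  define G where "G s = v s * \<phi> s" for s
  have near: "\<forall>\<^sub>F s in at t. \<bar>s\<bar> < r"
  proof -
    have "open {s::real. \<bar>s\<bar> < r}" by (intro open_Collect_less continuous_intros)
    then have "\<forall>\<^sub>F s in at t. s \<in> {s. \<bar>s\<bar> < r}" using t by (intro eventually_at_in_open') auto
    then show ?thesis by simp
  qed
  have mono: "v s \<le> v u" if "\<bar>s\<bar> < r" "\<bar>u\<bar> < r" "s < u" for s u
  proof -
    have "(u - s) * v s \<le> (u - s) * v u" using inc[OF that] by linarith
    then show ?thesis using that by simp
  qed
  \<comment> \<open>\<open>G' = v\<close>, since the difference quotient lies between two values of the monotone function \<open>v\<close>\<close>
  have quot: "min (v s) (v t) \<le> (G s - G t) / (s - t) \<and> (G s - G t) / (s - t) \<le> max (v s) (v t)"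
    if s: "\<bar>s\<bar> < r" "s \<noteq> t" for s
  proof (cases "s < t")
    case True
    have "(G s - G t) / (s - t) = (G t - G s) / (t - s)" by (metis minus_diff_eq minus_divide_divide)
    moreover have "v s \<le> (G t - G s) / (t - s)" "(G t - G s) / (t - s) \<le> v t"
      using inc[OF s(1) t True] True by (simp_all add: G_def pos_le_divide_eq pos_divide_le_eq mult.commute)
    ultimately show ?thesis by auto
  next
    case False
    then have st: "t < s" using s by simp
    have "v t \<le> (G s - G t) / (s - t)" "(G s - G t) / (s - t) \<le> v s"
      using inc[OF t s(1) st] st by (simp_all add: G_def pos_le_divide_eq pos_divide_le_eq mult.commute)
    then show ?thesis by auto
  qed
  define t1 where "t1 = (t + r) / 2"
  have t1: "t < t1" "t1 < r" using t by (auto simp: t1_def)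
  then have t1r: "\<bar>t1\<bar> < r" using t by auto
  have near1: "\<forall>\<^sub>F s in at t. s < t1" using t1(1) by (intro order_tendstoD(2)[OF tendsto_ident_at])
  have bound: "\<forall>\<^sub>F s in at t. \<bar>G s - G t\<bar> \<le> v t1 * \<bar>s - t\<bar>"
    using near near1 eventually_neq_at_within[of t]
  proof eventually_elim
    case (elim s)
    have "max (v s) (v t) \<le> v t1" using mono[of s t1] mono[of t t1] elim t t1 t1r by auto
    moreover have "min (v s) (v t) > 0" using pos elim t by simp
    ultimately have "\<bar>(G s - G t) / (s - t)\<bar> \<le> v t1" using quot[of s] elim by linarith
    then show ?case using elim by (simp add: abs_divide pos_divide_le_eq)
  qed
  have "((\<lambda>s. v t1 * \<bar>s - t\<bar>) \<longlongrightarrow> v t1 * \<bar>t - t\<bar>) (at t)" by (intro tendsto_intros)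
  then have "((\<lambda>s. v t1 * \<bar>s - t\<bar>) \<longlongrightarrow> 0) (at t)" by simp
  then have "((\<lambda>s. G s - G t) \<longlongrightarrow> 0) (at t)"
    by (rule Lim_null_comparison[rotated]) (use bound in simp)
  then have Glim: "(G \<longlongrightarrow> G t) (at t)" by (simp add: Lim_null[symmetric])
  have "(\<phi> \<longlongrightarrow> \<phi> t) (at t)" unfolding \<phi>[abs_def] by (intro tendsto_intros)
  then have "((\<lambda>s. G s / \<phi> s) \<longlongrightarrow> G t / \<phi> t) (at t)" using Glim pos(2)[OF t] by (intro tendsto_divide) auto
  moreover have ev: "\<forall>\<^sub>F s in at t. G s / \<phi> s = v s"
    using near by eventually_elim (use pos(2) in \<open>force simp: G_def\<close>)
  moreover have "G t / \<phi> t = v t" using pos(2)[OF t] by (simp add: G_def)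
  ultimately have vlim: "(v \<longlongrightarrow> v t) (at t)" using tendsto_cong[OF ev, of "v t"] by simp
  have "((\<lambda>s. (G s - G t) / (s - t)) \<longlongrightarrow> v t) (at t)"
  proof (rule tendsto_sandwich)
    show "\<forall>\<^sub>F s in at t. min (v s) (v t) \<le> (G s - G t) / (s - t)"
      using near eventually_neq_at_within[of t] by eventually_elim (use quot in blast)
    show "\<forall>\<^sub>F s in at t. (G s - G t) / (s - t) \<le> max (v s) (v t)"
      using near eventually_neq_at_within[of t] by eventually_elim (use quot in blast)
    show "((\<lambda>s. min (v s) (v t)) \<longlongrightarrow> v t) (at t)" using tendsto_min[OF vlim tendsto_const[of "v t"]] by simp
    show "((\<lambda>s. max (v s) (v t)) \<longlongrightarrow> v t) (at t)" using tendsto_max[OF vlim tendsto_const[of "v t"]] by simp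
  qed
  then have G': "(G has_real_derivative v t) (at t)" by (simp add: has_field_derivative_iff)
  have \<phi>': "(\<phi> has_real_derivative b) (at t)" unfolding \<phi>[abs_def] by (auto intro!: derivative_eq_intros)
  have "((\<lambda>s. ln (G s) - ln (\<phi> s)) has_real_derivative (1 / G t * v t - 1 / \<phi> t * b)) (at t)"
    using pos[OF t]
    by (intro DERIV_diff DERIV_chain2[OF DERIV_ln_divide G'] DERIV_chain2[OF DERIV_ln_divide \<phi>']) (auto simp: G_def)
  moreover have "1 / G t * v t - 1 / \<phi> t * b = (1 - b) / \<phi> t" using pos[OF t] by (simp add: G_def field_simps)
  ultimately have D: "((\<lambda>s. ln (G s) - ln (\<phi> s)) has_real_derivative (1 - b) / \<phi> t) (at t)" by simp
  show ?thesis
  proof (rule has_field_derivative_transform_within_open[OF D])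
    show "open {s::real. \<bar>s\<bar> < r}" by (intro open_Collect_less continuous_intros)
    show "t \<in> {s. \<bar>s\<bar> < r}" using t by simp
    fix s assume "s \<in> {s. \<bar>s\<bar> < r}"
    then have "v s > 0" "\<phi> s > 0" using pos by auto
    then show "ln (G s) - ln (\<phi> s) = ln (v s)" by (simp add: G_def ln_mult)
  qed
qed

text \<open>
  Equality of the mixed partial derivatives of a function of two variables whose partial
  derivatives are reciprocals of affine functions.
\<close>

lemma mixed_partials_reciprocal_affine:
  fixes g :: "real \<Rightarrow> real \<Rightarrow> real"
  assumes r: "r > 0"
    and pos: "\<And>s t. \<bar>s\<bar> < r \<Longrightarrow> \<bar>t\<bar> < r \<Longrightarrow> a + p * s + q * t > 0 \<and> a' + p' * s + q' * t > 0"
    and D1: "\<And>s t. \<bar>s\<bar> < r \<Longrightarrow> \<bar>t\<bar> < r \<Longrightarrow> ((\<lambda>s. g s t) has_real_derivative m / (a + p * s + q * t)) (at s)"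
    and D2: "\<And>s t. \<bar>s\<bar> < r \<Longrightarrow> \<bar>t\<bar> < r \<Longrightarrow> ((\<lambda>t. g s t) has_real_derivative m' / (a' + p' * s + q' * t)) (at t)"
  shows "m * q / a\<^sup>2 = m' * p' / a'\<^sup>2"
proof -
  have key: "\<exists>\<sigma> \<tau>. 0 < \<sigma> \<and> \<sigma> < h \<and> 0 < \<tau> \<and> \<tau> < h \<and>
    m * q / ((a + p * \<sigma> + q * h) * (a + p * \<sigma>)) = m' * p' / ((a' + p' * h + q' * \<tau>) * (a' + q' * \<tau>))"
    if h: "0 < h" "h < r" for h
  proof -
    have "((\<lambda>s. g s h - g s 0) has_real_derivative (m / (a + p * s + q * h) - m / (a + p * s + q * 0))) (at s)"
      if "0 \<le> s" "s \<le> h" for s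
      using that h by (intro DERIV_diff D1) auto
    from MVT2[OF h(1) this] obtain \<sigma> where \<sigma>: "0 < \<sigma>" "\<sigma> < h"
      "(g h h - g h 0) - (g 0 h - g 0 0) = h * (m / (a + p * \<sigma> + q * h) - m / (a + p * \<sigma>))" by auto
    have "((\<lambda>t. g h t - g 0 t) has_real_derivative (m' / (a' + p' * h + q' * t) - m' / (a' + p' * 0 + q' * t))) (at t)"
      if "0 \<le> t" "t \<le> h" for t
      using that h by (intro DERIV_diff D2) auto
    from MVT2[OF h(1) this] obtain \<tau> where \<tau>: "0 < \<tau>" "\<tau> < h"
      "(g h h - g 0 h) - (g h 0 - g 0 0) = h * (m' / (a' + p' * h + q' * \<tau>) - m' / (a' + q' * \<tau>))" by auto
    have "a + p * \<sigma> + q * h > 0" "a + p * \<sigma> > 0" "a' + p' * h + q' * \<tau> > 0" "a' + q' * \<tau> > 0"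
      using pos[of \<sigma> h] pos[of \<sigma> 0] pos[of h \<tau>] pos[of 0 \<tau>] h \<sigma> \<tau> by auto
    moreover from this have "m / (a + p * \<sigma> + q * h) - m / (a + p * \<sigma>) = - h * (m * q / ((a + p * \<sigma> + q * h) * (a + p * \<sigma>)))"
      "m' / (a' + p' * h + q' * \<tau>) - m' / (a' + q' * \<tau>) = - h * (m' * p' / ((a' + p' * h + q' * \<tau>) * (a' + q' * \<tau>)))"
      by (simp_all add: diff_frac_eq) (simp_all add: algebra_simps)
    moreover have "h * (m / (a + p * \<sigma> + q * h) - m / (a + p * \<sigma>)) = h * (m' / (a' + p' * h + q' * \<tau>) - m' / (a' + q' * \<tau>))"
      unfolding \<sigma>(3)[symmetric] \<tau>(3)[symmetric] by simp
    ultimately have "h * (- h * (m * q / ((a + p * \<sigma> + q * h) * (a + p * \<sigma>))))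
        = h * (- h * (m' * p' / ((a' + p' * h + q' * \<tau>) * (a' + q' * \<tau>))))"
      by (simp only:)
    moreover have "X = Y" if "h * (- h * X) = h * (- h * Y)" for X Y :: real using that h(1) by simp
    ultimately have "m * q / ((a + p * \<sigma> + q * h) * (a + p * \<sigma>)) = m' * p' / ((a' + p' * h + q' * \<tau>) * (a' + q' * \<tau>))"
      by blast
    with \<sigma> \<tau> show ?thesis by blast
  qed
  define h where "h n = r / 2 * inverse (real (Suc n))" for n
  have h: "0 < h n" "h n < r" for n
  proof -
    have "inverse (real (Suc n)) \<le> 1" by (simp add: inverse_le_1_iff)
    then have "r / 2 * inverse (real (Suc n)) \<le> r / 2 * 1" using r by (intro mult_left_mono) auto
    then show "0 < h n" "h n < r" using r by (auto simp: h_def)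
  qed
  obtain \<sigma> \<tau> where st: "\<And>n. 0 < \<sigma> n" "\<And>n. \<sigma> n < h n" "\<And>n. 0 < \<tau> n" "\<And>n. \<tau> n < h n"
    "\<And>n. m * q / ((a + p * \<sigma> n + q * h n) * (a + p * \<sigma> n)) = m' * p' / ((a' + p' * h n + q' * \<tau> n) * (a' + q' * \<tau> n))"
    using key[OF h] by metis
  have h0: "h \<longlonglongrightarrow> 0" unfolding h_def by (intro tendsto_mult_right_zero LIMSEQ_inverse_real_of_nat)
  have \<sigma>0: "\<sigma> \<longlonglongrightarrow> 0" using st by (intro tendsto_sandwich[OF _ _ tendsto_const h0]) (auto intro!: always_eventually less_imp_le)
  have \<tau>0: "\<tau> \<longlonglongrightarrow> 0" using st by (intro tendsto_sandwich[OF _ _ tendsto_const h0]) (auto intro!: always_eventually less_imp_le)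
  have a: "a > 0" "a' > 0" using pos[of 0 0] r by auto
  have "(\<lambda>n. m * q / ((a + p * \<sigma> n + q * h n) * (a + p * \<sigma> n))) \<longlonglongrightarrow> m * q / ((a + p * 0 + q * 0) * (a + p * 0))"
    using a by (intro tendsto_intros \<sigma>0 h0) auto
  moreover have "(\<lambda>n. m' * p' / ((a' + p' * h n + q' * \<tau> n) * (a' + q' * \<tau> n))) \<longlonglongrightarrow> m' * p' / ((a' + p' * 0 + q' * 0) * (a' + q' * 0))"
    using a by (intro tendsto_intros \<tau>0 h0) auto
  ultimately have "m * q / ((a + p * 0 + q * 0) * (a + p * 0)) = m' * p' / ((a' + p' * 0 + q' * 0) * (a' + q' * 0))"
    unfolding st(5) by (rule LIMSEQ_unique)
  then show ?thesis by (simp add: power2_eq_square)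
qed

subsection \<open>A center of mass that is affine in the support numbers\<close>

text \<open>On the ball of radius \<open>e\<close> around \<open>\<kappa>\<close>, the center of mass is the affine function with coefficients \<open>w\<close>.\<close>

locale affine_center =
  fixes \<eta> :: "'i::finite \<Rightarrow> 'a::euclidean_space" and \<kappa> :: "real ^ 'i" and e :: real
    and w :: "'i \<Rightarrow> 'a" and C :: 'a
  assumes e: "e > 0"
    and fp: "\<And>\<kappa>'. \<kappa>' \<in> ball \<kappa> e \<Longrightarrow> facet_polytope UNIV UNIV \<eta> (($) \<kappa>')"
    and center: "\<And>\<kappa>'. \<kappa>' \<in> ball \<kappa> e \<Longrightarrow>
      center_of_mass (polytope_of \<eta> \<kappa>') = (\<Sum>j\<in>UNIV. \<kappa>' $ j *\<^sub>R w j) + C"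
begin

text \<open>Volume, the slack of the center in each facet inequality, and the partial derivatives of the slack.\<close>

definition vol :: "real ^ 'i \<Rightarrow> real" where "vol \<kappa>' = measure lborel (polytope_of \<eta> \<kappa>')"
definition slack :: "'i \<Rightarrow> real ^ 'i \<Rightarrow> real" where
  "slack i \<kappa>' = \<kappa>' $ i - \<eta> i \<bullet> ((\<Sum>j\<in>UNIV. \<kappa>' $ j *\<^sub>R w j) + C)"
definition D :: "'i \<Rightarrow> 'i \<Rightarrow> real" where "D i j = of_bool (i = j) - \<eta> i \<bullet> w j"

lemma slack_center: "\<kappa>' \<in> ball \<kappa> e \<Longrightarrow> \<eta> i \<bullet> center_of_mass (polytope_of \<eta> \<kappa>') = \<kappa>' $ i - slack i \<kappa>'"
  by (simp add: slack_def center)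

lemma slack_pos: "\<kappa>' \<in> ball \<kappa> e \<Longrightarrow> slack i \<kappa>' > 0"
  using center_of_mass_strict[OF fp, of \<kappa>' i] slack_center[of \<kappa>' i] by simp

lemma vol_pos: "\<kappa>' \<in> ball \<kappa> e \<Longrightarrow> vol \<kappa>' > 0"
  unfolding vol_def using fp by (rule polytope_measure_pos)

lemma slack_add: "slack i (\<kappa>' + u) = slack i \<kappa>' + (\<Sum>k\<in>UNIV. D i k * u $ k)"
proof -
  have "(\<Sum>k\<in>UNIV. D i k * u $ k) = (\<Sum>k\<in>UNIV. if k = i then u $ k else 0) - (\<Sum>k\<in>UNIV. \<eta> i \<bullet> w k * u $ k)"
    unfolding sum_subtractf[symmetric] by (rule sum.cong) (auto simp: D_def algebra_simps)
  also have "\<dots> = u $ i - \<eta> i \<bullet> (\<Sum>k\<in>UNIV. u $ k *\<^sub>R w k)" by (simp add: inner_sum_right mult.commute)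
  finally show ?thesis by (simp add: slack_def scaleR_add_left sum.distrib inner_add_right)
qed

lemma slack_axis: "slack i (\<kappa>' + t *\<^sub>R axis j 1) = slack i \<kappa>' + D i j * t"
proof -
  have "(\<Sum>k\<in>UNIV. D i k * (t *\<^sub>R axis j 1 :: real ^ 'i) $ k) = (\<Sum>k\<in>UNIV. if k = j then D i k * t else 0)"
    by (rule sum.cong) (auto simp: axis_def)
  then show ?thesis unfolding slack_add by simp
qed

text \<open>
  Raising the support number of facet \<open>i\<close> adds a slab on which \<open>\<eta> i\<close> varies between its old and its new
  value; this squeezes the change of the first moment, hence that of the volume.
\<close>

lemma slab_increment:
  assumes s: "\<kappa>' + s *\<^sub>R axis i 1 \<in> ball \<kappa> e" and t: "\<kappa>' + t *\<^sub>R axis i 1 \<in> ball \<kappa> e" and st: "s < t"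
  defines "v \<equiv> \<lambda>t. vol (\<kappa>' + t *\<^sub>R axis i 1)" and "f \<equiv> \<lambda>t. slack i (\<kappa>' + t *\<^sub>R axis i 1)"
  shows "(t - s) * v s \<le> v t * f t - v s * f s" "v t * f t - v s * f s \<le> (t - s) * v t"
proof -
  let ?k = "\<lambda>t. \<kappa>' + t *\<^sub>R axis i 1 :: real ^ 'i"
  have coord: "?k t $ i = \<kappa>' $ i + t" for t by simp
  have other: "?k t $ k = \<kappa>' $ k" if "k \<noteq> i" for k t using that by (simp add: axis_def)
  have moment: "\<eta> i \<bullet> (LINT x:polytope_of \<eta> (?k u)|lborel. x) = v u * (\<kappa>' $ i + u - f u)" if "?k u \<in> ball \<kappa> e" for u
    using first_moment_eq[OF polytope_measure_pos[OF fp[OF that]]] slack_center[OF that, of i]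
    by (simp add: v_def f_def vol_def)
  have sub: "polytope_of \<eta> (?k s) \<subseteq> polytope_of \<eta> (?k t)"
  proof
    fix x assume x: "x \<in> polytope_of \<eta> (?k s)"
    have "\<eta> k \<bullet> x \<le> ?k t $ k" for k
    proof -
      have "\<eta> k \<bullet> x \<le> ?k s $ k" using x by (simp add: mem_halfspace_inter)
      also have "\<dots> \<le> ?k t $ k" 
      proof (cases "k = i")
        case True
        then show ?thesis using st coord by simp
      next
        case False
        show ?thesis by (simp only: other[OF False])
      qed
      finally show ?thesis .
    qed
    then show "x \<in> polytope_of \<eta> (?k t)" by (simp add: mem_halfspace_inter)
  qed
  have slab: "\<kappa>' $ i + s \<le> \<eta> i \<bullet> x \<and> \<eta> i \<bullet> x \<le> \<kappa>' $ i + t"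
    if x: "x \<in> polytope_of \<eta> (?k t) - polytope_of \<eta> (?k s)" for x
  proof -
    have le: "\<eta> k \<bullet> x \<le> ?k t $ k" for k using x by (simp add: mem_halfspace_inter)
    obtain k where k: "\<not> \<eta> k \<bullet> x \<le> ?k s $ k" using x by (auto simp: mem_halfspace_inter)
    have "k = i"
    proof (rule ccontr)
      assume "k \<noteq> i"
      from k le[of k] show False by (simp only: other[OF \<open>k \<noteq> i\<close>])
    qed
    then show ?thesis using k le[of i] coord by simp
  qed
  have cs: "compact (polytope_of \<eta> (?k s))" "compact (polytope_of \<eta> (?k t))"
    using compact_polytope[OF fp[OF s]] compact_polytope[OF fp[OF t]] .
  have "(\<kappa>' $ i + s) * (v t - v s) \<le> v t * (\<kappa>' $ i + t - f t) - v s * (\<kappa>' $ i + s - f s)"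
    using moment_increment_bounds(1)[OF cs sub slab] unfolding moment[OF s] moment[OF t] by (simp add: v_def vol_def)
  then show "v t * f t - v s * f s \<le> (t - s) * v t" by (simp add: algebra_simps)
  have "v t * (\<kappa>' $ i + t - f t) - v s * (\<kappa>' $ i + s - f s) \<le> (\<kappa>' $ i + t) * (v t - v s)"
    using moment_increment_bounds(2)[OF cs sub slab] unfolding moment[OF s] moment[OF t] by (simp add: v_def vol_def)
  then show "(t - s) * v s \<le> v t * f t - v s * f s" by (simp add: algebra_simps)
qed

lemma in_ball_axis:
  assumes "\<bar>t\<bar> < e - dist \<kappa> \<kappa>'"
  shows "\<kappa>' + t *\<^sub>R axis i 1 \<in> ball \<kappa> e"
proof -
  have "dist \<kappa> (\<kappa>' + t *\<^sub>R axis i 1) \<le> dist \<kappa> \<kappa>' + dist \<kappa>' (\<kappa>' + t *\<^sub>R axis i 1)" by (rule dist_triangle)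
  also have "dist \<kappa>' (\<kappa>' + t *\<^sub>R axis i 1) = \<bar>t\<bar>" by (simp add: dist_norm)
  finally show ?thesis using assms by simp
qed

lemma log_vol_derivative:
  assumes r: "r \<le> e - dist \<kappa> \<kappa>'" and t: "\<bar>t\<bar> < r"
  shows "((\<lambda>t. ln (vol (\<kappa>' + t *\<^sub>R axis i 1))) has_real_derivative (\<eta> i \<bullet> w i) / slack i (\<kappa>' + t *\<^sub>R axis i 1)) (at t)"
proof -
  have ib: "\<kappa>' + u *\<^sub>R axis i 1 \<in> ball \<kappa> e" if "\<bar>u\<bar> < r" for u using that r by (intro in_ball_axis) simp
  have "((\<lambda>t. ln (vol (\<kappa>' + t *\<^sub>R axis i 1))) has_real_derivative (1 - D i i) / slack i (\<kappa>' + t *\<^sub>R axis i 1)) (at t)"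
  proof (rule log_derivative_from_increments[where r = r and a = "slack i \<kappa>'"])
    show "slack i (\<kappa>' + t *\<^sub>R axis i 1) = slack i \<kappa>' + D i i * t" for t by (rule slack_axis)
  qed (use ib vol_pos slack_pos slab_increment t in blast)+
  then show ?thesis by (simp add: D_def)
qed

text \<open>The volume increases strictly with each support number.\<close>

lemma weight_pos: "\<eta> i \<bullet> w i > 0"
proof (rule ccontr)
  assume neg: "\<not> ?thesis"
  define t where "t = e / 2"
  have t: "t > 0" "\<kappa> + t *\<^sub>R axis i 1 \<in> ball \<kappa> e"
    using e in_ball_axis[of t \<kappa> i] by (simp_all only: t_def dist_self)
  have \<kappa>: "\<kappa> \<in> ball \<kappa> e" using e by simp
  let ?k = "\<kappa> + t *\<^sub>R axis i 1 :: real ^ 'i"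
  have "vol \<kappa> < vol ?k"
  proof -
    obtain p where p: "\<eta> i \<bullet> p = \<kappa> $ i" "\<And>k. k \<noteq> i \<Longrightarrow> \<eta> k \<bullet> p < \<kappa> $ k"
      using facet_only_point[OF fp[OF \<kappa>], of i] by auto
    let ?U = "{x. \<forall>k\<in>UNIV. \<eta> k \<bullet> x < ?k $ k} \<inter> {x. \<eta> i \<bullet> x > \<kappa> $ i}"
    have other: "?k $ k = (if k = i then \<kappa> $ i + t else \<kappa> $ k)" for k by (simp add: axis_def)
    have oN: "open {x. \<forall>k\<in>UNIV. \<eta> k \<bullet> x < ?k $ k}" by (intro strict_neighbourhood) simp
    moreover have "p \<in> {x. \<forall>k\<in>UNIV. \<eta> k \<bullet> x < ?k $ k}" using p t(1) unfolding other by auto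
    ultimately have "\<forall>\<^sub>F s in at_right 0. p + s *\<^sub>R \<eta> i \<in> {x. \<forall>k\<in>UNIV. \<eta> k \<bullet> x < ?k $ k}"
    proof -
      have "((\<lambda>s. p + s *\<^sub>R \<eta> i) \<longlongrightarrow> p + 0 *\<^sub>R \<eta> i) (at_right 0)" by (intro tendsto_intros)
      then show ?thesis using oN \<open>p \<in> _\<close> by (intro topological_tendstoD) auto
    qed
    moreover have "\<forall>\<^sub>F s::real in at_right 0. s > 0" by (simp add: eventually_at_right_less)
    ultimately have "\<forall>\<^sub>F s in at_right 0. s > 0 \<and> p + s *\<^sub>R \<eta> i \<in> {x. \<forall>k\<in>UNIV. \<eta> k \<bullet> x < ?k $ k}"
      by eventually_elim simp
    then obtain s where s: "s > 0" "p + s *\<^sub>R \<eta> i \<in> {x. \<forall>k\<in>UNIV. \<eta> k \<bullet> x < ?k $ k}"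
      by (auto dest!: eventually_happens)
    have "\<eta> i \<noteq> 0" using fp[OF \<kappa>] by (auto simp: facet_polytope_def)
    then have "p + s *\<^sub>R \<eta> i \<in> ?U" using s p by (auto simp: inner_add_right)
    moreover have "open ?U" using oN by (intro open_Int open_halfspace_gt)
    moreover have "?U \<subseteq> polytope_of \<eta> ?k - polytope_of \<eta> \<kappa>"
    proof
      fix x assume x: "x \<in> ?U"
      then have "\<eta> k \<bullet> x \<le> ?k $ k" for k by (blast intro: less_imp_le)
      then have "x \<in> polytope_of \<eta> ?k" by (simp only: mem_halfspace_inter) blast
      moreover have "\<not> \<eta> i \<bullet> x \<le> \<kappa> $ i" using x by simp
      then have "x \<notin> polytope_of \<eta> \<kappa>" by (auto simp: mem_halfspace_inter)
      ultimately show "x \<in> polytope_of \<eta> ?k - polytope_of \<eta> \<kappa>" by blast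
    qed
    moreover have "polytope_of \<eta> \<kappa> \<subseteq> polytope_of \<eta> ?k"
    proof
      fix x assume "x \<in> polytope_of \<eta> \<kappa>"
      then have x: "\<eta> k \<bullet> x \<le> \<kappa> $ k" for k by (simp add: mem_halfspace_inter)
      have "\<eta> k \<bullet> x \<le> ?k $ k" for k using x[of k] t(1) unfolding other by auto
      then show "x \<in> polytope_of \<eta> ?k" by (simp add: mem_halfspace_inter)
    qed
    ultimately show ?thesis unfolding vol_def
      using compact_polytope[OF fp[OF \<kappa>]] compact_polytope[OF fp[OF t(2)]]
      by (intro measure_less_if_open_between[of _ _ ?U]) auto
  qed
  moreover have "vol ?k * slack i ?k - vol \<kappa> * slack i \<kappa> \<le> t * vol ?k"
    using slab_increment(2)[of \<kappa> 0 i t] t \<kappa> by simp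
  moreover have "slack i ?k = slack i \<kappa> + t * (1 - \<eta> i \<bullet> w i)" by (simp add: slack_axis D_def)
  ultimately have "slack i \<kappa> * (vol ?k - vol \<kappa>) \<le> t * (\<eta> i \<bullet> w i) * vol ?k" by (simp add: algebra_simps)
  also have "\<dots> \<le> 0" using neg t(1) vol_pos[OF t(2)] by (simp add: mult_nonneg_nonpos mult_nonpos_nonneg)
  finally show False using slack_pos[OF \<kappa>, of i] \<open>vol \<kappa> < vol ?k\<close> by (simp add: mult_le_0_iff)
qed

text \<open>
  Symmetry of the second partial derivatives of the logarithm of the volume, whose \<open>i\<close>-th partial
  derivative is \<open>(\<eta> i \<bullet> w i) / slack i\<close>.
\<close>

lemma slack_symmetry:
  assumes \<kappa>': "\<kappa>' \<in> ball \<kappa> e"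
  shows "\<eta> i \<bullet> w i * D i j / (slack i \<kappa>')\<^sup>2 = \<eta> j \<bullet> w j * D j i / (slack j \<kappa>')\<^sup>2"
proof -
  define r where "r = (e - dist \<kappa> \<kappa>') / 2"
  have r: "r > 0" using \<kappa>' by (simp add: r_def)
  have room: "r \<le> e - dist \<kappa> (\<kappa>' + s *\<^sub>R axis k 1)" if "\<bar>s\<bar> < r" for s k
  proof -
    have "dist \<kappa> (\<kappa>' + s *\<^sub>R axis k 1) \<le> dist \<kappa> \<kappa>' + dist \<kappa>' (\<kappa>' + s *\<^sub>R axis k 1)" by (rule dist_triangle)
    also have "dist \<kappa>' (\<kappa>' + s *\<^sub>R axis k 1) = \<bar>s\<bar>" by (simp add: dist_norm)
    finally show ?thesis using that by (simp add: r_def)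
  qed
  let ?k = "\<lambda>s t. \<kappa>' + s *\<^sub>R axis i 1 + t *\<^sub>R axis j 1 :: real ^ 'i"
  have swap: "?k s t = \<kappa>' + t *\<^sub>R axis j 1 + s *\<^sub>R axis i 1" for s t by simp
  have ib: "?k s t \<in> ball \<kappa> e" if "\<bar>s\<bar> < r" "\<bar>t\<bar> < r" for s t
    using that room[OF that(1), of i] by (intro in_ball_axis) simp
  have sl: "slack i (?k s t) = slack i \<kappa>' + D i i * s + D i j * t" "slack j (?k s t) = slack j \<kappa>' + D j i * s + D j j * t" for s t
    by (simp_all add: slack_axis)
  show ?thesis
  proof (rule mixed_partials_reciprocal_affine[OF r, where g = "\<lambda>s t. ln (vol (?k s t))"])
    fix s t :: real assume st: "\<bar>s\<bar> < r" "\<bar>t\<bar> < r"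
    show "slack i \<kappa>' + D i i * s + D i j * t > 0 \<and> slack j \<kappa>' + D j i * s + D j j * t > 0"
      using slack_pos[OF ib[OF st]] by (simp add: sl[symmetric])
    show "((\<lambda>s. ln (vol (?k s t))) has_real_derivative (\<eta> i \<bullet> w i) / (slack i \<kappa>' + D i i * s + D i j * t)) (at s)"
      unfolding sl[symmetric] swap using log_vol_derivative[OF room[OF st(2)] st(1)] .
    show "((\<lambda>t. ln (vol (?k s t))) has_real_derivative (\<eta> j \<bullet> w j) / (slack j \<kappa>' + D j i * s + D j j * t)) (at t)"
      unfolding sl[symmetric] using log_vol_derivative[OF room[OF st(1)] st(2)] .
  qed
qed

text \<open>
  If one of two slacks depends on the other's support number, then the square of their quotient is
  constant, so that they are proportional.
\<close>

lemma slacks_proportional: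
  assumes ij: "D i j \<noteq> 0"
  shows "\<exists>t>0. \<forall>k. D i k = t * D j k"
proof -
  define \<rho> where "\<rho> = (\<eta> i \<bullet> w i * D i j) / (\<eta> j \<bullet> w j * D j i)"
  have \<kappa>: "\<kappa> \<in> ball \<kappa> e" using e by simp
  have sp: "slack l \<kappa>' \<noteq> 0" if "\<kappa>' \<in> ball \<kappa> e" for l \<kappa>' using slack_pos[OF that, of l] by simp
  have "D j i \<noteq> 0" using slack_symmetry[OF \<kappa>, of i j] ij weight_pos[of i] sp[OF \<kappa>] by auto
  have sq: "(slack i \<kappa>')\<^sup>2 = \<rho> * (slack j \<kappa>')\<^sup>2" if "\<kappa>' \<in> ball \<kappa> e" for \<kappa>'
    using slack_symmetry[OF that, of i j] weight_pos[of j] sp[OF that] \<open>D j i \<noteq> 0\<close>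
    by (simp add: \<rho>_def field_simps)
  have "\<rho> > 0"
  proof -
    have "\<rho> * (slack j \<kappa>)\<^sup>2 > 0" using sq[OF \<kappa>] sp[OF \<kappa>, of i] by (metis zero_less_power2)
    then show ?thesis by (simp add: zero_less_mult_iff)
  qed
  define t where "t = sqrt \<rho>"
  have t: "t > 0" using \<open>\<rho> > 0\<close> by (simp add: t_def)
  have prop_slack: "slack i \<kappa>' = t * slack j \<kappa>'" if "\<kappa>' \<in> ball \<kappa> e" for \<kappa>'
  proof (rule power2_eq_imp_eq)
    show "(slack i \<kappa>')\<^sup>2 = (t * slack j \<kappa>')\<^sup>2" using sq[OF that] \<open>\<rho> > 0\<close> by (simp add: t_def power_mult_distrib)
  qed (use slack_pos[OF that] t in \<open>auto intro: less_imp_le\<close>)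
  have "D i k = t * D j k" for k
  proof -
    have "\<kappa> + (e / 2) *\<^sub>R axis k 1 \<in> ball \<kappa> e" using e by (intro in_ball_axis) simp
    from prop_slack[OF this] prop_slack[OF \<kappa>] have "D i k * (e / 2) = t * D j k * (e / 2)"
      by (simp add: slack_axis algebra_simps)
    then show ?thesis using e by simp
  qed
  with t show ?thesis by blast
qed

text \<open>Translating the polytope does not change the slacks, so each row of \<open>D\<close> is a linear relation.\<close>

lemma row_relation: "(\<Sum>k\<in>UNIV. D i k *\<^sub>R \<eta> k) = 0"
proof -
  define x where "x = (\<Sum>k\<in>UNIV. D i k *\<^sub>R \<eta> k)"
  define u :: "real ^ 'i" where "u = (\<chi> k. \<eta> k \<bullet> x)"
  define s where "s = e / (2 * (norm u + 1))"
  have s: "s > 0" using e by (simp add: s_def add_nonneg_pos)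
  have "norm (s *\<^sub>R u) < e"
  proof -
    have "norm u / (norm u + 1) < 1" by (simp add: add_nonneg_pos)
    then have "e / 2 * (norm u / (norm u + 1)) < e / 2 * 1" using e by (intro mult_strict_left_mono) auto
    moreover have "norm (s *\<^sub>R u) = e / 2 * (norm u / (norm u + 1))"
      using s e unfolding norm_scaleR by (simp add: s_def abs_of_pos)
    ultimately show ?thesis using e by linarith
  qed
  then have ib: "\<kappa> + s *\<^sub>R u \<in> ball \<kappa> e" by (simp add: dist_norm)
  have \<kappa>: "\<kappa> \<in> ball \<kappa> e" using e by simp
  have "polytope_of \<eta> (\<kappa> + s *\<^sub>R u) = (\<lambda>y. y + s *\<^sub>R x) ` polytope_of \<eta> \<kappa>"
  proof (intro equalityI subsetI)
    fix y assume "y \<in> polytope_of \<eta> (\<kappa> + s *\<^sub>R u)"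
    then have "y - s *\<^sub>R x \<in> polytope_of \<eta> \<kappa>" by (auto simp: mem_halfspace_inter u_def inner_diff_right algebra_simps)
    then show "y \<in> (\<lambda>y. y + s *\<^sub>R x) ` polytope_of \<eta> \<kappa>" by (rule image_eqI[rotated]) simp
  qed (auto simp: mem_halfspace_inter u_def inner_add_right)
  then have "center_of_mass (polytope_of \<eta> (\<kappa> + s *\<^sub>R u)) = center_of_mass (polytope_of \<eta> \<kappa>) + s *\<^sub>R x"
    using center_of_mass_affine_image[of "\<lambda>y. y" "polytope_of \<eta> \<kappa>" "s *\<^sub>R x"] linear_ident
      compact_polytope[OF fp[OF \<kappa>]] polytope_measure_pos[OF fp[OF \<kappa>]] by simp
  then have "slack i (\<kappa> + s *\<^sub>R u) = slack i \<kappa>"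
    using slack_center[OF ib, of i] slack_center[OF \<kappa>, of i] by (simp add: inner_add_right u_def)
  then have "(\<Sum>k\<in>UNIV. D i k * (s *\<^sub>R u) $ k) = 0" unfolding slack_add by simp
  also have "(\<Sum>k\<in>UNIV. D i k * (s *\<^sub>R u) $ k) = s * (x \<bullet> x)"
  proof -
    have "x \<bullet> x = (\<Sum>k\<in>UNIV. D i k * (\<eta> k \<bullet> x))" by (subst (1) x_def) (simp add: inner_sum_left)
    then show ?thesis by (simp add: u_def sum_distrib_left mult_ac)
  qed
  finally show ?thesis using s by (simp add: x_def)
qed

text \<open>Conversely the rows span all relations; the blocks are the classes of proportional rows.\<close>

lemma relation_expand:
  assumes "(\<Sum>k\<in>UNIV. \<beta> k *\<^sub>R \<eta> k) = 0"
  shows "\<beta> j = (\<Sum>i\<in>UNIV. \<beta> i * D i j)"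
proof -
  have "(\<Sum>i\<in>UNIV. \<beta> i * D i j) = (\<Sum>i\<in>UNIV. if i = j then \<beta> i else 0) - (\<Sum>i\<in>UNIV. \<beta> i * (\<eta> i \<bullet> w j))"
    unfolding sum_subtractf[symmetric] by (rule sum.cong) (auto simp: D_def algebra_simps)
  also have "(\<Sum>i\<in>UNIV. \<beta> i * (\<eta> i \<bullet> w j)) = (\<Sum>k\<in>UNIV. \<beta> k *\<^sub>R \<eta> k) \<bullet> w j" by (simp add: inner_sum_left)
  finally show ?thesis using assms by simp
qed

text \<open>The indices whose row of \<open>D\<close> is a positive multiple of row \<open>i\<close>.\<close>

definition proportional_rows :: "'i \<Rightarrow> 'i set" where
  "proportional_rows i = {k. \<exists>t>0. \<forall>l. D k l = t * D i l}"

lemma proportional_rows_eq_iff: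
  "proportional_rows i = proportional_rows j \<longleftrightarrow> (\<exists>t>0. \<forall>l. D i l = t * D j l)"
proof
  assume eq: "proportional_rows i = proportional_rows j"
  have "i \<in> proportional_rows i" unfolding proportional_rows_def by (auto intro: exI[of _ 1])
  then show "\<exists>t>0. \<forall>l. D i l = t * D j l" unfolding eq by (simp add: proportional_rows_def)
next
  assume "\<exists>t>0. \<forall>l. D i l = t * D j l"
  then obtain t where t: "t > 0" "\<And>l. D i l = t * D j l" by blast
  have "k \<in> proportional_rows j" if "k \<in> proportional_rows i" for k
  proof -
    obtain s where "s > 0" "\<forall>l. D k l = s * D i l" using \<open>k \<in> proportional_rows i\<close> by (auto simp: proportional_rows_def)
    then have "s * t > 0" "\<forall>l. D k l = s * t * D j l" using t by auto
    then show ?thesis unfolding proportional_rows_def by blast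
  qed
  moreover have "k \<in> proportional_rows i" if "k \<in> proportional_rows j" for k
  proof -
    obtain s where "s > 0" "\<forall>l. D k l = s * D j l" using \<open>k \<in> proportional_rows j\<close> by (auto simp: proportional_rows_def)
    then have "s / t > 0" "\<forall>l. D k l = s / t * D i l" using t by auto
    then show ?thesis unfolding proportional_rows_def by blast
  qed
  ultimately show "proportional_rows i = proportional_rows j" by blast
qed

lemma blocks: "\<exists>\<mu>. simplex_blocks \<eta> \<mu> proportional_rows"
proof -
  have \<kappa>: "\<kappa> \<in> ball \<kappa> e" using e by simp
  obtain \<mu> where \<mu>: "\<And>i. \<mu> i > (0::real)" "(\<Sum>i\<in>UNIV. \<mu> i *\<^sub>R \<eta> i) = 0"
    using positive_relation[OF fp[OF \<kappa>]] by auto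
  let ?p = proportional_rows
  have zero: "D i j = 0" if "?p i \<noteq> ?p j" for i j
    using slacks_proportional[of i j] that proportional_rows_eq_iff[of i j] by blast
  have expand: "\<beta> j = (\<Sum>i | ?p i = ?p j. \<beta> i * D i j)" if "(\<Sum>k\<in>UNIV. \<beta> k *\<^sub>R \<eta> k) = 0" for \<beta> j
    unfolding relation_expand[OF that, of j] using zero by (intro sum.mono_neutral_right) auto
  have "simplex_blocks \<eta> \<mu> ?p"
    unfolding simplex_blocks_def
  proof (intro conjI allI impI)
    show "\<mu> i > 0" for i by (rule \<mu>(1))
  next
    fix i
    let ?B = "{k. ?p k = ?p i}"
    have "(\<Sum>k\<in>?B. \<mu> k *\<^sub>R \<eta> k) = (\<Sum>k\<in>?B. (\<Sum>l\<in>?B. \<mu> l * D l k) *\<^sub>R \<eta> k)"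
    proof (rule sum.cong)
      fix k assume "k \<in> ?B"
      then have "{l. ?p l = ?p k} = ?B" by simp
      then show "\<mu> k *\<^sub>R \<eta> k = (\<Sum>l\<in>?B. \<mu> l * D l k) *\<^sub>R \<eta> k" using expand[OF \<mu>(2), of k] by simp
    qed simp
    also have "\<dots> = (\<Sum>k\<in>UNIV. (\<Sum>l\<in>?B. \<mu> l * D l k) *\<^sub>R \<eta> k)"
      using zero by (intro sum.mono_neutral_left) auto
    also have "\<dots> = (\<Sum>l\<in>?B. \<mu> l *\<^sub>R (\<Sum>k\<in>UNIV. D l k *\<^sub>R \<eta> k))"
      by (simp add: scaleR_sum_left scaleR_sum_right sum.swap[of _ ?B])
    also have "\<dots> = 0" by (simp add: row_relation)
    finally show "(\<Sum>k\<in>?B. \<mu> k *\<^sub>R \<eta> k) = 0" .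
  next
    fix \<beta> i j assume rel: "(\<Sum>k\<in>UNIV. \<beta> k *\<^sub>R \<eta> k) = 0" and ij: "?p i = ?p j"
    have "\<forall>l. \<exists>t. ?p l = ?p i \<longrightarrow> (\<forall>k. D l k = t * D i k)" using proportional_rows_eq_iff[of _ i] by blast
    then obtain t where t: "\<And>l k. ?p l = ?p i \<Longrightarrow> D l k = t l * D i k" by metis
    have row: "\<gamma> k = (\<Sum>l | ?p l = ?p i. \<gamma> l * t l) * D i k"
      if "(\<Sum>k\<in>UNIV. \<gamma> k *\<^sub>R \<eta> k) = 0" "?p k = ?p i" for \<gamma> k
    proof -
      have "\<gamma> k = (\<Sum>l | ?p l = ?p i. \<gamma> l * D l k)" using expand[OF that(1), of k] that(2) by simp
      also have "\<dots> = (\<Sum>l | ?p l = ?p i. \<gamma> l * t l * D i k)"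
      proof (rule sum.cong)
        fix l assume "l \<in> {l. ?p l = ?p i}"
        then have "D l k = t l * D i k" by (intro t) simp
        then show "\<gamma> l * D l k = \<gamma> l * t l * D i k" by (simp only: mult.assoc)
      qed simp
      finally show ?thesis by (simp add: sum_distrib_right)
    qed
    show "\<beta> i * \<mu> j = \<beta> j * \<mu> i"
      using row[OF rel, of i] row[OF rel, of j] row[OF \<mu>(2), of i] row[OF \<mu>(2), of j] ij by simp
  qed
  then show ?thesis by blast
qed

end

lemma blocks_if_all_mass_linear:
  fixes \<eta> :: "'i::finite \<Rightarrow> 'a::euclidean_space"
  assumes simp: "simple_polytope UNIV UNIV \<eta> (($) \<kappa>)" and all: "\<And>H. mass_linear \<eta> \<kappa> H"
  shows "\<exists>\<mu> (p :: 'i \<Rightarrow> 'i set). simplex_blocks \<eta> \<mu> p"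
proof -
  obtain e where e: "e > 0" "ball \<kappa> e \<subseteq> chamber \<eta> \<kappa>" using chamber_ball[OF simp] .
  obtain \<gamma> C where \<gamma>: "\<And>H \<kappa>'. \<kappa>' \<in> chamber \<eta> \<kappa> \<Longrightarrow>
      H \<bullet> center_of_mass (polytope_of \<eta> \<kappa>') = (\<Sum>i\<in>UNIV. \<gamma> H i * \<kappa>' $ i) + C H"
    using all unfolding mass_linear_def by metis
  interpret affine_center \<eta> \<kappa> e "\<lambda>j. \<Sum>b\<in>Basis. \<gamma> b j *\<^sub>R b" "\<Sum>b\<in>Basis. C b *\<^sub>R b"
  proof
    show "e > 0" by fact
    fix \<kappa>' assume "\<kappa>' \<in> ball \<kappa> e"
    then have \<kappa>': "\<kappa>' \<in> chamber \<eta> \<kappa>" using e by blast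
    then show "facet_polytope UNIV UNIV \<eta> (($) \<kappa>')" by (intro simple_imp_facet_polytope simple_if_in_chamber)
    show "center_of_mass (polytope_of \<eta> \<kappa>') = (\<Sum>j\<in>UNIV. \<kappa>' $ j *\<^sub>R (\<Sum>b\<in>Basis. \<gamma> b j *\<^sub>R b)) + (\<Sum>b\<in>Basis. C b *\<^sub>R b)"
    proof (rule euclidean_eqI)
      fix b :: 'a assume b: "b \<in> Basis"
      have proj: "(\<Sum>b\<in>Basis. h b *\<^sub>R b) \<bullet> b = h b" for h using b by (rule inner_sum_left_Basis)
      show "center_of_mass (polytope_of \<eta> \<kappa>') \<bullet> b = ((\<Sum>j\<in>UNIV. \<kappa>' $ j *\<^sub>R (\<Sum>b\<in>Basis. \<gamma> b j *\<^sub>R b)) + (\<Sum>b\<in>Basis. C b *\<^sub>R b)) \<bullet> b"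
        unfolding inner_add_left inner_sum_left[where A = "UNIV :: 'i set"] inner_scaleR_left proj
        using \<gamma>[OF \<kappa>', of b] by (subst inner_commute) (simp add: mult.commute)
    qed
  qed
  from blocks show ?thesis by blast
qed

section \<open>The equivalence\<close>

theorem theorem1p20:
  fixes \<eta> :: "'i::finite \<Rightarrow> 'a::euclidean_space"
    and \<kappa> :: "real ^ 'i"
    and \<Lambda> :: "'a set option"
  assumes "simple_or_smooth_polytope \<Lambda> \<eta> \<kappa>"
  shows "((\<forall>H. mass_linear \<eta> \<kappa> H) \<longleftrightarrow> (\<forall>H. inessential \<Lambda> \<eta> \<kappa> H)) \<and>
    ((\<forall>H. inessential \<Lambda> \<eta> \<kappa> H) \<longleftrightarrow> product_of_simplices \<Lambda> (polytope_of \<eta> \<kappa>)) \<and>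
    (product_of_simplices \<Lambda> (polytope_of \<eta> \<kappa>) \<longleftrightarrow>
       (\<forall>I \<in> facet_classes \<Lambda> \<eta> \<kappa>. (\<Inter>i\<in>I. facet_of_index \<eta> \<kappa> i) = {})) \<and>
    ((\<forall>I \<in> facet_classes \<Lambda> \<eta> \<kappa>. (\<Inter>i\<in>I. facet_of_index \<eta> \<kappa> i) = {}) \<longrightarrow>
       (\<forall>I \<in> facet_classes \<Lambda> \<eta> \<kappa>. card I > 1))"
proof -
  let ?i = "\<forall>H. mass_linear \<eta> \<kappa> H" and ?ii = "\<forall>H. inessential \<Lambda> \<eta> \<kappa> H"
    and ?iii = "product_of_simplices \<Lambda> (polytope_of \<eta> \<kappa>)"
    and ?iv = "\<forall>I \<in> facet_classes \<Lambda> \<eta> \<kappa>. (\<Inter>i\<in>I. facet_of_index \<eta> \<kappa> i) = {}"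
  note ss = assms
  have "?ii" if all: "?i"
  proof -
    obtain \<mu> and p :: "'i \<Rightarrow> 'i set" where "simplex_blocks \<eta> \<mu> p"
      using blocks_if_all_mass_linear[OF simple_if_simple_or_smooth[OF ss]] all by blast
    then show ?thesis using inessential_if_blocks[OF ss] blocks_normalized[OF ss] by blast
  qed
  moreover have "?i" if "?ii" using mass_linear_if_inessential[OF ss] that by blast
  moreover have "?iii" if "?ii" using product_if_blocks[OF ss] blocks_if_all_inessential[OF ss] that by blast
  moreover have "?ii \<and> ?iv" if "?iii"
    using blocks_if_product[OF ss that] inessential_if_blocks[OF ss] class_intersections_empty_if_blocks[OF ss]
    by blast
  moreover have "?iii" if "?iv" using product_if_blocks[OF ss] blocks_if_class_intersections_empty[OF ss] that by blast
  moreover have "\<forall>I \<in> facet_classes \<Lambda> \<eta> \<kappa>. card I > 1" if "?iv" using card_facet_class_gt_1[OF ss] that by blast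
  ultimately show ?thesis by blast
qed

end
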